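(* Let $V\subseteq L^2(\mathbb{R}^d)$ be a nonzero finitely generated shift-invariant space and let $L:V\to V$ be a normal bounded shift-preserving operator. Then there exist $m\in\mathbb{N}$, $s$-eigenvalues $\Lambda_1,\dots,\Lambda_m$ of $L$, and pairwise orthogonal shift-invariant subspaces $V_1,\dots,V_m$ of $V$ such that $V$ is the orthogonal direct sum of $V_1,\dots,V_m$ and $$L=\sum_{j=1}^m \Lambda_j P_{V_j},$$ where $P_{S}$ denotes the orthogonal projection onto a closed subspace $S$. Furthermore, each $V_j$ is invariant under $L$, so that $Lf=\Lambda_j f$ for all $f\in V_j$, $j=1,\dots,m$.
   Context: For $k\in\mathbb{Z}^d$, $T_kf(x)=f(x-k)$. A closed subspace $V\subseteq L^2(\mathbb{R}^d)$ is shift invariant if $T_kf\in V$ for all $f\in V$, $k\in\mathbb{Z}^d$; it is finitely generated if $V=\overline{\mathrm{span}}\{T_k\varphi:\varphi\in\Phi,\ k\in\mathbb{Z}^d\}$ for some finite set $\Phi\subset L^2(\mathbb{R}^d)$. An operator $L:V\to V$ is shift preserving if it is bounded and linear and $LT_k=T_kL$ for all $k\in\mathbb{Z}^d$. Let $\hat f(\omega)=\int_{\mathbb{R}^d} f(x)e^{-2\pi i\langle\omega,x\rangle}dx$ denote the Fourier transform, and let $\mathcal{T}:L^2(\mathbb{R}^d)\to L^2([0,1)^d,\ell^2(\mathbb{Z}^d))$ be the isometric isomorphism $\mathcal{T}f(\omega)=\{\hat f(\omega+k)\}_{k\in\mathbb{Z}^d}$. A sequence $a=\{a_k\}\in\ell^2(\mathbb{Z}^d)$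 is of bounded spectrum if $\hat a\in L^\infty([0,1)^d)$, where $\hat a(\omega)=\sum_{k\in\mathbb{Z}^d}a_ke^{-2\pi i\langle\omega,k\rangle}$. For such $a$, $\Lambda_a:L^2(\mathbb{R}^d)\to L^2(\mathbb{R}^d)$ is the bounded operator determined by $\mathcal{T}(\Lambda_af)(\omega)=\hat a(\omega)\mathcal{T}f(\omega)$ for a.e. $\omega$ (formally $\Lambda_a=\sum_k a_kT_k$). For a bounded shift-preserving $L:V\to V$ and $a$ of bounded spectrum, $\Lambda_a$ is an $s$-eigenvalue of $L$ if $\ker(L-\Lambda_a)=\{f\in V: Lf=\Lambda_af\}\neq\{0\}$. *)

theory Defs
  imports "HOL-Analysis.Analysis"
begin

text \<open>
  Representatives are Borel functions. Since every Lebesgue measurable function agrees almost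
  everywhere with a Borel one, the quotient below is the usual space of classes of Lebesgue
  measurable functions.
\<close>

definition sq_integrable :: "(real ^ 'n \<Rightarrow> complex) \<Rightarrow> bool" where
  "sq_integrable f \<longleftrightarrow>
     f \<in> borel_measurable lborel \<and> integrable lborel (\<lambda>x. (cmod (f x))\<^sup>2)"

definition L2_rel :: "(real ^ 'n \<Rightarrow> complex) \<Rightarrow> (real ^ 'n \<Rightarrow> complex) \<Rightarrow> bool" where
  "L2_rel f g \<longleftrightarrow> sq_integrable f \<and> sq_integrable g \<and> (AE x in lborel. f x = g x)"

lemma sq_integrable_zero: "sq_integrable (\<lambda>_. 0)"
  by (simp add: sq_integrable_def)

lemma sq_integrable_cmult:
  assumes "sq_integrable f"
  shows "sq_integrable (\<lambda>x. c * f x)"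
  using assms unfolding sq_integrable_def by (auto simp: norm_mult power_mult_distrib)

lemma sq_integrable_mult_cnj:
  assumes f: "sq_integrable f" and g: "sq_integrable g"
  shows "integrable lborel (\<lambda>x. f x * cnj (g x))"
proof (rule Bochner_Integration.integrable_bound)
  show "integrable lborel (\<lambda>x. (cmod (f x))\<^sup>2 + (cmod (g x))\<^sup>2)"
    using f g by (simp add: sq_integrable_def)
  have [measurable]: "f \<in> borel_measurable lborel" "g \<in> borel_measurable lborel"
    using f g by (simp_all add: sq_integrable_def)
  have [measurable]: "cnj \<in> borel_measurable borel"
    by (intro borel_measurable_continuous_onI continuous_intros)
  show "(\<lambda>x. f x * cnj (g x)) \<in> borel_measurable lborel"
    by measurable
  have "cmod (f x * cnj (g x)) \<le> (cmod (f x))\<^sup>2 + (cmod (g x))\<^sup>2" for x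
  proof -
    have "0 \<le> (cmod (f x) - cmod (g x))\<^sup>2" "0 \<le> cmod (f x) * cmod (g x)"
      by simp_all
    then show ?thesis
      unfolding norm_mult complex_mod_cnj power2_diff by linarith
  qed
  then show "AE x in lborel. cmod (f x * cnj (g x))
      \<le> norm ((cmod (f x))\<^sup>2 + (cmod (g x))\<^sup>2)"
    by simp
qed

lemma sq_integrable_add:
  assumes f: "sq_integrable f" and g: "sq_integrable g"
  shows "sq_integrable (\<lambda>x. f x + g x)"
proof -
  have [measurable]: "f \<in> borel_measurable lborel" "g \<in> borel_measurable lborel"
    using f g by (simp_all add: sq_integrable_def)
  have "integrable lborel (\<lambda>x. (cmod (f x + g x))\<^sup>2)"
  proof (rule Bochner_Integration.integrable_bound)
    show "integrable lborel (\<lambda>x. 2 * (cmod (f x))\<^sup>2 + 2 * (cmod (g x))\<^sup>2)"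
      using f g by (simp add: sq_integrable_def)
    have "(cmod (f x + g x))\<^sup>2 \<le> 2 * (cmod (f x))\<^sup>2 + 2 * (cmod (g x))\<^sup>2" for x
    proof -
      have "(cmod (f x + g x))\<^sup>2 \<le> (cmod (f x) + cmod (g x))\<^sup>2"
        by (simp add: norm_triangle_ineq power_mono)
      moreover have "0 \<le> (cmod (f x) - cmod (g x))\<^sup>2"
        by simp
      ultimately show ?thesis
        unfolding power2_diff power2_sum by linarith
    qed
    then show "AE x in lborel. norm ((cmod (f x + g x))\<^sup>2)
        \<le> norm (2 * (cmod (f x))\<^sup>2 + 2 * (cmod (g x))\<^sup>2)"
      by simp
  qed measurable
  then show ?thesis
    by (simp add: sq_integrable_def)
qed

quotient_type (overloaded) 'n L2 = "real ^ 'n \<Rightarrow> complex" / partial: L2_rel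
  morphisms rep_L2 abs_L2
proof (rule part_equivpI)
  show "\<exists>f :: real ^ 'n \<Rightarrow> complex. L2_rel f f"
    using sq_integrable_zero by (auto simp: L2_rel_def)
  show "symp L2_rel"
    by (auto simp: symp_def L2_rel_def elim: eventually_mono)
  show "transp L2_rel"
    unfolding transp_def L2_rel_def
    by (auto elim: eventually_elim2)
qed

lemma sq_integrable_rep_L2: "sq_integrable (rep_L2 f)"
  using Quotient_rep_reflp[OF Quotient_L2] by (auto simp: L2_rel_def)

lemma rep_abs_L2: "sq_integrable f \<Longrightarrow> AE x in lborel. rep_L2 (abs_L2 f) x = f x"
  using Quotient_rep_abs[OF Quotient_L2, of f] by (auto simp: L2_rel_def)

lemma L2_eq_iff: "f = g \<longleftrightarrow> (AE x in lborel. rep_L2 f x = rep_L2 g x)"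
  using Quotient_rel_rep[OF Quotient_L2, of f g] sq_integrable_rep_L2[of f] sq_integrable_rep_L2[of g]
  by (auto simp: L2_rel_def)

lift_definition cinner :: "'n::finite L2 \<Rightarrow> 'n L2 \<Rightarrow> complex" is
  "\<lambda>f g. LINT x|lborel. f x * cnj (g x)"
proof -
  fix f f' g g' :: "real ^ 'n \<Rightarrow> complex"
  assume f: "L2_rel f f'" and g: "L2_rel g g'"
  show "(LINT x|lborel. f x * cnj (g x)) = (LINT x|lborel. f' x * cnj (g' x))"
  proof (rule integral_cong_AE)
    show "(\<lambda>x. f x * cnj (g x)) \<in> borel_measurable lborel"
      "(\<lambda>x. f' x * cnj (g' x)) \<in> borel_measurable lborel"
      using f g sq_integrable_mult_cnj borel_measurable_integrable
      unfolding L2_rel_def by blast+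
    have "AE x in lborel. f x = f' x" "AE x in lborel. g x = g' x"
      using f g by (auto simp: L2_rel_def)
    then show "AE x in lborel. f x * cnj (g x) = f' x * cnj (g' x)"
      by eventually_elim simp
  qed
qed

lift_definition scaleC :: "complex \<Rightarrow> 'n::finite L2 \<Rightarrow> 'n L2" (infixr "*\<^sub>C" 75) is
  "\<lambda>c f x. c * f x"
  by (auto simp: L2_rel_def sq_integrable_cmult elim: eventually_mono)

instantiation L2 :: (finite) ab_group_add
begin

lift_definition zero_L2 :: "'a L2" is "\<lambda>_. 0"
  by (simp add: L2_rel_def sq_integrable_zero)

lift_definition plus_L2 :: "'a L2 \<Rightarrow> 'a L2 \<Rightarrow> 'a L2" is "\<lambda>f g x. f x + g x"
  by (auto simp: L2_rel_def sq_integrable_add elim: eventually_elim2)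

definition uminus_L2 :: "'a L2 \<Rightarrow> 'a L2" where
  "uminus_L2 f = (-1) *\<^sub>C f"

definition minus_L2 :: "'a L2 \<Rightarrow> 'a L2 \<Rightarrow> 'a L2" where
  "minus_L2 f g = f + (-1) *\<^sub>C g"

instance
proof
  fix a b c :: "'a L2"
  show "a + b + c = a + (b + c)"
    by transfer (auto simp: L2_rel_def sq_integrable_add add.assoc)
  show "a + b = b + a"
    by transfer (auto simp: L2_rel_def sq_integrable_add add.commute)
  show "0 + a = a"
    by transfer (auto simp: L2_rel_def)
  show "- a + a = 0"
    unfolding uminus_L2_def
    by transfer (auto simp: L2_rel_def sq_integrable_zero)
  show "a - b = a + - b"
    by (simp add: minus_L2_def uminus_L2_def)
qed

end

lemma scaleC_one: "1 *\<^sub>C f = f"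
  by transfer (auto simp: L2_rel_def)

lemma scaleC_scaleC: "a *\<^sub>C b *\<^sub>C f = (a * b) *\<^sub>C f"
  by transfer (auto simp: L2_rel_def sq_integrable_cmult mult.assoc)

lemma scaleC_add_right: "a *\<^sub>C (f + g) = a *\<^sub>C f + a *\<^sub>C g"
  by transfer (auto simp: L2_rel_def sq_integrable_cmult sq_integrable_add distrib_left)

lemma scaleC_add_left: "(a + b) *\<^sub>C f = a *\<^sub>C f + b *\<^sub>C f"
  by transfer (auto simp: L2_rel_def sq_integrable_cmult sq_integrable_add distrib_right)

lemma cinner_commute: "cinner f g = cnj (cinner g f)"
  by (simp add: cinner.rep_eq mult.commute flip: Bochner_Integration.integral_cnj)

lemma cinner_add_left: "cinner (f + g) h = cinner f h + cinner g h"
  by transfer (simp add: L2_rel_def distrib_right sq_integrable_mult_cnj)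

lemma cinner_scaleC_left: "cinner (c *\<^sub>C f) g = c * cinner f g"
  by transfer (simp add: mult.assoc)

lemma cinner_self: "cinner f f = complex_of_real (LINT x|lborel. (cmod (rep_L2 f x))\<^sup>2)"
  by (simp add: cinner.rep_eq complex_norm_square[symmetric] flip: integral_complex_of_real)

lemma cinner_self_eq_0:
  assumes "cinner f f = 0"
  shows "f = 0"
proof -
  have "(LINT x|lborel. (cmod (rep_L2 f x))\<^sup>2) = 0"
    using assms by (simp add: cinner_self)
  then have "AE x in lborel. rep_L2 f x = 0"
    using sq_integrable_rep_L2[of f]
    by (subst (asm) integral_nonneg_eq_0_iff_AE) (auto simp: sq_integrable_def)
  moreover have "AE x in lborel. rep_L2 (0 :: 'a L2) x = 0"
    using rep_abs_L2[OF sq_integrable_zero] by (simp add: zero_L2_def)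
  ultimately have "AE x in lborel. rep_L2 f x = rep_L2 0 x"
    by eventually_elim simp
  then show ?thesis
    by (simp add: L2_eq_iff)
qed

instantiation L2 :: (finite) real_vector
begin

definition scaleR_L2 :: "real \<Rightarrow> 'a L2 \<Rightarrow> 'a L2" where
  "scaleR_L2 r f = complex_of_real r *\<^sub>C f"

instance
proof
  fix a b :: real and x y :: "'a L2"
  show "a *\<^sub>R (x + y) = a *\<^sub>R x + a *\<^sub>R y"
    by (simp add: scaleR_L2_def scaleC_add_right)
  show "(a + b) *\<^sub>R x = a *\<^sub>R x + b *\<^sub>R x"
    by (simp add: scaleR_L2_def scaleC_add_left)
  show "a *\<^sub>R b *\<^sub>R x = (a * b) *\<^sub>R x"
    by (simp add: scaleR_L2_def scaleC_scaleC)
  show "1 *\<^sub>R x = x"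
    by (simp add: scaleR_L2_def scaleC_one)
qed

end

instantiation L2 :: (finite) real_inner
begin

definition inner_L2 :: "'a L2 \<Rightarrow> 'a L2 \<Rightarrow> real" where
  "inner_L2 f g = Re (cinner f g)"

definition norm_L2 :: "'a L2 \<Rightarrow> real" where
  "norm_L2 f = sqrt (f \<bullet> f)"

definition sgn_L2 :: "'a L2 \<Rightarrow> 'a L2" where
  "sgn_L2 f = f /\<^sub>R norm f"

definition dist_L2 :: "'a L2 \<Rightarrow> 'a L2 \<Rightarrow> real" where
  "dist_L2 f g = norm (f - g)"

definition uniformity_L2 :: "('a L2 \<times> 'a L2) filter" where
  "uniformity_L2 = (INF e\<in>{0<..}. principal {(x, y). dist x y < e})"

definition open_L2 :: "'a L2 set \<Rightarrow> bool" where
  "open_L2 U \<longleftrightarrow> (\<forall>x\<in>U. eventually (\<lambda>(x', y). x' = x \<longrightarrow> y \<in> U) uniformity)"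

instance
proof
  fix a :: real and x y z :: "'a L2" and U :: "'a L2 set"
  show "dist x y = norm (x - y)"
    by (simp add: dist_L2_def)
  show "sgn x = x /\<^sub>R norm x"
    by (simp add: sgn_L2_def)
  show "uniformity = (INF e\<in>{0<..}. principal {(x :: 'a L2, y). dist x y < e})"
    by (simp add: uniformity_L2_def)
  show "open U \<longleftrightarrow> (\<forall>x\<in>U. eventually (\<lambda>(x', y). x' = x \<longrightarrow> y \<in> U) uniformity)"
    by (simp add: open_L2_def)
  show "x \<bullet> y = y \<bullet> x"
    unfolding inner_L2_def by (subst cinner_commute) simp
  show "(x + y) \<bullet> z = x \<bullet> z + y \<bullet> z"
    by (simp add: inner_L2_def cinner_add_left)
  show "(a *\<^sub>R x) \<bullet> y = a * (x \<bullet> y)"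
    by (simp add: inner_L2_def scaleR_L2_def cinner_scaleC_left)
  show "0 \<le> x \<bullet> x"
    by (simp add: inner_L2_def cinner_self)
  show "x \<bullet> x = 0 \<longleftrightarrow> x = 0"
  proof
    assume "x \<bullet> x = 0"
    then have "cinner x x = 0"
      by (simp add: inner_L2_def cinner_self)
    then show "x = 0"
      by (rule cinner_self_eq_0)
  next
    assume "x = 0"
    moreover have "cinner (0 + 0) y = cinner 0 y + cinner 0 y" for y :: "'a L2"
      by (rule cinner_add_left)
    ultimately show "x \<bullet> x = 0"
      by (simp add: inner_L2_def)
  qed
  show "norm x = sqrt (x \<bullet> x)"
    by (simp add: norm_L2_def)
qed

end

global_interpretation L2_complex: vector_space "scaleC :: complex \<Rightarrow> 'n L2 \<Rightarrow> 'n::finite L2"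
  defines csubspace = L2_complex.subspace
    and cspan = L2_complex.span
  by unfold_locales
    (simp_all add: scaleC_add_right scaleC_add_left scaleC_scaleC scaleC_one)

definition of_int_vec :: "int ^ 'n \<Rightarrow> real ^ 'n" where
  "of_int_vec k = (\<chi> i. of_int (k $ i))"

lemma sq_integrable_translate:
  assumes "sq_integrable f"
  shows "sq_integrable (\<lambda>x. f (x - c))"
proof -
  have "integrable (distr lborel borel ((+) (- c))) (\<lambda>x. (cmod (f x))\<^sup>2)"
    using assms unfolding lborel_distr_plus by (simp add: sq_integrable_def)
  then show ?thesis
    using assms by (subst (asm) integrable_distr_eq) (auto simp: sq_integrable_def)
qed

lemma AE_lborel_translate:
  fixes c :: "'a::euclidean_space"
  assumes "AE x in lborel. P x"
  shows "AE x in lborel. P (x - c)"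
proof -
  have "AE x in distr lborel borel ((+) (- c)). P x"
    using assms unfolding lborel_distr_plus .
  then show ?thesis
    using AE_distrD[of "(+) (- c)" lborel borel P] by simp
qed

lift_definition shift :: "int ^ 'n \<Rightarrow> 'n::finite L2 \<Rightarrow> 'n L2" is
  "\<lambda>k f x. f (x - of_int_vec k)"
  unfolding L2_rel_def
proof (intro conjI; elim conjE)
  fix k :: "int ^ 'n" and f g :: "real ^ 'n \<Rightarrow> complex"
  assume "AE x in lborel. f x = g x"
  then show "AE x in lborel. f (x - of_int_vec k) = g (x - of_int_vec k)"
    by (rule AE_lborel_translate)
qed (simp_all add: sq_integrable_translate)

definition shift_invariant :: "'n::finite L2 set \<Rightarrow> bool" where
  "shift_invariant V \<longleftrightarrow> csubspace V \<and> closed V \<and> (\<forall>k. \<forall>f\<in>V. shift k f \<in> V)"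

definition finitely_generated :: "'n::finite L2 set \<Rightarrow> bool" where
  "finitely_generated V \<longleftrightarrow>
     (\<exists>\<Phi>. finite \<Phi> \<and> V = closure (cspan {shift k \<phi> | k \<phi>. \<phi> \<in> \<Phi>}))"

definition bounded_clinear_on :: "'n::finite L2 set \<Rightarrow> ('n L2 \<Rightarrow> 'n L2) \<Rightarrow> bool" where
  "bounded_clinear_on V L \<longleftrightarrow>
     (\<forall>f\<in>V. \<forall>g\<in>V. L (f + g) = L f + L g) \<and>
     (\<forall>c. \<forall>f\<in>V. L (c *\<^sub>C f) = c *\<^sub>C L f) \<and>
     (\<exists>C. \<forall>f\<in>V. norm (L f) \<le> C * norm f)"

definition shift_preserving :: "'n::finite L2 set \<Rightarrow> ('n L2 \<Rightarrow> 'n L2) \<Rightarrow> bool" where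
  "shift_preserving V L \<longleftrightarrow>
     L ` V \<subseteq> V \<and> bounded_clinear_on V L \<and> (\<forall>k. \<forall>f\<in>V. L (shift k f) = shift k (L f))"

text \<open>
  The adjoint of an operator on the Hilbert space \<open>V\<close>; it is well defined on \<open>V\<close> when \<open>V\<close> is a
  closed subspace and \<open>L\<close> is a bounded operator from \<open>V\<close> to \<open>V\<close>.
\<close>

definition adjoint_on :: "'n::finite L2 set \<Rightarrow> ('n L2 \<Rightarrow> 'n L2) \<Rightarrow> 'n L2 \<Rightarrow> 'n L2" where
  "adjoint_on V L g = (THE h. h \<in> V \<and> (\<forall>f\<in>V. cinner (L f) g = cinner f h))"

definition normal_on :: "'n::finite L2 set \<Rightarrow> ('n L2 \<Rightarrow> 'n L2) \<Rightarrow> bool" where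
  "normal_on V L \<longleftrightarrow> (\<forall>f\<in>V. L (adjoint_on V L f) = adjoint_on V L (L f))"

definition orth_proj :: "'n::finite L2 set \<Rightarrow> 'n L2 \<Rightarrow> 'n L2" where
  "orth_proj S f = (THE p. p \<in> S \<and> (\<forall>g\<in>S. cinner (f - p) g = 0))"

text \<open>
  The Fourier transform on \<open>L\<^sup>2\<close> is the unique continuous extension of the integral
  transform from the dense subspace of integrable square-integrable functions.
\<close>

definition fourier_integral :: "(real ^ 'n \<Rightarrow> complex) \<Rightarrow> real ^ 'n \<Rightarrow> complex" where
  "fourier_integral f \<omega> = (LINT x|lborel. f x * exp (- 2 * pi * \<i> * (\<omega> \<bullet> x)))"

definition fourier_L2 :: "'n::finite L2 \<Rightarrow> 'n L2" where
  "fourier_L2 = (THE F. bounded_linear F \<and>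
     (\<forall>f. integrable lborel (rep_L2 f) \<longrightarrow>
        (AE \<omega> in lborel. rep_L2 (F f) \<omega> = fourier_integral (rep_L2 f) \<omega>)))"

definition unit_cube :: "(real ^ 'n) set" where
  "unit_cube = {\<omega>. \<forall>i. 0 \<le> \<omega> $ i \<and> \<omega> $ i < 1}"

definition fiberization :: "'n::finite L2 \<Rightarrow> real ^ 'n \<Rightarrow> int ^ 'n \<Rightarrow> complex" where
  "fiberization f \<omega> = (\<lambda>k. rep_L2 (fourier_L2 f) (\<omega> + of_int_vec k))"

text \<open>
  Square-integrable functions on the unit cube are identified with their extensions by zero, so
  that Fourier series with square-summable coefficients converge in the norm of \<open>L2\<close>.
\<close>

lemma unit_cube_sets [measurable]: "(unit_cube :: (real ^ 'n) set) \<in> sets borel"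
  unfolding unit_cube_def by measurable

lemma sq_integrable_character:
  "sq_integrable (\<lambda>\<omega> :: real ^ 'n. if \<omega> \<in> unit_cube
     then exp (- 2 * pi * \<i> * (\<omega> \<bullet> of_int_vec k)) else 0)" (is "sq_integrable ?e")
proof -
  have cont: "continuous_on UNIV (\<lambda>\<omega> :: real ^ 'n. exp (- 2 * pi * \<i> * (\<omega> \<bullet> of_int_vec k)))"
    by (intro continuous_intros)
  have meas: "?e \<in> borel_measurable lborel"
    using borel_measurable_continuous_onI[OF cont] by (intro measurable_If_set) auto
  have "emeasure lborel (unit_cube :: (real ^ 'n) set) < \<infinity>"
  proof (rule le_less_trans[OF emeasure_mono])
    show "unit_cube \<subseteq> cbox (0 :: real ^ 'n) 1"
      by (auto simp: unit_cube_def mem_box_cart less_imp_le)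
    show "emeasure lborel (cbox (0 :: real ^ 'n) 1) < \<infinity>"
      using emeasure_lborel_cbox_finite by simp
  qed simp
  then have "integrable lborel (\<lambda>\<omega>. indicator unit_cube (\<omega> :: real ^ 'n) :: real)"
    by (simp add: integrable_indicator_iff)
  moreover have "(\<lambda>\<omega>. (cmod (?e \<omega>))\<^sup>2) = indicator unit_cube"
    by (auto simp: fun_eq_iff indicator_def norm_exp_eq_Re)
  ultimately show ?thesis
    using meas by (simp add: sq_integrable_def)
qed

lift_definition character :: "int ^ 'n \<Rightarrow> 'n::finite L2" is
  "\<lambda>k \<omega>. if \<omega> \<in> unit_cube then exp (- 2 * pi * \<i> * (\<omega> \<bullet> of_int_vec k)) else 0"
  using sq_integrable_character by (simp add: L2_rel_def)

definition symbol :: "(int ^ 'n \<Rightarrow> complex) \<Rightarrow> 'n::finite L2" where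
  "symbol a = (\<Sum>\<^sub>\<infinity>k. a k *\<^sub>C character k)"

definition bounded_spectrum :: "(int ^ 'n::finite \<Rightarrow> complex) \<Rightarrow> bool" where
  "bounded_spectrum a \<longleftrightarrow>
     (\<lambda>k. (cmod (a k))\<^sup>2) summable_on UNIV \<and>
     (\<exists>C. AE \<omega> in lborel. \<omega> \<in> unit_cube \<longrightarrow> cmod (rep_L2 (symbol a) \<omega>) \<le> C)"

definition Lambda :: "(int ^ 'n \<Rightarrow> complex) \<Rightarrow> 'n::finite L2 \<Rightarrow> 'n L2" where
  "Lambda a f = (THE g. AE \<omega> in lborel. \<omega> \<in> unit_cube \<longrightarrow>
     fiberization g \<omega> = (\<lambda>k. rep_L2 (symbol a) \<omega> * fiberization f \<omega> k))"

definition s_eigenvalue ::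
  "'n::finite L2 set \<Rightarrow> ('n L2 \<Rightarrow> 'n L2) \<Rightarrow> ('n L2 \<Rightarrow> 'n L2) \<Rightarrow> bool" where
  "s_eigenvalue V L \<Lambda> \<longleftrightarrow>
     (\<exists>a. bounded_spectrum a \<and> \<Lambda> = Lambda a) \<and> {f \<in> V. L f = \<Lambda> f} \<noteq> {0}"

end

theory Submission
  imports Defs "HOL-Computational_Algebra.Fundamental_Theorem_Algebra"
begin

text \<open>
  The Fourier transform, cut into fibers over the unit cube, turns \<open>V\<close> into a field of subspaces of
  the square-summable families on \<open>int ^ 'n\<close>, translations into multiplication by scalars, and
  \<open>L\<close> into a field of operators.  If \<open>V\<close> has \<open>n\<close> generators, the fibers have dimension at most
  \<open>n\<close> (\<open>AE_linear_relation\<close>), and the operators on the fibers have norm at most that of \<open>L\<close>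
  (\<open>fiber_bound\<close>).  Hence, for \<open>\<phi>\<close> in \<open>V\<close> and almost every \<open>\<omega>\<close>, the orbit of \<open>\<phi>\<close> under
  \<open>L\<close> satisfies a linear relation of length \<open>n + 1\<close> in the fiber at \<open>\<omega>\<close>, and factoring the
  corresponding polynomial gives \<open>n\<close> roots in a fixed disc such that the product of the factors
  \<open>L - z\<close> annihilates \<open>\<phi>\<close> there (\<open>annihilating_roots\<close>).  The roots can be chosen as
  measurable functions of \<open>\<omega>\<close> (\<open>measurable_selection_of_zeros\<close>), that is, as bounded periodic
  multipliers, and these are the operators \<open>Lambda a\<close> (\<open>multiplier_is_Lambda\<close>).  So each
  generator is annihilated by a product of operators \<open>L - Lambda a\<close>; all of these commute, and the
  product over all generators annihilates \<open>V\<close> (\<open>factors_annihilate\<close>).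

  The rest is geometry.  Since \<open>L\<close> is normal, the kernel of \<open>L - Lambda a\<close> is invariant under \<open>L\<close>
  and its adjoint (\<open>reducing_kernel\<close>).  Split off these kernels one after the other, each inside
  the orthogonal complement of the previous ones (\<open>kernel_decomposition\<close>).  On what remains, every
  factor is injective and their product is zero; so nothing remains.

  Two facts from harmonic analysis carry this.  Trigonometric polynomials are dense among the
  periodic functions in the mean, for every finite Borel measure (\<open>trig_poly_dense\<close>), by the
  Stone-Weierstrass theorem on the torus and a monotone class argument.  This yields Fourier series
  on the cube, and it shows that \<open>V\<close> is invariant under all bounded periodic multipliers and that
  \<open>L\<close> commutes with them (\<open>multiplier_in\<close>, \<open>L_multiplier\<close>).  Plancherel's theorem follows from
  Parseval's on the cube: the values of a Fourier transform on a coset of the integer vectors are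
  Fourier coefficients (\<open>fourier_integral_zak\<close>, \<open>Plancherel_finite_cubes\<close>).  Surjectivity holds
  because the adjoint is isometric as well.
\<close>

section \<open>The Hilbert space structure\<close>

lemma borel_measurable_rep_L2 [measurable]: "rep_L2 f \<in> borel_measurable borel"
  using sq_integrable_rep_L2[of f] by (simp add: sq_integrable_def)

lemma borel_measurable_cnj [measurable (raw)]:
  "f \<in> borel_measurable M \<Longrightarrow> (\<lambda>x. cnj (f x)) \<in> borel_measurable M"
  by (rule borel_measurable_continuous_on[OF continuous_on_cnj[OF continuous_on_id]])

lemma rep_L2_zero: "AE x in lborel. rep_L2 0 x = 0"
  using rep_abs_L2[OF sq_integrable_zero] by (simp add: zero_L2_def)

lemma rep_L2_add: "AE x in lborel. rep_L2 (f + g) x = rep_L2 f x + rep_L2 g x"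
proof -
  have "f + g = abs_L2 (\<lambda>x. rep_L2 f x + rep_L2 g x)"
    unfolding plus_L2_def by simp
  then show ?thesis
    using rep_abs_L2[OF sq_integrable_add[OF sq_integrable_rep_L2 sq_integrable_rep_L2]] by simp
qed

lemma rep_L2_scaleC: "AE x in lborel. rep_L2 (c *\<^sub>C f) x = c * rep_L2 f x"
proof -
  have "c *\<^sub>C f = abs_L2 (\<lambda>x. c * rep_L2 f x)"
    unfolding scaleC_def by simp
  then show ?thesis
    using rep_abs_L2[OF sq_integrable_cmult[OF sq_integrable_rep_L2]] by simp
qed

lemma rep_L2_diff: "AE x in lborel. rep_L2 (f - g) x = rep_L2 f x - rep_L2 g x"
  unfolding minus_L2_def
  using rep_L2_add[of f "(-1) *\<^sub>C g"] rep_L2_scaleC[of "-1" g] by eventually_elim simp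

lemma rep_L2_shift: "AE x in lborel. rep_L2 (shift k f) x = rep_L2 f (x - of_int_vec k)"
proof -
  have "shift k f = abs_L2 (\<lambda>x. rep_L2 f (x - of_int_vec k))"
    unfolding shift_def by simp
  then show ?thesis
    using rep_abs_L2[OF sq_integrable_translate[OF sq_integrable_rep_L2]] by simp
qed

lemma rep_L2_character:
  "AE \<omega> in lborel. rep_L2 (character k) \<omega>
     = (if \<omega> \<in> unit_cube then exp (- 2 * pi * \<i> * (\<omega> \<bullet> of_int_vec k)) else 0)"
  using rep_abs_L2[OF sq_integrable_character[of k]] unfolding character_def
  by (simp only: map_fun_apply id_apply)

lemma rep_L2_sum: "AE x in lborel. rep_L2 (\<Sum>i\<in>I. f i) x = (\<Sum>i\<in>I. rep_L2 (f i) x)"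
proof (induction I rule: infinite_finite_induct)
  case (insert i I)
  show ?case
    using insert.IH rep_L2_add[of "f i" "\<Sum>i\<in>I. f i"]
    by eventually_elim (simp add: insert.hyps)
qed (use rep_L2_zero in auto)

lemma scaleC_zero_left [simp]: "0 *\<^sub>C f = 0"
  by (rule L2_complex.scale_zero_left)

lemma scaleC_zero_right [simp]: "c *\<^sub>C 0 = 0"
  by (rule L2_complex.scale_zero_right)

lemma scaleC_diff_right: "c *\<^sub>C (f - g) = c *\<^sub>C f - c *\<^sub>C g"
  by (rule L2_complex.scale_right_diff_distrib)

lemma cinner_add_right: "cinner h (f + g) = cinner h f + cinner h g"
  by (subst (1 2 3) cinner_commute) (simp add: cinner_add_left)

lemma cinner_scaleC_right: "cinner f (c *\<^sub>C g) = cnj c * cinner f g"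
  by (subst (1 2) cinner_commute) (simp add: cinner_scaleC_left)

lemma cinner_zero_left [simp]: "cinner 0 g = 0"
  using cinner_scaleC_left[of 0 0 g] by simp

lemma cinner_zero_right [simp]: "cinner g 0 = 0"
  using cinner_scaleC_right[of g 0 0] by simp

lemma cinner_diff_left: "cinner (f - g) h = cinner f h - cinner g h"
  unfolding minus_L2_def cinner_add_left cinner_scaleC_left by simp

lemma cinner_diff_right: "cinner h (f - g) = cinner h f - cinner h g"
  unfolding minus_L2_def cinner_add_right cinner_scaleC_right by simp

lemma cinner_sum_left: "cinner (\<Sum>i\<in>I. f i) g = (\<Sum>i\<in>I. cinner (f i) g)"
  by (induction I rule: infinite_finite_induct) (auto simp: cinner_add_left)

lemma cinner_sum_right: "cinner g (\<Sum>i\<in>I. f i) = (\<Sum>i\<in>I. cinner g (f i))"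
  by (induction I rule: infinite_finite_induct) (auto simp: cinner_add_right)

lemma cinner_norm: "cinner f f = complex_of_real ((norm f)\<^sup>2)"
  unfolding norm_L2_def inner_L2_def by (simp add: cinner_self)

lemma norm_L2_sq: "(norm f)\<^sup>2 = (LINT x|lborel. (cmod (rep_L2 f x))\<^sup>2)"
  using cinner_norm[of f] cinner_self[of f] of_real_eq_iff by metis

lemma ennreal_norm_L2_sq: "ennreal ((norm f)\<^sup>2) = (\<integral>\<^sup>+x. ennreal ((cmod (rep_L2 f x))\<^sup>2) \<partial>lborel)"
  unfolding norm_L2_sq using sq_integrable_rep_L2[of f]
  by (intro nn_integral_eq_integral[symmetric]) (auto simp: sq_integrable_def)

lemma ennreal_norm_diff_L2_sq:
  "ennreal ((norm (f - g))\<^sup>2) = (\<integral>\<^sup>+x. ennreal ((cmod (rep_L2 f x - rep_L2 g x))\<^sup>2) \<partial>lborel)"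
  unfolding ennreal_norm_L2_sq
  by (rule nn_integral_cong_AE) (use rep_L2_diff[of f g] in eventually_elim, simp)

lemma norm_scaleC: "norm (c *\<^sub>C f) = cmod c * norm f"
proof -
  have "complex_of_real ((norm (c *\<^sub>C f))\<^sup>2) = complex_of_real ((cmod c * norm f)\<^sup>2)"
    unfolding cinner_norm[symmetric] cinner_scaleC_left cinner_scaleC_right
    by (simp add: cinner_norm power_mult_distrib mult.commute[of "cnj c"] flip: complex_norm_square)
  then have "(norm (c *\<^sub>C f))\<^sup>2 = (cmod c * norm f)\<^sup>2"
    using of_real_eq_iff by blast
  then show ?thesis
    by (simp add: power2_eq_iff_nonneg)
qed

lemma cinner_Cauchy_Schwarz: "cmod (cinner f g) \<le> norm f * norm g"
proof (cases "cinner f g = 0")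
  case False
  define c where "c = cnj (cinner f g) / cmod (cinner f g)"
  have "c * cinner f g = cmod (cinner f g)"
    using False by (simp add: c_def complex_norm_square[symmetric] power2_eq_square mult.commute)
  then have "cmod (cinner f g) = (c *\<^sub>C f) \<bullet> g"
    by (simp add: inner_L2_def cinner_scaleC_left)
  also have "\<dots> \<le> norm (c *\<^sub>C f) * norm g"
    by (rule norm_cauchy_schwarz)
  also have "norm (c *\<^sub>C f) = norm f"
    using False by (simp add: norm_scaleC c_def norm_divide)
  finally show ?thesis .
qed simp

lemma bounded_bilinear_cinner: "bounded_bilinear cinner"
proof
  show "\<exists>K. \<forall>a b. norm (cinner a b) \<le> norm a * norm b * K"
    by (intro exI[of _ 1]) (simp add: cinner_Cauchy_Schwarz)
qed (simp_all add: cinner_add_left cinner_add_right scaleR_L2_def cinner_scaleC_left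
      cinner_scaleC_right scaleR_conv_of_real)

lemma bounded_linear_scaleC: "bounded_linear (scaleC c)"
  by (rule bounded_linear_intro[where K = "cmod c"])
     (simp_all add: scaleC_add_right scaleR_L2_def scaleC_scaleC norm_scaleC mult.commute)

lemmas tendsto_cinner = bounded_bilinear.tendsto[OF bounded_bilinear_cinner]
lemmas tendsto_scaleC = bounded_linear.tendsto[OF bounded_linear_scaleC]

lemma norm_add_sq_L2: "(norm (f + g))\<^sup>2 = (norm f)\<^sup>2 + 2 * Re (cinner f g) + (norm g)\<^sup>2"
  unfolding power2_norm_eq_inner inner_add_left inner_add_right inner_commute[of g f]
  by (simp add: inner_L2_def)

lemma norm_diff_sq_L2: "(norm (f - g))\<^sup>2 = (norm f)\<^sup>2 - 2 * Re (cinner f g) + (norm g)\<^sup>2"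
  unfolding power2_norm_eq_inner inner_diff_left inner_diff_right inner_commute[of g f]
  by (simp add: inner_L2_def)

subsection \<open>Completeness\<close>

text \<open>
  Square summability with the weights \<open>2^i\<close> controls absolute summability, because
  \<open>2 t \<le> 2^(-i) + 2^i t\<^sup>2\<close>.  This is how convergence in the mean, when fast enough, becomes
  convergence almost everywhere.
\<close>

lemma AE_summable_of_fast_norm:
  fixes d :: "nat \<Rightarrow> 'n::finite L2"
  assumes "\<And>i. norm (d i) \<le> (1/2)^i"
  shows "AE x in lborel. summable (\<lambda>i. cmod (rep_L2 (d i) x))"
proof -
  have nn: "(\<integral>\<^sup>+x. ennreal (2^i * (cmod (rep_L2 (d i) x))\<^sup>2) \<partial>lborel) \<le> ennreal ((1/2)^i)" for i
  proof -
    have "(\<integral>\<^sup>+x. ennreal (2^i * (cmod (rep_L2 (d i) x))\<^sup>2) \<partial>lborel)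
        = ennreal (2^i) * ennreal ((norm (d i))\<^sup>2)"
      unfolding ennreal_norm_L2_sq by (subst nn_integral_cmult[symmetric]) (auto simp: ennreal_mult)
    also have "\<dots> = ennreal (2^i * (norm (d i))\<^sup>2)"
      by (simp add: ennreal_mult)
    also have "2^i * (norm (d i))\<^sup>2 \<le> 2^i * ((1/2)^i)\<^sup>2"
      using assms[of i] by (intro mult_left_mono power_mono) auto
    also have "2^i * ((1/2::real)^i)\<^sup>2 = (1/2)^i"
      by (simp add: power2_eq_square power_divide)
    finally show ?thesis
      using ennreal_leI by blast
  qed
  have "(\<integral>\<^sup>+x. (\<Sum>i. ennreal (2^i * (cmod (rep_L2 (d i) x))\<^sup>2)) \<partial>lborel)
      = (\<Sum>i. (\<integral>\<^sup>+x. ennreal (2^i * (cmod (rep_L2 (d i) x))\<^sup>2) \<partial>lborel))"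
    by (intro nn_integral_suminf) measurable
  also have "\<dots> \<le> (\<Sum>i. ennreal ((1/2)^i))"
    by (intro suminf_le nn) auto
  also have "\<dots> = ennreal (\<Sum>i. (1/2)^i)"
    by (intro suminf_ennreal2) auto
  also have "\<dots> < \<infinity>"
    by simp
  finally have "AE x in lborel. (\<Sum>i. ennreal (2^i * (cmod (rep_L2 (d i) x))\<^sup>2)) \<noteq> \<infinity>"
    by (intro nn_integral_PInf_AE) (auto simp: less_top)
  then show ?thesis
  proof eventually_elim
    case (elim x)
    then have s: "summable (\<lambda>i. 2^i * (cmod (rep_L2 (d i) x))\<^sup>2)"
      by (intro summable_suminf_not_top) auto
    have s': "summable (\<lambda>i. (1/2)^i + 2^i * (cmod (rep_L2 (d i) x))\<^sup>2)"
      using s by (intro summable_add) auto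
    have "cmod (rep_L2 (d i) x) \<le> (1/2)^i + 2^i * (cmod (rep_L2 (d i) x))\<^sup>2" for i
    proof -
      let ?t = "cmod (rep_L2 (d i) x)"
      have "0 \<le> (1 - 2^i * ?t)\<^sup>2"
        by simp
      then have "2 * (2^i * ?t) \<le> 1 + (2^i * ?t)\<^sup>2"
        by (simp add: power2_diff)
      then have "(1/2)^i * (2 * (2^i * ?t)) \<le> (1/2)^i * (1 + (2^i * ?t)\<^sup>2)"
        by (intro mult_left_mono) auto
      then have "2 * ?t \<le> (1/2)^i + 2^i * ?t\<^sup>2"
        by (simp add: field_simps power2_eq_square power_divide)
      moreover have "0 \<le> ?t" by simp
      ultimately show ?thesis by linarith
    qed
    then show ?case
      by (intro summable_comparison_test'[OF s', of 0]) auto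
  qed
qed

lemma AE_tendsto_of_fast_norm:
  fixes F :: "nat \<Rightarrow> 'n::finite L2"
  assumes "\<And>i. norm (F i - f) \<le> (1/2)^i"
  shows "AE x in lborel. (\<lambda>i. rep_L2 (F i) x) \<longlonglongrightarrow> rep_L2 f x"
proof -
  have "AE x in lborel. \<forall>i. rep_L2 (F i - f) x = rep_L2 (F i) x - rep_L2 f x"
    using rep_L2_diff by (subst AE_all_countable) blast
  with AE_summable_of_fast_norm[OF assms] show ?thesis
  proof eventually_elim
    case (elim x)
    have "(\<lambda>i. cmod (rep_L2 (F i) x - rep_L2 f x)) \<longlonglongrightarrow> 0"
      using summable_LIMSEQ_zero[OF elim(1)] unfolding elim(2)[rule_format] .
    then show ?case
      by (rule LIM_zero_cancel[OF tendsto_norm_zero_cancel])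
  qed
qed

lemma AE_tendsto_subsequence:
  fixes F :: "nat \<Rightarrow> 'n::finite L2"
  assumes "F \<longlonglongrightarrow> f"
  shows "\<exists>r. strict_mono r \<and> (AE x in lborel. (\<lambda>i. rep_L2 (F (r i)) x) \<longlonglongrightarrow> rep_L2 f x)"
proof -
  have "\<forall>i. \<exists>N. \<forall>m\<ge>N. norm (F m - f) \<le> (1/2)^i"
    using LIMSEQ_D[OF assms] by (metis less_le zero_less_power half_gt_zero_iff zero_less_one)
  then obtain N where N: "\<And>i m. m \<ge> N i \<Longrightarrow> norm (F m - f) \<le> (1/2)^i"
    by metis
  define r where "r = rec_nat (N 0) (\<lambda>i p. Suc (p + N (Suc i)))"
  have r: "r (Suc i) = Suc (r i + N (Suc i))" for i
    by (simp add: r_def)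
  have "strict_mono r"
    by (rule strict_monoI_Suc) (simp add: r)
  moreover have "N i \<le> r i" for i
    by (cases i) (simp_all add: r, simp add: r_def)
  ultimately show ?thesis
    using N AE_tendsto_of_fast_norm[of "\<lambda>i. F (r i)" f] by blast
qed

text \<open>
  A fast Cauchy sequence converges almost everywhere by telescoping; Fatou's lemma shows that
  the pointwise limit is also the limit in the mean.
\<close>

lemma fast_Cauchy_convergent_L2:
  fixes F :: "nat \<Rightarrow> 'n::finite L2"
  assumes fast: "\<And>i j. i \<le> j \<Longrightarrow> norm (F j - F i) \<le> (1/2)^i"
  shows "convergent F"
proof -
  have "AE x in lborel. \<forall>i. rep_L2 (F (Suc i) - F i) x = rep_L2 (F (Suc i)) x - rep_L2 (F i) x"
    using rep_L2_diff by (subst AE_all_countable) blast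
  moreover have "AE x in lborel. summable (\<lambda>i. cmod (rep_L2 (F (Suc i) - F i) x))"
    by (rule AE_summable_of_fast_norm) (simp add: fast)
  ultimately have conv: "AE x in lborel. convergent (\<lambda>i. rep_L2 (F i) x)"
  proof eventually_elim
    case (elim x)
    then have "summable (\<lambda>i. rep_L2 (F (Suc i)) x - rep_L2 (F i) x)"
      using summable_norm_cancel[OF elim(2)] unfolding elim(1)[rule_format] by blast
    then have "convergent (\<lambda>n. \<Sum>i<n. rep_L2 (F (Suc i)) x - rep_L2 (F i) x)"
      by (simp only: summable_iff_convergent)
    then have "convergent (\<lambda>n. rep_L2 (F n) x - rep_L2 (F 0) x)"
      by (simp only: sum_lessThan_telescope[of "\<lambda>i. rep_L2 (F i) x"])
    then show ?case
      unfolding convergent_diff_const_right_iff .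
  qed
  define G where "G = (\<lambda>x. lim (\<lambda>i. rep_L2 (F i) x))"
  have G [measurable]: "G \<in> borel_measurable borel"
    unfolding G_def by measurable
  have lim: "AE x in lborel. (\<lambda>i. rep_L2 (F i) x) \<longlonglongrightarrow> G x"
    using conv unfolding G_def by eventually_elim (simp add: convergent_LIMSEQ_iff)
  have est: "(\<integral>\<^sup>+x. ennreal ((cmod (G x - rep_L2 (F i) x))\<^sup>2) \<partial>lborel) \<le> ennreal (((1/2)^i)\<^sup>2)" for i
  proof -
    have "(\<integral>\<^sup>+x. ennreal ((cmod (G x - rep_L2 (F i) x))\<^sup>2) \<partial>lborel)
       = (\<integral>\<^sup>+x. liminf (\<lambda>j. ennreal ((cmod (rep_L2 (F j) x - rep_L2 (F i) x))\<^sup>2)) \<partial>lborel)"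
    proof (rule nn_integral_cong_AE)
      show "AE x in lborel. ennreal ((cmod (G x - rep_L2 (F i) x))\<^sup>2)
          = liminf (\<lambda>j. ennreal ((cmod (rep_L2 (F j) x - rep_L2 (F i) x))\<^sup>2))"
        using lim
      proof eventually_elim
        case (elim x)
        then have "(\<lambda>j. ennreal ((cmod (rep_L2 (F j) x - rep_L2 (F i) x))\<^sup>2))
            \<longlonglongrightarrow> ennreal ((cmod (G x - rep_L2 (F i) x))\<^sup>2)"
          by (intro tendsto_intros)
        then show ?case
          by (rule lim_imp_Liminf[OF trivial_limit_sequentially, symmetric])
      qed
    qed
    also have "\<dots> \<le> liminf (\<lambda>j. \<integral>\<^sup>+x. ennreal ((cmod (rep_L2 (F j) x - rep_L2 (F i) x))\<^sup>2) \<partial>lborel)"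
      by (intro nn_integral_liminf) measurable
    also have "\<dots> \<le> ennreal (((1/2)^i)\<^sup>2)"
    proof (rule Liminf_le)
      show "\<forall>\<^sub>F j in sequentially.
          (\<integral>\<^sup>+x. ennreal ((cmod (rep_L2 (F j) x - rep_L2 (F i) x))\<^sup>2) \<partial>lborel) \<le> ennreal (((1/2)^i)\<^sup>2)"
        using eventually_ge_at_top[of i]
      proof eventually_elim
        case (elim j)
        then show ?case
          unfolding ennreal_norm_diff_L2_sq[symmetric]
          by (intro ennreal_leI power_mono fast) auto
      qed
    qed simp
    finally show ?thesis .
  qed
  have "integrable lborel (\<lambda>x. (cmod (G x - rep_L2 (F 0) x))\<^sup>2)"
    using le_less_trans[OF est[of 0] ennreal_less_top] by (intro integrableI_bounded) auto
  then have "sq_integrable (\<lambda>x. G x - rep_L2 (F 0) x)"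
    by (simp add: sq_integrable_def)
  from sq_integrable_add[OF this sq_integrable_rep_L2[of "F 0"]]
  have sqG: "sq_integrable G"
    by simp
  have "norm (F i - abs_L2 G) \<le> (1/2)^i" for i
  proof -
    have "ennreal ((norm (abs_L2 G - F i))\<^sup>2) \<le> ennreal (((1/2)^i)\<^sup>2)"
      unfolding ennreal_norm_diff_L2_sq
      by (rule order_trans[OF _ est[of i]], rule nn_integral_mono_AE)
         (use rep_abs_L2[OF sqG] in eventually_elim, simp)
    then have "(norm (abs_L2 G - F i))\<^sup>2 \<le> ((1/2)^i)\<^sup>2"
      by (subst (asm) ennreal_le_iff) auto
    then show ?thesis
      by (simp add: norm_minus_commute power2_le_iff_abs_le)
  qed
  then have "(\<lambda>i. norm (F i - abs_L2 G)) \<longlonglongrightarrow> 0"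
    by (intro Lim_null_comparison[OF _ LIMSEQ_realpow_zero[of "1/2"]]) auto
  from LIM_zero_cancel[OF tendsto_norm_zero_cancel[OF this]] show ?thesis
    unfolding convergent_def by (rule exI)
qed

instance L2 :: (finite) complete_space
proof
  fix X :: "nat \<Rightarrow> 'a L2"
  assume X: "Cauchy X"
  have "\<forall>i. \<exists>N. \<forall>m\<ge>N. \<forall>n\<ge>N. norm (X m - X n) < (1/2)^i"
    using CauchyD[OF X] by simp
  then obtain N where N: "\<And>i m n. m \<ge> N i \<Longrightarrow> n \<ge> N i \<Longrightarrow> norm (X m - X n) < (1/2)^i"
    by metis
  define r where "r = rec_nat (N 0) (\<lambda>i p. Suc (p + N (Suc i)))"
  have r: "r (Suc i) = Suc (r i + N (Suc i))" for i
    by (simp add: r_def)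
  have mono: "strict_mono r"
    by (rule strict_monoI_Suc) (simp add: r)
  have ge: "N i \<le> r i" for i
    by (cases i) (simp_all add: r, simp add: r_def)
  have "norm (X (r j) - X (r i)) \<le> (1/2)^i" if "i \<le> j" for i j
    using N[of i "r j" "r i"] ge[of i] strict_mono_leD[OF mono that] by simp
  then have "convergent (X \<circ> r)"
    using fast_Cauchy_convergent_L2[of "X \<circ> r"] by simp
  then obtain l where "(X \<circ> r) \<longlonglongrightarrow> l"
    by (auto simp: convergent_def)
  then have "X \<longlonglongrightarrow> l"
    by (rule Cauchy_converges_subseq[OF X mono])
  then show "convergent X"
    by (auto simp: convergent_def)
qed

subsection \<open>Orthogonal projections and adjoints\<close>

text \<open>
  By the parallelogram identity, a minimising sequence is a Cauchy sequence; the excesses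
  \<open>(1/4)^i / 4\<close> are chosen to make it a fast one.
\<close>

lemma closed_subspace_minimiser:
  fixes S :: "'n::finite L2 set"
  assumes S: "csubspace S" "closed S"
  shows "\<exists>p\<in>S. \<forall>s\<in>S. (norm (f - p))\<^sup>2 \<le> (norm (f - s))\<^sup>2"
proof -
  define D where "D = (INF s\<in>S. (norm (f - s))\<^sup>2)"
  have "0 \<in> S"
    using S(1) by (rule L2_complex.subspace_0)
  have bdd: "bdd_below ((\<lambda>s. (norm (f - s))\<^sup>2) ` S)"
    by (rule bdd_belowI2[of _ 0]) simp
  have D_le: "D \<le> (norm (f - s))\<^sup>2" if "s \<in> S" for s
    unfolding D_def using bdd that by (rule cINF_lower)
  have "\<exists>s\<in>S. (norm (f - s))\<^sup>2 < D + (1/4)^i / 4" for i :: nat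
    using cINF_less_iff[OF _ bdd, of "D + (1/4)^i / 4"] \<open>0 \<in> S\<close> unfolding D_def[symmetric] by auto
  then obtain s where s: "\<And>i. s i \<in> S" and sD: "\<And>i. (norm (f - s i))\<^sup>2 < D + (1/4)^i / 4"
    by metis
  have "norm (s j - s i) \<le> (1/2)^i" if "i \<le> j" for i j
  proof -
    have mid: "(1/2) *\<^sub>R (s i + s j) \<in> S"
      unfolding scaleR_L2_def using S(1) s
      by (intro L2_complex.subspace_scale L2_complex.subspace_add)
    have "2 *\<^sub>R (f - (1/2) *\<^sub>R (s i + s j)) = (f - s i) + (f - s j)"
      by (simp add: algebra_simps scaleR_2)
    then have "4 * (norm (f - (1/2) *\<^sub>R (s i + s j)))\<^sup>2 = (norm ((f - s i) + (f - s j)))\<^sup>2"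
      by (metis norm_scaleR abs_numeral power_mult_distrib mult_2 numeral_Bit0 power2_eq_square)
    moreover have "(norm ((f - s i) + (f - s j)))\<^sup>2 + (norm ((f - s i) - (f - s j)))\<^sup>2
        = 2 * (norm (f - s i))\<^sup>2 + 2 * (norm (f - s j))\<^sup>2"
      unfolding norm_add_sq_L2 norm_diff_sq_L2 by simp
    moreover have "(f - s i) - (f - s j) = s j - s i"
      by simp
    ultimately have "(norm (s j - s i))\<^sup>2 =
        2 * (norm (f - s i))\<^sup>2 + 2 * (norm (f - s j))\<^sup>2 - 4 * (norm (f - (1/2) *\<^sub>R (s i + s j)))\<^sup>2"
      by simp
    also have "\<dots> \<le> (1/4)^i / 2 + (1/4)^j / 2"
      using D_le[OF mid] sD[of i] sD[of j] by linarith
    also have "(1/4::real)^i / 2 + (1/4)^j / 2 \<le> (1/4)^i"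
      using power_decreasing[OF that, of "1/4::real"] by linarith
    also have "(1/4::real)^i = ((1/2)^i)\<^sup>2"
      by (simp add: power2_eq_square flip: power_mult_distrib)
    finally show ?thesis
      by (rule power2_le_imp_le) simp
  qed
  then have "convergent s"
    by (rule fast_Cauchy_convergent_L2)
  then obtain p where p: "s \<longlonglongrightarrow> p"
    by (auto simp: convergent_def)
  have "p \<in> S"
    using closed_sequentially[OF S(2) _ p] s by blast
  have "(\<lambda>i. (norm (f - s i))\<^sup>2) \<longlonglongrightarrow> (norm (f - p))\<^sup>2"
    by (intro tendsto_intros p)
  moreover have "(\<lambda>i. D + (1/4)^i / 4) \<longlonglongrightarrow> D + 0 / 4"
    by (intro tendsto_intros LIMSEQ_realpow_zero) auto
  ultimately have "(norm (f - p))\<^sup>2 \<le> D + 0 / 4"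
    by (rule LIMSEQ_le) (use sD less_imp_le in blast)
  then have "(norm (f - p))\<^sup>2 \<le> D"
    by simp
  then show ?thesis
    using \<open>p \<in> S\<close> D_le by (meson order_trans)
qed

text \<open>
  If the inner product of \<open>f - p\<close> with some \<open>g\<close> were nonzero, moving \<open>p\<close> along \<open>g\<close> by the
  Fourier coefficient of \<open>f - p\<close> would decrease the distance.
\<close>

lemma projection_exists:
  fixes S :: "'n::finite L2 set"
  assumes S: "csubspace S" "closed S"
  shows "\<exists>p\<in>S. \<forall>g\<in>S. cinner (f - p) g = 0"
proof -
  obtain p where p: "p \<in> S" and min: "\<And>s. s \<in> S \<Longrightarrow> (norm (f - p))\<^sup>2 \<le> (norm (f - s))\<^sup>2"
    using closed_subspace_minimiser[OF S, of f] by blast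
  have "cinner (f - p) g = 0" if g: "g \<in> S" for g
  proof (cases "g = 0")
    case False
    define a where "a = cinner (f - p) g"
    \<comment> \<open>the coefficient of the projection of \<open>f - p\<close> to the line of \<open>g\<close>\<close>
    define c where "c = a / complex_of_real ((norm g)\<^sup>2)"
    have "p + c *\<^sub>C g \<in> S"
      using S(1) p g by (intro L2_complex.subspace_scale L2_complex.subspace_add)
    from min[OF this] have le: "(norm (f - p))\<^sup>2 \<le> (norm ((f - p) - c *\<^sub>C g))\<^sup>2"
      by (simp add: diff_diff_eq)
    have "Re (cinner (f - p) (c *\<^sub>C g)) = (cmod a)\<^sup>2 / (norm g)\<^sup>2"
    proof -
      have "cinner (f - p) (c *\<^sub>C g) = cnj c * a"
        by (simp add: cinner_scaleC_right a_def)
      also have "\<dots> = complex_of_real ((cmod a)\<^sup>2 / (norm g)\<^sup>2)"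
        unfolding c_def of_real_divide complex_norm_square by simp
      finally show ?thesis
        by simp
    qed
    moreover have "(norm (c *\<^sub>C g))\<^sup>2 = (cmod a)\<^sup>2 / (norm g)\<^sup>2"
    proof -
      have "cmod c = cmod a / (norm g)\<^sup>2"
        by (simp add: c_def norm_divide norm_power)
      then show ?thesis
        using False by (simp add: norm_scaleC power2_eq_square)
    qed
    ultimately have "(cmod a)\<^sup>2 / (norm g)\<^sup>2 \<le> 0"
      using le unfolding norm_diff_sq_L2[of "f - p"] by linarith
    then show ?thesis
      using False by (simp add: a_def divide_le_0_iff power2_eq_square mult_le_0_iff)
  qed simp
  with p show ?thesis by blast
qed

lemma orth_proj_unique:
  assumes S: "csubspace S" and p: "p \<in> S" and o: "\<And>g. g \<in> S \<Longrightarrow> cinner (f - p) g = 0"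
  shows "orth_proj S f = p"
  unfolding orth_proj_def
proof (rule the_equality)
  show "p \<in> S \<and> (\<forall>g\<in>S. cinner (f - p) g = 0)"
    using p o by blast
  fix q assume q: "q \<in> S \<and> (\<forall>g\<in>S. cinner (f - q) g = 0)"
  have "p - q \<in> S"
    using S p q by (intro L2_complex.subspace_diff) auto
  then have "cinner (f - p) (p - q) = 0" "cinner (f - q) (p - q) = 0"
    using o q by auto
  then have "cinner (p - q) (p - q) = 0"
    by (simp add: cinner_diff_left)
  then show "q = p"
    using cinner_self_eq_0 by fastforce
qed

text \<open>
  The kernel of a nonzero functional has a one-dimensional orthogonal complement in \<open>V\<close>; the
  representing vector is a multiple of any nonzero vector there.
\<close>

lemma Riesz_representation_on:
  fixes V :: "'n::finite L2 set" and \<phi> :: "'n L2 \<Rightarrow> complex"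
  assumes V: "csubspace V" "closed V"
    and add: "\<And>f g. f \<in> V \<Longrightarrow> g \<in> V \<Longrightarrow> \<phi> (f + g) = \<phi> f + \<phi> g"
    and scale: "\<And>c f. f \<in> V \<Longrightarrow> \<phi> (c *\<^sub>C f) = c * \<phi> f"
    and bound: "\<And>f. f \<in> V \<Longrightarrow> cmod (\<phi> f) \<le> C * norm f"
  shows "\<exists>h\<in>V. \<forall>f\<in>V. \<phi> f = cinner f h"
proof (cases "\<forall>f\<in>V. \<phi> f = 0")
  case True
  then show ?thesis
    using L2_complex.subspace_0[OF V(1)] by (intro bexI[of _ 0]) auto
next
  case False
  then obtain f0 where f0: "f0 \<in> V" "\<phi> f0 \<noteq> 0"
    by blast
  have diff: "\<phi> (f - g) = \<phi> f - \<phi> g" if "f \<in> V" "g \<in> V" for f g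
    unfolding minus_L2_def
    using add[OF that(1) L2_complex.subspace_scale[OF V(1) that(2), of "-1"]] scale[OF that(2), of "-1"]
    by (simp only: mult_minus1 add_uminus_conv_diff)
  define K where "K = {f\<in>V. \<phi> f = 0}"
  have subK: "csubspace K"
    using V(1) unfolding K_def L2_complex.subspace_def by (auto simp: add scale scale[of 0 0, simplified])
  have clK: "closed K"
    unfolding closed_sequential_limits
  proof (intro allI impI, elim conjE)
    fix x l assume x: "\<forall>n. x n \<in> K" and l: "x \<longlonglongrightarrow> l"
    have "l \<in> V"
      using closed_sequentially[OF V(2) _ l] x by (auto simp: K_def)
    have "cmod (\<phi> l) \<le> C * norm (l - x n)" for n
      using bound[of "l - x n"] diff[of l "x n"] x \<open>l \<in> V\<close> L2_complex.subspace_diff[OF V(1)]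
      by (simp add: K_def)
    moreover have "(\<lambda>n. C * norm (l - x n)) \<longlonglongrightarrow> C * norm (l - l)"
      by (intro tendsto_intros l)
    ultimately have "cmod (\<phi> l) \<le> C * norm (l - l)"
      by (intro LIMSEQ_le_const) auto
    then show "l \<in> K"
      using \<open>l \<in> V\<close> by (simp add: K_def)
  qed
  obtain p where p: "p \<in> K" "\<And>g. g \<in> K \<Longrightarrow> cinner (f0 - p) g = 0"
    using projection_exists[OF subK clK] by blast
  define u where "u = f0 - p"
  have u: "u \<in> V" "\<phi> u \<noteq> 0"
    using f0 p diff L2_complex.subspace_diff[OF V(1)] by (auto simp: u_def K_def)
  then have "u \<noteq> 0"
    using scale[of 0 0] L2_complex.subspace_0[OF V(1)] by auto
  define h where "h = (cnj (\<phi> u) / complex_of_real ((norm u)\<^sup>2)) *\<^sub>C u"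
  have "\<phi> f = cinner f h" if f: "f \<in> V" for f
  proof -
    have "f - (\<phi> f / \<phi> u) *\<^sub>C u \<in> K"
      using f u L2_complex.subspace_diff[OF V(1)] L2_complex.subspace_scale[OF V(1)]
      by (simp add: K_def diff scale)
    then have "cinner u (f - (\<phi> f / \<phi> u) *\<^sub>C u) = 0"
      using p(2) u_def by blast
    then have "cinner (f - (\<phi> f / \<phi> u) *\<^sub>C u) u = 0"
      by (subst cinner_commute) simp
    then have "cinner f u = \<phi> f / \<phi> u * complex_of_real ((norm u)\<^sup>2)"
      by (simp add: cinner_diff_left cinner_scaleC_left cinner_norm)
    then show ?thesis
      using u \<open>u \<noteq> 0\<close> by (simp add: h_def cinner_scaleC_right)
  qed
  moreover have "h \<in> V"
    unfolding h_def by (rule L2_complex.subspace_scale[OF V(1) u(1)])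
  ultimately show ?thesis by blast
qed

locale bounded_operator_on =
  fixes V :: "'n::finite L2 set" and L :: "'n L2 \<Rightarrow> 'n L2"
  assumes subspace: "csubspace V" and closed: "closed V"
    and maps: "f \<in> V \<Longrightarrow> L f \<in> V" and bounded_clinear: "bounded_clinear_on V L"
begin

lemma L_add: "f \<in> V \<Longrightarrow> g \<in> V \<Longrightarrow> L (f + g) = L f + L g"
  and L_scale: "f \<in> V \<Longrightarrow> L (c *\<^sub>C f) = c *\<^sub>C L f"
  using bounded_clinear by (auto simp: bounded_clinear_on_def)

lemma L_bound: "\<exists>C>0. \<forall>f\<in>V. norm (L f) \<le> C * norm f"
proof -
  obtain C where C: "\<And>f. f \<in> V \<Longrightarrow> norm (L f) \<le> C * norm f"
    using bounded_clinear unfolding bounded_clinear_on_def by blast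
  have "norm (L f) \<le> (\<bar>C\<bar> + 1) * norm f" if "f \<in> V" for f
  proof -
    have "C * norm f \<le> (\<bar>C\<bar> + 1) * norm f"
      by (intro mult_right_mono) auto
    with C[OF that] show ?thesis by linarith
  qed
  then show ?thesis
    by (intro exI[of _ "\<bar>C\<bar> + 1"]) auto
qed

lemma V_0: "0 \<in> V"
  and V_add: "f \<in> V \<Longrightarrow> g \<in> V \<Longrightarrow> f + g \<in> V"
  and V_diff: "f \<in> V \<Longrightarrow> g \<in> V \<Longrightarrow> f - g \<in> V"
  and V_scale: "f \<in> V \<Longrightarrow> c *\<^sub>C f \<in> V"
  using subspace
  by (auto intro: L2_complex.subspace_0 L2_complex.subspace_add L2_complex.subspace_diff
      L2_complex.subspace_scale)

lemma L_0: "L 0 = 0"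
  using L_scale[OF V_0, of 0] by simp

lemma L_diff: "f \<in> V \<Longrightarrow> g \<in> V \<Longrightarrow> L (f - g) = L f - L g"
  unfolding minus_L2_def by (simp only: L_add L_scale V_scale)

lemma L_tendsto:
  assumes "\<And>n. x n \<in> V" "l \<in> V" "x \<longlonglongrightarrow> l"
  shows "(\<lambda>n. L (x n)) \<longlonglongrightarrow> L l"
proof -
  obtain C where C: "\<And>f. f \<in> V \<Longrightarrow> norm (L f) \<le> C * norm f"
    using L_bound by blast
  have "(\<lambda>n. C * norm (x n - l)) \<longlonglongrightarrow> C * norm (l - l)"
    by (intro tendsto_intros assms)
  then have "(\<lambda>n. C * norm (x n - l)) \<longlonglongrightarrow> 0"
    by simp
  then have "(\<lambda>n. L (x n) - L l) \<longlonglongrightarrow> 0"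
    by (rule Lim_null_comparison[rotated])
       (use C[OF V_diff[OF assms(1,2)]] L_diff[OF assms(1,2)] in simp)
  then show ?thesis
    by (rule LIM_zero_cancel)
qed

abbreviation adj :: "'n L2 \<Rightarrow> 'n L2" where "adj \<equiv> adjoint_on V L"

lemma
  assumes g: "g \<in> V"
  shows adj_in: "adj g \<in> V" and adj: "f \<in> V \<Longrightarrow> cinner (L f) g = cinner f (adj g)"
proof -
  obtain C where C: "\<And>f. f \<in> V \<Longrightarrow> norm (L f) \<le> C * norm f"
    using L_bound by blast
  have "cmod (cinner (L f) g) \<le> (C * norm g) * norm f" if "f \<in> V" for f
    using cinner_Cauchy_Schwarz[of "L f" g] mult_right_mono[OF C[OF that] norm_ge_zero[of g]]
    by (simp add: mult_ac)
  then obtain h where h: "h \<in> V" "\<And>f. f \<in> V \<Longrightarrow> cinner (L f) g = cinner f h"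
    using Riesz_representation_on[OF subspace closed, of "\<lambda>f. cinner (L f) g" "C * norm g"]
    by (auto simp: L_add L_scale cinner_add_left cinner_scaleC_left)
  have "adj g = h"
    unfolding adjoint_on_def
  proof (rule the_equality)
    show "h \<in> V \<and> (\<forall>f\<in>V. cinner (L f) g = cinner f h)"
      using h by blast
    fix k assume k: "k \<in> V \<and> (\<forall>f\<in>V. cinner (L f) g = cinner f k)"
    then have "cinner (k - h) (k - h) = 0"
      using h V_diff by (metis cinner_diff_right diff_self)
    then show "k = h"
      using cinner_self_eq_0 by fastforce
  qed
  with h show "adj g \<in> V" "f \<in> V \<Longrightarrow> cinner (L f) g = cinner f (adj g)"
    by simp_all
qed

end

section \<open>Approximation by trigonometric polynomials\<close>

definition wave :: "real ^ 'n \<Rightarrow> real ^ 'n \<Rightarrow> complex" where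
  "wave x \<omega> = exp (- 2 * pi * \<i> * (\<omega> \<bullet> x))"

lemma norm_wave [simp]: "cmod (wave x \<omega>) = 1"
  by (simp add: wave_def norm_exp_eq_Re)

lemma wave_neq_0 [simp]: "wave x \<omega> \<noteq> 0"
  by (simp add: wave_def)

lemma wave_commute: "wave x \<omega> = wave \<omega> x"
  by (simp add: wave_def inner_commute)

lemma wave_add_left: "wave (x + y) \<omega> = wave x \<omega> * wave y \<omega>"
  unfolding wave_def exp_add[symmetric] inner_add_right of_real_add by (simp add: algebra_simps)

lemma wave_add_right: "wave x (\<omega> + \<theta>) = wave x \<omega> * wave x \<theta>"
  using wave_add_left[of \<omega> \<theta> x] by (simp add: wave_commute[of x])

lemma wave_0 [simp]: "wave 0 \<omega> = 1" "wave x 0 = 1"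
  by (simp_all add: wave_def)

lemma wave_minus: "wave (- x) \<omega> = cnj (wave x \<omega>)"
  by (simp add: wave_def exp_cnj)

lemma wave_cis: "wave x \<omega> = cis (- 2 * pi * (\<omega> \<bullet> x))"
  by (simp add: wave_def cis_conv_exp mult_ac)

lemma of_int_vec_add: "of_int_vec (k + l) = of_int_vec k + of_int_vec l"
  by (simp add: of_int_vec_def vec_eq_iff)

lemma of_int_vec_minus: "of_int_vec (- k) = - of_int_vec k"
  by (simp add: of_int_vec_def vec_eq_iff)

lemma of_int_vec_diff: "of_int_vec (k - l) = of_int_vec k - of_int_vec l"
  by (simp add: of_int_vec_def vec_eq_iff)

lemma of_int_vec_0 [simp]: "of_int_vec 0 = 0"
  by (simp add: of_int_vec_def vec_eq_iff)

lemma of_int_vec_nth [simp]: "of_int_vec k $ i = of_int (k $ i)"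
  by (simp add: of_int_vec_def)

lemma wave_of_int_of_int [simp]: "wave (of_int_vec k) (of_int_vec l) = 1"
proof -
  have "of_int_vec l \<bullet> of_int_vec k = of_int (\<Sum>i\<in>UNIV. l $ i * k $ i)"
    by (simp add: inner_vec_def of_int_vec_def)
  then have "wave (of_int_vec k) (of_int_vec l) = cis (2 * pi * of_int (- (\<Sum>i\<in>UNIV. l $ i * k $ i)))"
    unfolding wave_cis by simp
  then show ?thesis
    using cis_multiple_2pi[of "of_int (- (\<Sum>i\<in>UNIV. l $ i * k $ i))"] by (simp only: Ints_of_int)
qed

lemma wave_periodic [simp]: "wave (of_int_vec k) (\<omega> + of_int_vec l) = wave (of_int_vec k) \<omega>"
  by (simp add: wave_add_right)

lemma continuous_on_wave [continuous_intros]: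
  "continuous_on S f \<Longrightarrow> continuous_on S g \<Longrightarrow> continuous_on S (\<lambda>x. wave (f x) (g x))"
  unfolding wave_def by (intro continuous_intros)

lemma borel_measurable_wave [measurable]: "wave x \<in> borel_measurable borel"
  by (intro borel_measurable_continuous_onI continuous_intros)

inductive trig_poly :: "(real ^ 'n \<Rightarrow> complex) \<Rightarrow> bool" where
  wave: "trig_poly (wave (of_int_vec k))"
| add: "trig_poly p \<Longrightarrow> trig_poly q \<Longrightarrow> trig_poly (\<lambda>\<omega>. p \<omega> + q \<omega>)"
| scale: "trig_poly p \<Longrightarrow> trig_poly (\<lambda>\<omega>. c * p \<omega>)"

definition periodic_multiplier :: "(real ^ 'n \<Rightarrow> complex) \<Rightarrow> bool" where
  "periodic_multiplier m \<longleftrightarrow> m \<in> borel_measurable borel \<and> (\<exists>B. \<forall>\<omega>. cmod (m \<omega>) \<le> B)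
     \<and> (\<forall>\<omega> k. m (\<omega> + of_int_vec k) = m \<omega>)"

lemma periodic_multiplierD:
  assumes "periodic_multiplier m"
  shows "m \<in> borel_measurable borel" "\<exists>B. \<forall>\<omega>. cmod (m \<omega>) \<le> B" "m (\<omega> + of_int_vec k) = m \<omega>"
  using assms by (auto simp: periodic_multiplier_def)

lemma periodic_multiplier_wave: "periodic_multiplier (wave (of_int_vec k))"
  by (auto simp: periodic_multiplier_def intro!: exI[of _ 1])

lemma periodic_multiplier_const: "periodic_multiplier (\<lambda>_. c)"
  by (auto simp: periodic_multiplier_def)

lemma periodic_multiplier_add:
  assumes "periodic_multiplier p" "periodic_multiplier q"
  shows "periodic_multiplier (\<lambda>\<omega>. p \<omega> + q \<omega>)"
proof -
  obtain A B where "\<And>\<omega>. cmod (p \<omega>) \<le> A" "\<And>\<omega>. cmod (q \<omega>) \<le> B"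
    using assms unfolding periodic_multiplier_def by blast
  then have "cmod (p \<omega> + q \<omega>) \<le> A + B" for \<omega>
    by (meson norm_triangle_ineq add_mono order_trans)
  then show ?thesis
    using assms unfolding periodic_multiplier_def by auto
qed

lemma periodic_multiplier_mult:
  assumes "periodic_multiplier p" "periodic_multiplier q"
  shows "periodic_multiplier (\<lambda>\<omega>. p \<omega> * q \<omega>)"
proof -
  obtain A B where AB: "\<And>\<omega>. cmod (p \<omega>) \<le> A" "\<And>\<omega>. cmod (q \<omega>) \<le> B"
    using assms unfolding periodic_multiplier_def by blast
  then have "cmod (p \<omega> * q \<omega>) \<le> A * B" for \<omega>
    unfolding norm_mult by (meson norm_ge_zero mult_mono order_trans)
  then show ?thesis
    using assms unfolding periodic_multiplier_def by auto
qed

lemma periodic_multiplier_cnj: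
  "periodic_multiplier p \<Longrightarrow> periodic_multiplier (\<lambda>\<omega>. cnj (p \<omega>))"
  unfolding periodic_multiplier_def by auto

lemma trig_poly_multiplier: "trig_poly p \<Longrightarrow> periodic_multiplier p"
proof (induction rule: trig_poly.induct)
  case (scale p c)
  show ?case
    by (rule periodic_multiplier_mult[OF periodic_multiplier_const scale.IH])
qed (auto intro: periodic_multiplier_wave periodic_multiplier_add)

lemma trig_poly_measurable: "trig_poly p \<Longrightarrow> p \<in> borel_measurable borel"
  using trig_poly_multiplier periodic_multiplierD(1) by blast

lemma trig_poly_const: "trig_poly (\<lambda>_. c)"
  using trig_poly.scale[OF trig_poly.wave[of 0], of c] by simp

lemma trig_poly_mult_wave: "trig_poly p \<Longrightarrow> trig_poly (\<lambda>\<omega>. p \<omega> * wave (of_int_vec k) \<omega>)"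
proof (induction rule: trig_poly.induct)
  case (wave l)
  show ?case
    using trig_poly.wave[of "l + k"] by (simp add: of_int_vec_add wave_add_left[abs_def])
next
  case (add p q)
  then show ?case
    using trig_poly.add by (fastforce simp: distrib_right)
next
  case (scale p c)
  then show ?case
    using trig_poly.scale by (fastforce simp: mult.assoc)
qed

lemma trig_poly_mult: "trig_poly q \<Longrightarrow> trig_poly p \<Longrightarrow> trig_poly (\<lambda>\<omega>. p \<omega> * q \<omega>)"
proof (induction rule: trig_poly.induct)
  case (wave k)
  then show ?case
    by (rule trig_poly_mult_wave)
next
  case (add q r)
  then show ?case
    using trig_poly.add by (fastforce simp: distrib_left)
next
  case (scale q c)
  then show ?case
    using trig_poly.scale by (fastforce simp: mult.left_commute)
qed

lemma trig_poly_sum: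
  assumes "\<And>i. i \<in> I \<Longrightarrow> trig_poly (p i)"
  shows "trig_poly (\<lambda>\<omega>. \<Sum>i\<in>I. p i \<omega>)"
  using assms
  by (induction I rule: infinite_finite_induct) (auto intro: trig_poly_const trig_poly.add)

text \<open>
  The map \<open>torus\<close> identifies the quotient of \<open>real ^ 'n\<close> by the integer vectors with a compact
  subset of \<open>complex ^ 'n\<close>, where real polynomials are available to approximate continuous functions.
\<close>

definition torus :: "real ^ 'n \<Rightarrow> complex ^ 'n" where
  "torus \<omega> = (\<chi> i. wave (of_int_vec (axis i 1)) \<omega>)"

lemma torus_nth [simp]: "torus \<omega> $ i = wave (of_int_vec (axis i 1)) \<omega>"
  by (simp add: torus_def)

lemma torus_nth_cis: "torus \<omega> $ i = cis (- 2 * pi * \<omega> $ i)"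
proof -
  have "of_int_vec (axis i 1) = axis i (1::real)"
    by (simp add: of_int_vec_def vec_eq_iff axis_def)
  then show ?thesis
    by (simp add: wave_cis inner_axis)
qed

lemma borel_measurable_torus [measurable]: "torus \<in> borel_measurable borel"
  unfolding torus_def by (intro borel_measurable_continuous_onI continuous_intros)

text \<open>
  The real coordinate functions of \<open>complex ^ 'n\<close>, restricted to the torus, are combinations of a
  character and its conjugate.
\<close>

lemma trig_poly_real_polynomial_torus:
  assumes "real_polynomial_function q"
  shows "trig_poly (\<lambda>\<omega>. complex_of_real (q (torus \<omega>)))"
  using assms
proof (induction rule: real_polynomial_function.induct)
  case (linear f)
  have comp: "trig_poly (\<lambda>\<omega>. complex_of_real (torus \<omega> \<bullet> b))" if "b \<in> Basis" for b
  proof -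
    obtain i u where b: "b = axis i u" and u: "u = 1 \<or> u = \<i>"
      using \<open>b \<in> Basis\<close> by (auto simp: Basis_vec_def Basis_complex_def)
    let ?w = "wave (of_int_vec (axis i 1))"
    have t: "trig_poly ?w" "trig_poly (\<lambda>\<omega>. cnj (?w \<omega>))"
      using trig_poly.wave[of "axis i 1"] trig_poly.wave[of "- axis i 1"]
      by (simp_all add: of_int_vec_minus wave_minus[abs_def])
    from u show ?thesis
    proof
      assume "u = 1"
      then have "complex_of_real (torus \<omega> \<bullet> b) = (1/2) * ?w \<omega> + (1/2) * cnj (?w \<omega>)" for \<omega>
        by (simp add: b inner_axis inner_complex_def complex_eq_iff[of "complex_of_real _"])
      then show ?thesis
        using trig_poly.add[OF trig_poly.scale[OF t(1)] trig_poly.scale[OF t(2)]] by presburger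
    next
      assume "u = \<i>"
      then have "complex_of_real (torus \<omega> \<bullet> b) = (- \<i>/2) * ?w \<omega> + (\<i>/2) * cnj (?w \<omega>)" for \<omega>
        by (simp add: b inner_axis inner_complex_def complex_eq_iff[of "complex_of_real _"])
      then show ?thesis
        using trig_poly.add[OF trig_poly.scale[OF t(1)] trig_poly.scale[OF t(2)]] by presburger
    qed
  qed
  have "f z = (\<Sum>b\<in>Basis. (z \<bullet> b) * f b)" for z
  proof -
    have "f z = f (\<Sum>b\<in>Basis. (z \<bullet> b) *\<^sub>R b)"
      by (simp only: euclidean_representation)
    also have "\<dots> = (\<Sum>b\<in>Basis. (z \<bullet> b) * f b)"
      using linear by (simp add: linear_sum[OF bounded_linear.linear] linear_simps(5))
    finally show ?thesis .
  qed
  note expand = this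
  have "complex_of_real (f (torus \<omega>))
      = (\<Sum>b\<in>Basis. complex_of_real (f b) * complex_of_real (torus \<omega> \<bullet> b))" for \<omega>
    by (subst expand) (simp add: mult.commute)
  moreover have "trig_poly (\<lambda>\<omega>. \<Sum>b\<in>Basis. complex_of_real (f b) * complex_of_real (torus \<omega> \<bullet> b))"
    by (intro trig_poly_sum trig_poly.scale comp)
  ultimately show ?case
    by (simp only:)
next
  case (const c)
  show ?case
    by (rule trig_poly_const)
next
  case (add f g)
  then show ?case
    using trig_poly.add by fastforce
next
  case (mult f g)
  then show ?case
    using trig_poly_mult by fastforce
qed

locale finite_borel_measure = finite_measure \<mu>
  for \<mu> :: "(real ^ 'n) measure" +
  assumes sets_borel [measurable_cong]: "sets \<mu> = sets borel"
begin

text \<open>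
  Membership in the closure of the trigonometric polynomials in the space of square-integrable
  functions with respect to \<open>\<mu>\<close>.
\<close>

definition approximable :: "(real ^ 'n \<Rightarrow> complex) \<Rightarrow> bool" where
  "approximable g \<longleftrightarrow> g \<in> borel_measurable borel \<and>
     (\<forall>\<epsilon>>0. \<exists>p. trig_poly p \<and> (\<integral>\<^sup>+\<omega>. ennreal ((cmod (g \<omega> - p \<omega>))\<^sup>2) \<partial>\<mu>) < ennreal \<epsilon>)"

lemma sq_cmod_add_le: "(cmod (a + b))\<^sup>2 \<le> 2 * (cmod a)\<^sup>2 + 2 * (cmod b)\<^sup>2"
proof -
  have "(cmod (a + b))\<^sup>2 \<le> (cmod a + cmod b)\<^sup>2"
    by (simp add: norm_triangle_ineq power_mono)
  moreover have "0 \<le> (cmod a - cmod b)\<^sup>2"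
    by simp
  ultimately show ?thesis
    unfolding power2_diff power2_sum by linarith
qed

lemma nn_integral_sq_add_le:
  assumes [measurable]: "f \<in> borel_measurable \<mu>" "g \<in> borel_measurable \<mu>"
  shows "(\<integral>\<^sup>+\<omega>. ennreal ((cmod (f \<omega> + g \<omega>))\<^sup>2) \<partial>\<mu>)
    \<le> 2 * (\<integral>\<^sup>+\<omega>. ennreal ((cmod (f \<omega>))\<^sup>2) \<partial>\<mu>) + 2 * (\<integral>\<^sup>+\<omega>. ennreal ((cmod (g \<omega>))\<^sup>2) \<partial>\<mu>)"
proof -
  have "(\<integral>\<^sup>+\<omega>. ennreal ((cmod (f \<omega> + g \<omega>))\<^sup>2) \<partial>\<mu>)
      \<le> (\<integral>\<^sup>+\<omega>. 2 * ennreal ((cmod (f \<omega>))\<^sup>2) + 2 * ennreal ((cmod (g \<omega>))\<^sup>2) \<partial>\<mu>)"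
  proof (rule nn_integral_mono)
    fix \<omega>
    have "ennreal ((cmod (f \<omega> + g \<omega>))\<^sup>2) \<le> ennreal (2 * (cmod (f \<omega>))\<^sup>2 + 2 * (cmod (g \<omega>))\<^sup>2)"
      by (intro ennreal_leI sq_cmod_add_le)
    then show "ennreal ((cmod (f \<omega> + g \<omega>))\<^sup>2)
        \<le> 2 * ennreal ((cmod (f \<omega>))\<^sup>2) + 2 * ennreal ((cmod (g \<omega>))\<^sup>2)"
      by (simp add: ennreal_mult)
  qed
  also have "\<dots> = 2 * (\<integral>\<^sup>+\<omega>. ennreal ((cmod (f \<omega>))\<^sup>2) \<partial>\<mu>) + 2 * (\<integral>\<^sup>+\<omega>. ennreal ((cmod (g \<omega>))\<^sup>2) \<partial>\<mu>)"
    by (subst nn_integral_add) (auto simp: nn_integral_cmult)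
  finally show ?thesis .
qed

lemma approximable_measurable: "approximable g \<Longrightarrow> g \<in> borel_measurable borel"
  by (simp add: approximable_def)

lemma approximable_close:
  assumes g [measurable]: "g \<in> borel_measurable borel"
    and close: "\<And>\<epsilon>. \<epsilon> > 0 \<Longrightarrow> \<exists>h. approximable h \<and> (\<integral>\<^sup>+\<omega>. ennreal ((cmod (g \<omega> - h \<omega>))\<^sup>2) \<partial>\<mu>) < ennreal \<epsilon>"
  shows "approximable g"
  unfolding approximable_def
proof (intro conjI allI impI g)
  fix \<epsilon> :: real assume "\<epsilon> > 0"
  then obtain h where h: "approximable h" "(\<integral>\<^sup>+\<omega>. ennreal ((cmod (g \<omega> - h \<omega>))\<^sup>2) \<partial>\<mu>) < ennreal (\<epsilon>/4)"
    using close[of "\<epsilon>/4"] by auto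
  then obtain p where p: "trig_poly p" "(\<integral>\<^sup>+\<omega>. ennreal ((cmod (h \<omega> - p \<omega>))\<^sup>2) \<partial>\<mu>) < ennreal (\<epsilon>/4)"
    using \<open>\<epsilon> > 0\<close> unfolding approximable_def by (meson divide_pos_pos zero_less_numeral)
  have [measurable]: "h \<in> borel_measurable borel" "p \<in> borel_measurable borel"
    using h p by (auto simp: approximable_measurable trig_poly_measurable)
  have "(\<integral>\<^sup>+\<omega>. ennreal ((cmod (g \<omega> - p \<omega>))\<^sup>2) \<partial>\<mu>)
      = (\<integral>\<^sup>+\<omega>. ennreal ((cmod ((g \<omega> - h \<omega>) + (h \<omega> - p \<omega>)))\<^sup>2) \<partial>\<mu>)"
    by simp
  also have "\<dots> \<le> 2 * (\<integral>\<^sup>+\<omega>. ennreal ((cmod (g \<omega> - h \<omega>))\<^sup>2) \<partial>\<mu>) + 2 * (\<integral>\<^sup>+\<omega>. ennreal ((cmod (h \<omega> - p \<omega>))\<^sup>2) \<partial>\<mu>)"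
    by (rule nn_integral_sq_add_le) measurable
  also have "\<dots> < 2 * ennreal (\<epsilon>/4) + 2 * ennreal (\<epsilon>/4)"
    using h(2) p(2) by (intro add_strict_mono ennreal_mult_strict_left_mono) auto
  also have "\<dots> = ennreal \<epsilon>"
    using \<open>\<epsilon> > 0\<close> by (simp flip: ennreal_plus ennreal_mult ennreal_numeral)
  finally show "\<exists>p. trig_poly p \<and> (\<integral>\<^sup>+\<omega>. ennreal ((cmod (g \<omega> - p \<omega>))\<^sup>2) \<partial>\<mu>) < ennreal \<epsilon>"
    using p(1) by blast
qed

lemma approximable_limit:
  assumes g: "\<And>i. approximable (g i)" and bound: "\<And>i \<omega>. cmod (g i \<omega>) \<le> B"
    and lim: "\<And>\<omega>. (\<lambda>i. g i \<omega>) \<longlonglongrightarrow> h \<omega>"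
  shows "approximable h"
proof (rule approximable_close)
  have meas [measurable]: "g i \<in> borel_measurable borel" for i
    using g approximable_measurable by blast
  show h [measurable]: "h \<in> borel_measurable borel"
    by (rule borel_measurable_LIMSEQ_metric[OF meas lim])
  fix \<epsilon> :: real assume "\<epsilon> > 0"
  have hB: "cmod (h \<omega>) \<le> B" for \<omega>
    using tendsto_norm[OF lim] bound by (intro LIMSEQ_le_const2[of "\<lambda>i. cmod (g i \<omega>)"]) auto
  have "(\<lambda>i. \<integral>\<^sup>+\<omega>. ennreal ((cmod (h \<omega> - g i \<omega>))\<^sup>2) \<partial>\<mu>) \<longlonglongrightarrow> (\<integral>\<^sup>+\<omega>. 0 \<partial>\<mu>)"
  proof (rule nn_integral_dominated_convergence[where w = "\<lambda>_. ennreal ((2 * B)\<^sup>2)"])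
    show "AE \<omega> in \<mu>. ennreal ((cmod (h \<omega> - g i \<omega>))\<^sup>2) \<le> ennreal ((2 * B)\<^sup>2)" for i
    proof (intro AE_I2 ennreal_leI power_mono)
      fix \<omega> show "cmod (h \<omega> - g i \<omega>) \<le> 2 * B"
        using norm_triangle_ineq4[of "h \<omega>" "g i \<omega>"] hB[of \<omega>] bound[of i \<omega>] by linarith
    qed simp
    show "(\<integral>\<^sup>+\<omega>. ennreal ((2 * B)\<^sup>2) \<partial>\<mu>) < \<infinity>"
      by (simp add: ennreal_mult_less_top less_top)
         (simp add: emeasure_eq_measure ennreal_mult_less_top flip: less_top)
    show "AE \<omega> in \<mu>. (\<lambda>i. ennreal ((cmod (h \<omega> - g i \<omega>))\<^sup>2)) \<longlonglongrightarrow> 0"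
    proof (rule AE_I2)
      fix \<omega>
      have "(\<lambda>i. ennreal ((cmod (h \<omega> - g i \<omega>))\<^sup>2)) \<longlonglongrightarrow> ennreal ((cmod (h \<omega> - h \<omega>))\<^sup>2)"
        by (intro tendsto_intros lim)
      then show "(\<lambda>i. ennreal ((cmod (h \<omega> - g i \<omega>))\<^sup>2)) \<longlonglongrightarrow> 0"
        by simp
    qed
  qed measurable
  then have "\<forall>\<^sub>F i in sequentially. (\<integral>\<^sup>+\<omega>. ennreal ((cmod (h \<omega> - g i \<omega>))\<^sup>2) \<partial>\<mu>) < ennreal \<epsilon>"
    using \<open>\<epsilon> > 0\<close> by (intro order_tendstoD(2)) auto
  then show "\<exists>f. approximable f \<and> (\<integral>\<^sup>+\<omega>. ennreal ((cmod (h \<omega> - f \<omega>))\<^sup>2) \<partial>\<mu>) < ennreal \<epsilon>"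
    using g by (meson eventually_happens' sequentially_bot)
qed

lemma approximable_trig_poly: "trig_poly p \<Longrightarrow> approximable p"
  unfolding approximable_def using trig_poly_measurable by (auto intro!: exI[of _ p])

lemma approximable_add:
  assumes f: "approximable f" and g: "approximable g"
  shows "approximable (\<lambda>\<omega>. f \<omega> + g \<omega>)"
  unfolding approximable_def
proof (intro conjI allI impI)
  have [measurable]: "f \<in> borel_measurable borel" "g \<in> borel_measurable borel"
    using f g by (auto simp: approximable_measurable)
  show "(\<lambda>\<omega>. f \<omega> + g \<omega>) \<in> borel_measurable borel"
    by measurable
  fix \<epsilon> :: real assume "\<epsilon> > 0"
  then have e4: "\<epsilon>/4 > 0" by simp
  obtain p where p: "trig_poly p" "(\<integral>\<^sup>+\<omega>. ennreal ((cmod (f \<omega> - p \<omega>))\<^sup>2) \<partial>\<mu>) < ennreal (\<epsilon>/4)"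
    using f e4 unfolding approximable_def by meson
  obtain q where q: "trig_poly q" "(\<integral>\<^sup>+\<omega>. ennreal ((cmod (g \<omega> - q \<omega>))\<^sup>2) \<partial>\<mu>) < ennreal (\<epsilon>/4)"
    using g e4 unfolding approximable_def by meson
  have [measurable]: "p \<in> borel_measurable borel" "q \<in> borel_measurable borel"
    using p q by (auto simp: trig_poly_measurable)
  have "(\<integral>\<^sup>+\<omega>. ennreal ((cmod (f \<omega> + g \<omega> - (p \<omega> + q \<omega>)))\<^sup>2) \<partial>\<mu>)
      = (\<integral>\<^sup>+\<omega>. ennreal ((cmod ((f \<omega> - p \<omega>) + (g \<omega> - q \<omega>)))\<^sup>2) \<partial>\<mu>)"
    by (simp add: algebra_simps)
  also have "\<dots> \<le> 2 * (\<integral>\<^sup>+\<omega>. ennreal ((cmod (f \<omega> - p \<omega>))\<^sup>2) \<partial>\<mu>) + 2 * (\<integral>\<^sup>+\<omega>. ennreal ((cmod (g \<omega> - q \<omega>))\<^sup>2) \<partial>\<mu>)"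
    by (rule nn_integral_sq_add_le) measurable
  also have "\<dots> < 2 * ennreal (\<epsilon>/4) + 2 * ennreal (\<epsilon>/4)"
    using p(2) q(2) by (intro add_strict_mono ennreal_mult_strict_left_mono) auto
  also have "\<dots> = ennreal \<epsilon>"
    using \<open>\<epsilon> > 0\<close> by (simp flip: ennreal_plus ennreal_mult ennreal_numeral)
  finally show "\<exists>r. trig_poly r \<and> (\<integral>\<^sup>+\<omega>. ennreal ((cmod (f \<omega> + g \<omega> - r \<omega>))\<^sup>2) \<partial>\<mu>) < ennreal \<epsilon>"
    using trig_poly.add[OF p(1) q(1)] by blast
qed

lemma approximable_scale:
  assumes f: "approximable f"
  shows "approximable (\<lambda>\<omega>. c * f \<omega>)"
  unfolding approximable_def
proof (intro conjI allI impI)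
  have [measurable]: "f \<in> borel_measurable borel"
    using f by (auto simp: approximable_measurable)
  show "(\<lambda>\<omega>. c * f \<omega>) \<in> borel_measurable borel"
    by measurable
  fix \<epsilon> :: real assume "\<epsilon> > 0"
  then have e: "\<epsilon> / ((cmod c)\<^sup>2 + 1) > 0"
    by (simp add: add_nonneg_pos)
  obtain p where p: "trig_poly p"
      "(\<integral>\<^sup>+\<omega>. ennreal ((cmod (f \<omega> - p \<omega>))\<^sup>2) \<partial>\<mu>) < ennreal (\<epsilon> / ((cmod c)\<^sup>2 + 1))"
    using f e unfolding approximable_def by meson
  have [measurable]: "p \<in> borel_measurable borel"
    using p by (auto simp: trig_poly_measurable)
  have "(\<integral>\<^sup>+\<omega>. ennreal ((cmod (c * f \<omega> - c * p \<omega>))\<^sup>2) \<partial>\<mu>)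
      = (\<integral>\<^sup>+\<omega>. ennreal ((cmod c)\<^sup>2) * ennreal ((cmod (f \<omega> - p \<omega>))\<^sup>2) \<partial>\<mu>)"
    by (simp add: norm_mult power_mult_distrib ennreal_mult flip: right_diff_distrib)
  also have "\<dots> = ennreal ((cmod c)\<^sup>2) * (\<integral>\<^sup>+\<omega>. ennreal ((cmod (f \<omega> - p \<omega>))\<^sup>2) \<partial>\<mu>)"
    by (rule nn_integral_cmult) measurable
  also have "\<dots> \<le> ennreal ((cmod c)\<^sup>2) * ennreal (\<epsilon> / ((cmod c)\<^sup>2 + 1))"
    using p(2) by (intro mult_left_mono) auto
  also have "\<dots> = ennreal ((cmod c)\<^sup>2 * (\<epsilon> / ((cmod c)\<^sup>2 + 1)))"
    using e by (subst ennreal_mult) auto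
  also have "\<dots> < ennreal \<epsilon>"
  proof (rule ennreal_lessI)
    have "(cmod c)\<^sup>2 * \<epsilon> < \<epsilon> * ((cmod c)\<^sup>2 + 1)"
      using \<open>\<epsilon> > 0\<close> by (simp add: algebra_simps)
    then show "(cmod c)\<^sup>2 * (\<epsilon> / ((cmod c)\<^sup>2 + 1)) < \<epsilon>"
      using add_nonneg_pos[of "(cmod c)\<^sup>2" 1] by (simp add: divide_less_eq)
  qed fact
  finally show "\<exists>r. trig_poly r \<and> (\<integral>\<^sup>+\<omega>. ennreal ((cmod (c * f \<omega> - r \<omega>))\<^sup>2) \<partial>\<mu>) < ennreal \<epsilon>"
    using trig_poly.scale[OF p(1)] by blast
qed

lemma approximable_sum:
  assumes "\<And>i. i \<in> I \<Longrightarrow> approximable (f i)"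
  shows "approximable (\<lambda>\<omega>. \<Sum>i\<in>I. f i \<omega>)"
  using assms
  by (induction I rule: infinite_finite_induct)
     (auto intro: approximable_trig_poly trig_poly_const approximable_add)

lemma approximable_continuous:
  fixes f :: "complex ^ 'n \<Rightarrow> real"
  assumes f: "continuous_on UNIV f"
  shows "approximable (\<lambda>\<omega>. complex_of_real (f (torus \<omega>)))"
  unfolding approximable_def
proof (intro conjI allI impI)
  have [measurable]: "f \<in> borel_measurable borel"
    using f by (rule borel_measurable_continuous_onI)
  show "(\<lambda>\<omega>. complex_of_real (f (torus \<omega>))) \<in> borel_measurable borel"
    by measurable
  fix \<epsilon> :: real assume "\<epsilon> > 0"
  define S where "S = {z :: complex ^ 'n. \<forall>i. cmod (z $ i) = 1}"
  have "closed S"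
    unfolding S_def by (intro closed_Collect_all closed_Collect_eq continuous_intros)
  moreover have "bounded S"
  proof (rule boundedI)
    fix z :: "complex ^ 'n" assume "z \<in> S"
    then show "norm z \<le> (\<Sum>i\<in>(UNIV :: 'n set). 1)"
      using L2_set_le_sum[of UNIV "\<lambda>i. cmod (z $ i)"] by (simp add: S_def norm_vec_def)
  qed
  ultimately have "compact S"
    by (simp add: compact_eq_bounded_closed)
  define M where "M = measure \<mu> (space \<mu>)"
  define e where "e = sqrt (\<epsilon> / (M + 1))"
  have "M \<ge> 0" by (simp add: M_def)
  then have "e > 0" "e\<^sup>2 = \<epsilon> / (M + 1)"
    using \<open>\<epsilon> > 0\<close> by (simp_all add: e_def)
  obtain q where q: "real_polynomial_function q" "\<And>z. z \<in> S \<Longrightarrow> \<bar>f z - q z\<bar> < e"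
    using Stone_Weierstrass_real_polynomial_function[OF \<open>compact S\<close> continuous_on_subset[OF f] \<open>e > 0\<close>]
    by (metis subset_UNIV)
  have "torus \<omega> \<in> S" for \<omega>
    by (simp add: S_def)
  then have le: "(cmod (complex_of_real (f (torus \<omega>)) - complex_of_real (q (torus \<omega>))))\<^sup>2 \<le> e\<^sup>2" for \<omega>
    using q(2)[of "torus \<omega>"] unfolding of_real_diff[symmetric] norm_of_real
    by (intro power_mono) auto
  have "(\<integral>\<^sup>+\<omega>. ennreal ((cmod (complex_of_real (f (torus \<omega>)) - complex_of_real (q (torus \<omega>))))\<^sup>2) \<partial>\<mu>)
      \<le> (\<integral>\<^sup>+\<omega>. ennreal (e\<^sup>2) \<partial>\<mu>)"
    by (intro nn_integral_mono ennreal_leI le)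
  also have "\<dots> = ennreal (\<epsilon> / (M + 1) * M)"
    using \<open>\<epsilon> > 0\<close> \<open>M \<ge> 0\<close>
    by (simp only: \<open>e\<^sup>2 = _\<close> nn_integral_const emeasure_eq_measure M_def[symmetric]) (subst ennreal_mult, auto)
  also have "\<dots> < ennreal \<epsilon>"
  proof (rule ennreal_lessI)
    have "\<epsilon> * M < \<epsilon> * (M + 1)"
      using \<open>\<epsilon> > 0\<close> by simp
    then show "\<epsilon> / (M + 1) * M < \<epsilon>"
      using \<open>M \<ge> 0\<close> by (simp add: divide_less_eq)
  qed fact
  finally show "\<exists>p. trig_poly p \<and>
      (\<integral>\<^sup>+\<omega>. ennreal ((cmod (complex_of_real (f (torus \<omega>)) - p \<omega>))\<^sup>2) \<partial>\<mu>) < ennreal \<epsilon>"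
    using trig_poly_real_polynomial_torus[OF q(1)] by blast
qed

text \<open>
  The indicator of an open set is the increasing limit of continuous functions.
\<close>

lemma approximable_open:
  assumes U: "open U"
  shows "approximable (\<lambda>\<omega>. complex_of_real (indicator U (torus \<omega>)))"
proof (cases "U = UNIV")
  case True
  then show ?thesis
    using approximable_trig_poly[OF trig_poly_const, of 1] by simp
next
  case False
  define f where "f = (\<lambda>i z. min 1 (real i * infdist z (- U)))"
  have app: "approximable (\<lambda>\<omega>. complex_of_real (f i (torus \<omega>)))" for i
    unfolding f_def by (intro approximable_continuous continuous_intros)
  have bd: "cmod (complex_of_real (f i z)) \<le> 1" for i z
    by (simp add: f_def infdist_nonneg min_def)
  have lim: "(\<lambda>i. f i z) \<longlonglongrightarrow> indicator U z" for z
  proof (cases "z \<in> U")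
    case True
    have pos: "infdist z (- U) > 0"
      using infdist_pos_not_in_closed[of "- U" z] U False True by (auto simp: closed_def)
    obtain N where N: "1 / infdist z (- U) < real N"
      using reals_Archimedean2 by blast
    have "f i z = 1" if "i \<ge> N" for i
    proof -
      have "1 / infdist z (- U) \<le> real i"
        using N that by linarith
      then have "1 \<le> real i * infdist z (- U)"
        using pos by (simp add: divide_le_eq)
      then show ?thesis by (simp add: f_def)
    qed
    then have "eventually (\<lambda>i. f i z = 1) sequentially"
      unfolding eventually_sequentially by blast
    then have "(\<lambda>i. f i z) \<longlonglongrightarrow> 1"
      by (rule tendsto_eventually)
    then show ?thesis
      using True by simp
  next
    case False
    then have "(\<lambda>i. f i z) = (\<lambda>i. 0)"
      by (simp add: f_def)
    then show ?thesis
      using False by simp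
  qed
  show ?thesis
    by (rule approximable_limit[OF app bd tendsto_of_real[OF lim]])
qed

lemma approximable_set:
  assumes "A \<in> sets (borel :: (complex ^ 'n) measure)"
  shows "approximable (\<lambda>\<omega>. complex_of_real (indicator A (torus \<omega>)))"
proof -
  have "Int_stable {S :: (complex ^ 'n) set. open S}"
    by (auto simp: Int_stable_def)
  moreover have "{S :: (complex ^ 'n) set. open S} \<subseteq> Pow UNIV"
    by simp
  moreover have "A \<in> sigma_sets UNIV {S. open S}"
    using assms by (simp add: borel_def)
  ultimately show ?thesis
  proof (induction rule: sigma_sets_induct_disjoint)
    case (basic A)
    then show ?case
      by (simp add: approximable_open)
  next
    case empty
    show ?case
      using approximable_trig_poly[OF trig_poly_const, of 0] by simp
  next
    case (compl A)
    have "approximable (\<lambda>\<omega>. 1 + (-1) * complex_of_real (indicator A (torus \<omega>)))"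
      by (intro approximable_add approximable_scale compl.IH approximable_trig_poly trig_poly_const)
    moreover have "1 + (-1) * complex_of_real (indicator A z) = complex_of_real (indicator (UNIV - A) z)" for z
      by (simp add: indicator_def)
    ultimately show ?case
      by simp
  next
    case (union A)
    let ?s = "\<lambda>n \<omega>. \<Sum>i<n. complex_of_real (indicator (A i) (torus \<omega>))"
    have eq: "?s n \<omega> = complex_of_real (indicator (\<Union>i<n. A i) (torus \<omega>))" for n \<omega>
      using union(1) unfolding of_real_sum[symmetric]
      by (subst indicator_UN_disjoint) (auto simp: disjoint_family_on_def)
    show ?case
    proof (rule approximable_limit[where B = 1])
      show "approximable (?s n)" for n
        by (intro approximable_sum union.IH)
      show "cmod (?s n \<omega>) \<le> 1" for n \<omega>
        unfolding eq by (simp add: indicator_def)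
      show "(\<lambda>n. ?s n \<omega>) \<longlonglongrightarrow> complex_of_real (indicator (\<Union>i. A i) (torus \<omega>))" for \<omega>
        unfolding eq by (intro tendsto_of_real LIMSEQ_indicator_UN)
    qed
  qed
qed

lemma approximable_nonneg:
  assumes "u \<in> borel_measurable borel" "\<And>z. 0 \<le> u z" "\<And>z. u z \<le> B"
  shows "approximable (\<lambda>\<omega>. complex_of_real (u (torus \<omega>)))"
  using assms
proof (induction u arbitrary: B rule: borel_measurable_induct_real)
  case (set A)
  then show ?case by (intro approximable_set) simp
next
  case (mult u c)
  show ?case
  proof (cases "c = 0")
    case True
    then show ?thesis
      using approximable_trig_poly[OF trig_poly_const, of 0] by simp
  next
    case False
    then have "u z \<le> B / c" for z
      using mult.prems[of z] mult.hyps by (simp add: pos_le_divide_eq mult.commute)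
    then show ?thesis
      unfolding of_real_mult by (intro approximable_scale mult.IH)
  qed
next
  case (add u v)
  have "u z \<le> B" "v z \<le> B" for z
    using add.prems[of z] add.hyps(2)[of z] add.hyps(4)[of z] by linarith+
  then show ?case
    unfolding of_real_add by (intro approximable_add add.IH)
next
  case (seq U)
  have le: "U i z \<le> u z" for i z
    using incseq_le[of "\<lambda>i. U i z" "u z" i] seq.hyps(3) seq.hyps(4)[of z]
    by (auto simp: incseq_def le_fun_def)
  show ?case
  proof (rule approximable_limit[where B = B])
    show "approximable (\<lambda>\<omega>. complex_of_real (U i (torus \<omega>)))" for i
      using le seq.prems by (intro seq.IH[of _ B]) (meson order_trans)
    show "cmod (complex_of_real (U i (torus \<omega>))) \<le> B" for i \<omega>
      using order_trans[OF le seq.prems] seq.hyps(2) by simp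
    show "(\<lambda>i. complex_of_real (U i (torus \<omega>))) \<longlonglongrightarrow> complex_of_real (u (torus \<omega>))" for \<omega>
      by (intro tendsto_of_real seq.hyps(4)) simp
  qed
qed

lemma approximable_bounded:
  fixes g :: "complex ^ 'n \<Rightarrow> complex"
  assumes [measurable]: "g \<in> borel_measurable borel" and B: "\<And>z. cmod (g z) \<le> B"
  shows "approximable (\<lambda>\<omega>. g (torus \<omega>))"
proof -
  have re: "\<bar>Re (g z)\<bar> \<le> B" "\<bar>Im (g z)\<bar> \<le> B" for z
    using B[of z] abs_Re_le_cmod[of "g z"] abs_Im_le_cmod[of "g z"] by linarith+
  have "approximable (\<lambda>\<omega>. complex_of_real (u (torus \<omega>)))"
    if [measurable]: "u \<in> borel_measurable borel" and u: "\<And>z. \<bar>u z\<bar> \<le> B" for u :: "complex ^ 'n \<Rightarrow> real"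
  proof -
    have pos: "approximable (\<lambda>\<omega>. complex_of_real (u (torus \<omega>) + B))"
    proof (rule approximable_nonneg[of "\<lambda>z. u z + B" "2 * B"])
      show "0 \<le> u z + B" "u z + B \<le> 2 * B" for z
        using u[of z] by linarith+
    qed measurable
    have "approximable (\<lambda>\<omega>. complex_of_real (u (torus \<omega>) + B) + (- complex_of_real B))"
      by (intro approximable_add pos approximable_trig_poly trig_poly_const)
    then show ?thesis
      by simp
  qed
  from this[of "\<lambda>z. Re (g z)"] this[of "\<lambda>z. Im (g z)"]
  have "approximable (\<lambda>\<omega>. complex_of_real (Re (g (torus \<omega>))) + \<i> * complex_of_real (Im (g (torus \<omega>))))"
    using re by (intro approximable_add approximable_scale) auto
  then show ?thesis
    by (simp flip: complex_eq)
qed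

end

lemma borel_measurable_Arg: "Arg \<in> borel_measurable borel"
proof -
  have "(\<lambda>z. indicator (- \<real>\<^sub>\<le>\<^sub>0) z *\<^sub>R Arg z) \<in> borel_measurable borel"
    by (intro borel_measurable_continuous_on_indicator continuous_on_Arg borel_comp borel_closed closed_nonpos_Reals_complex)
  moreover have "(\<lambda>z :: complex. indicator (\<real>\<^sub>\<le>\<^sub>0 - {0}) z *\<^sub>R pi) \<in> borel_measurable borel"
    by (intro borel_measurable_scaleR borel_measurable_indicator sets.Diff borel_closed closed_nonpos_Reals_complex) auto
  ultimately have "(\<lambda>z. indicator (- \<real>\<^sub>\<le>\<^sub>0) z *\<^sub>R Arg z + indicator (\<real>\<^sub>\<le>\<^sub>0 - {0}) z *\<^sub>R pi) \<in> borel_measurable borel"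
    by (rule borel_measurable_add)
  moreover have "indicator (- \<real>\<^sub>\<le>\<^sub>0) z *\<^sub>R Arg z + indicator (\<real>\<^sub>\<le>\<^sub>0 - {0}) z *\<^sub>R pi = Arg z" for z
  proof (cases "z = 0")
    case False
    then show ?thesis
      using Arg_eq_pi[of z] by (auto simp: indicator_def complex_nonpos_Reals_iff complex_eq_iff)
  qed (simp add: Arg_zero)
  ultimately show ?thesis
    by simp
qed

text \<open>
  Recovers a vector from its image on the torus up to an integer vector, which periodic functions
  do not see.
\<close>

definition torus_inverse :: "complex ^ 'n \<Rightarrow> real ^ 'n" where
  "torus_inverse z = (\<chi> i. - Arg (z $ i) / (2 * pi))"

lemma borel_measurable_torus_inverse [measurable]: "torus_inverse \<in> borel_measurable borel"
proof -
  have "(\<lambda>z :: complex ^ 'n. z $ i) \<in> borel_measurable borel" for i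
    by (intro borel_measurable_continuous_onI continuous_intros)
  then have [measurable]: "(\<lambda>z :: complex ^ 'n. Arg (z $ i)) \<in> borel_measurable borel" for i
    using borel_measurable_Arg by (rule measurable_compose)
  show ?thesis
    unfolding torus_inverse_def
    by (rule borel_measurable_euclidean_space[THEN iffD2])
       (auto simp: Basis_vec_def inner_axis intro!: borel_measurable_divide)
qed

lemma torus_inverse_torus: "\<exists>k. torus_inverse (torus \<omega>) = \<omega> + of_int_vec k"
proof -
  have "\<exists>n :: int. - Arg (torus \<omega> $ i) / (2 * pi) = \<omega> $ i + of_int n" for i
  proof -
    let ?z = "torus \<omega> $ i"
    have "?z \<noteq> 0" "cmod ?z = 1"
      by simp_all
    then have "cis (Arg ?z) = cis (- 2 * pi * \<omega> $ i)"
      unfolding torus_nth_cis[symmetric] by (subst cis_Arg) (simp_all add: sgn_div_norm)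
    then obtain n :: int where "Complex 0 (Arg ?z) = Complex 0 (- 2 * pi * \<omega> $ i) + of_real (2 * of_int n * pi) * \<i>"
      unfolding cis_conv_exp by (subst (asm) exp_eq) (auto simp: complex_eq_iff)
    then have "Arg ?z = - 2 * pi * \<omega> $ i + 2 * of_int n * pi"
      by (simp add: complex_eq_iff)
    then have "- Arg ?z / (2 * pi) = \<omega> $ i + of_int (- n)"
      by (simp add: field_simps)
    then show ?thesis by blast
  qed
  then obtain n where "\<And>i. - Arg (torus \<omega> $ i) / (2 * pi) = \<omega> $ i + of_int (n i)"
    by metis
  then show ?thesis
    by (intro exI[of _ "\<chi> i. n i"]) (simp add: torus_inverse_def vec_eq_iff del: torus_nth)
qed

theorem (in finite_borel_measure) trig_poly_dense:
  assumes m: "periodic_multiplier m" and "\<epsilon> > 0"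
  shows "\<exists>p. trig_poly p \<and> (\<integral>\<^sup>+\<omega>. ennreal ((cmod (m \<omega> - p \<omega>))\<^sup>2) \<partial>\<mu>) < ennreal \<epsilon>"
proof -
  have [measurable]: "m \<in> borel_measurable borel"
    using periodic_multiplierD(1)[OF m] .
  have "m (torus_inverse (torus \<omega>)) = m \<omega>" for \<omega>
    using torus_inverse_torus[of \<omega>] periodic_multiplierD(3)[OF m] by metis
  moreover obtain B where "\<And>\<omega>. cmod (m \<omega>) \<le> B"
    using periodic_multiplierD(2)[OF m] by blast
  then have "approximable (\<lambda>\<omega>. m (torus_inverse (torus \<omega>)))"
    by (intro approximable_bounded[of "\<lambda>z. m (torus_inverse z)"]) measurable
  ultimately have "approximable m"
    by simp
  then show ?thesis
    using \<open>\<epsilon> > 0\<close> unfolding approximable_def by blast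
qed

section \<open>The unit cube as a fundamental domain\<close>

definition floor_vec :: "real ^ 'n \<Rightarrow> int ^ 'n" where
  "floor_vec \<omega> = (\<chi> i. \<lfloor>\<omega> $ i\<rfloor>)"

lemma diff_of_int_vec_in_cube: "\<omega> - of_int_vec k \<in> unit_cube \<longleftrightarrow> k = floor_vec \<omega>"
proof -
  have "\<omega> - of_int_vec k \<in> unit_cube \<longleftrightarrow> (\<forall>i. of_int (k $ i) \<le> \<omega> $ i \<and> \<omega> $ i < of_int (k $ i) + 1)"
    by (simp add: unit_cube_def) (simp add: algebra_simps)
  also have "\<dots> \<longleftrightarrow> (\<forall>i. \<lfloor>\<omega> $ i\<rfloor> = k $ i)"
    by (simp add: floor_eq_iff)
  finally show ?thesis
    by (auto simp: floor_vec_def vec_eq_iff)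
qed

lemma add_of_int_vec_in_cube: "\<omega> + of_int_vec k \<in> unit_cube \<longleftrightarrow> k = - floor_vec \<omega>"
  using diff_of_int_vec_in_cube[of \<omega> "- k"] minus_equation_iff[of k "floor_vec \<omega>"]
  by (auto simp: of_int_vec_minus)

lemma floor_vec_cube_shift: "\<omega> \<in> unit_cube \<Longrightarrow> floor_vec (\<omega> + of_int_vec k) = k"
  using diff_of_int_vec_in_cube[of "\<omega> + of_int_vec k" k] by simp

definition frac_vec :: "real ^ 'n \<Rightarrow> real ^ 'n" where
  "frac_vec \<omega> = \<omega> - of_int_vec (floor_vec \<omega>)"

lemma frac_vec_in_cube [simp]: "frac_vec \<omega> \<in> unit_cube"
  by (simp add: frac_vec_def diff_of_int_vec_in_cube)

lemma frac_vec_cube: "\<omega> \<in> unit_cube \<Longrightarrow> frac_vec \<omega> = \<omega>"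
  using diff_of_int_vec_in_cube[of \<omega> 0] by (simp add: frac_vec_def)

lemma frac_vec_periodic [simp]: "frac_vec (\<omega> + of_int_vec k) = frac_vec \<omega>"
  by (simp add: frac_vec_def floor_vec_def of_int_vec_def vec_eq_iff)

lemma borel_measurable_vec_nth [measurable]: "(\<lambda>\<omega> :: real ^ 'n. \<omega> $ i) \<in> borel_measurable borel"
  by (intro borel_measurable_continuous_onI continuous_intros)

lemma borel_measurable_frac_vec [measurable]: "frac_vec \<in> borel_measurable borel"
proof (rule borel_measurable_euclidean_space[THEN iffD2], safe)
  fix b :: "real ^ 'a" assume "b \<in> Basis"
  then obtain i where b: "b = axis i 1"
    by (auto simp: Basis_vec_def)
  have "frac_vec \<omega> \<bullet> b = \<omega> $ i - of_int \<lfloor>\<omega> $ i\<rfloor>" for \<omega>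
    by (simp add: b inner_axis frac_vec_def floor_vec_def)
  then show "(\<lambda>\<omega>. frac_vec \<omega> \<bullet> b) \<in> borel_measurable borel"
    by simp
qed

lemma nn_integral_translate:
  fixes c :: "'a::euclidean_space"
  assumes [measurable]: "g \<in> borel_measurable borel"
  shows "(\<integral>\<^sup>+\<omega>. g (\<omega> + c) \<partial>lborel) = (\<integral>\<^sup>+\<omega>. g \<omega> \<partial>lborel)"
proof -
  have "(\<integral>\<^sup>+\<omega>. g \<omega> \<partial>lborel) = (\<integral>\<^sup>+\<omega>. g \<omega> \<partial>distr lborel borel ((+) c))"
    by (simp add: lborel_distr_plus)
  also have "\<dots> = (\<integral>\<^sup>+\<omega>. g (\<omega> + c) \<partial>lborel)"
    by (subst nn_integral_distr) (auto simp: add.commute)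
  finally show ?thesis ..
qed

lemma integral_translate:
  fixes c :: "'a::euclidean_space" and g :: "'a \<Rightarrow> complex"
  assumes [measurable]: "g \<in> borel_measurable borel"
  shows "(LINT \<omega>|lborel. g (\<omega> + c)) = (LINT \<omega>|lborel. g \<omega>)"
proof -
  have "(LINT \<omega>|lborel. g \<omega>) = (LINT \<omega>|distr lborel borel ((+) c). g \<omega>)"
    by (simp add: lborel_distr_plus)
  also have "\<dots> = (LINT \<omega>|lborel. g (\<omega> + c))"
    by (subst integral_distr) (auto simp: add.commute)
  finally show ?thesis ..
qed

lemma nn_integral_indicator_cube_translates:
  "(\<integral>\<^sup>+k. indicator unit_cube (\<omega> - of_int_vec k) \<partial>count_space UNIV) = 1"
  "(\<integral>\<^sup>+k. indicator unit_cube (\<omega> + of_int_vec k) \<partial>count_space UNIV) = 1"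
  by (subst nn_integral_count_space'[where A = "{floor_vec \<omega>}"])
     (auto simp: indicator_def diff_of_int_vec_in_cube,
      subst nn_integral_count_space'[where A = "{- floor_vec \<omega>}"],
      auto simp: indicator_def add_of_int_vec_in_cube)

text \<open>The integer translates of the half-open cube partition the space.\<close>

lemma nn_integral_tiling:
  fixes f :: "real ^ 'n \<Rightarrow> ennreal"
  assumes [measurable]: "f \<in> borel_measurable borel"
  shows "(\<integral>\<^sup>+\<omega>. f \<omega> \<partial>lborel)
    = (\<integral>\<^sup>+\<omega>. indicator unit_cube \<omega> * (\<integral>\<^sup>+k. f (\<omega> + of_int_vec k) \<partial>count_space UNIV) \<partial>lborel)"
proof -
  have "(\<integral>\<^sup>+\<omega>. f \<omega> \<partial>lborel)
      = (\<integral>\<^sup>+\<omega>. (\<integral>\<^sup>+k. indicator unit_cube (\<omega> - of_int_vec k) * f \<omega> \<partial>count_space UNIV) \<partial>lborel)"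
    by (simp add: nn_integral_multc nn_integral_indicator_cube_translates)
  also have "\<dots> = (\<integral>\<^sup>+k. (\<integral>\<^sup>+\<omega>. indicator unit_cube (\<omega> - of_int_vec k) * f \<omega> \<partial>lborel) \<partial>count_space UNIV)"
    by (rule nn_integral_count_space_nn_integral) auto
  also have "\<dots> = (\<integral>\<^sup>+k. (\<integral>\<^sup>+\<omega>. indicator unit_cube \<omega> * f (\<omega> + of_int_vec k) \<partial>lborel) \<partial>count_space UNIV)"
  proof (rule nn_integral_cong)
    fix k :: "int ^ 'n"
    show "(\<integral>\<^sup>+\<omega>. indicator unit_cube (\<omega> - of_int_vec k) * f \<omega> \<partial>lborel)
        = (\<integral>\<^sup>+\<omega>. indicator unit_cube \<omega> * f (\<omega> + of_int_vec k) \<partial>lborel)"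
      using nn_integral_translate[of "\<lambda>\<omega>. indicator unit_cube (\<omega> - of_int_vec k) * f \<omega>" "of_int_vec k"]
      by simp
  qed
  also have "\<dots> = (\<integral>\<^sup>+\<omega>. (\<integral>\<^sup>+k. indicator unit_cube \<omega> * f (\<omega> + of_int_vec k) \<partial>count_space UNIV) \<partial>lborel)"
    by (rule nn_integral_count_space_nn_integral[symmetric]) auto
  finally show ?thesis
    by (simp add: nn_integral_cmult)
qed

lemma AE_cube_iff:
  "(AE \<omega> in lborel. P \<omega>) \<longleftrightarrow> (AE \<omega> in lborel. \<omega> \<in> unit_cube \<longrightarrow> (\<forall>k. P (\<omega> + of_int_vec k)))"
proof
  assume P: "AE \<omega> in lborel. P \<omega>"
  have "AE \<omega> in lborel. \<forall>k. P (\<omega> + of_int_vec k)"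
  proof (subst AE_all_countable, rule allI)
    fix k show "AE \<omega> in lborel. P (\<omega> + of_int_vec k)"
      using AE_lborel_translate[OF P, of "- of_int_vec k"] by simp
  qed
  then show "AE \<omega> in lborel. \<omega> \<in> unit_cube \<longrightarrow> (\<forall>k. P (\<omega> + of_int_vec k))"
    by eventually_elim blast
next
  assume P: "AE \<omega> in lborel. \<omega> \<in> unit_cube \<longrightarrow> (\<forall>k. P (\<omega> + of_int_vec k))"
  have "AE \<omega> in lborel. \<forall>k. \<omega> - of_int_vec k \<in> unit_cube \<longrightarrow> (\<forall>l. P (\<omega> - of_int_vec k + of_int_vec l))"
    by (subst AE_all_countable) (use AE_lborel_translate[OF P] in blast)
  then show "AE \<omega> in lborel. P \<omega>"
    by eventually_elim (metis diff_add_cancel diff_of_int_vec_in_cube)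
qed

definition cube_measure :: "(real ^ 'n) measure" where
  "cube_measure = density lborel (\<lambda>\<omega>. ennreal (indicator unit_cube \<omega>))"

lemma sets_cube_measure [simp, measurable_cong]: "sets cube_measure = sets borel"
  and space_cube_measure [simp]: "space cube_measure = UNIV"
  by (simp_all add: cube_measure_def)

lemma nn_integral_cube_measure:
  "f \<in> borel_measurable borel \<Longrightarrow>
    (\<integral>\<^sup>+\<omega>. f \<omega> \<partial>cube_measure) = (\<integral>\<^sup>+\<omega>. indicator unit_cube \<omega> * f \<omega> \<partial>lborel)"
  unfolding cube_measure_def by (subst nn_integral_density) (auto simp: ennreal_indicator)

lemma integral_cube_measure:
  fixes f :: "real ^ 'n \<Rightarrow> 'b::{banach, second_countable_topology}"
  shows "f \<in> borel_measurable borel \<Longrightarrow>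
    (LINT \<omega>|cube_measure. f \<omega>) = (LINT \<omega>|lborel. indicator unit_cube \<omega> *\<^sub>R f \<omega>)"
  unfolding cube_measure_def by (subst integral_density) auto

lemma emeasure_unit_cube: "emeasure lborel (unit_cube :: (real ^ 'n) set) = 1"
proof (rule antisym)
  have one: "(\<Prod>b\<in>Basis. (1 :: real ^ 'n) \<bullet> b) = 1" "\<forall>b\<in>Basis. 0 \<le> (1 :: real ^ 'n) \<bullet> b"
    by (auto intro!: prod.neutral simp: Basis_vec_def inner_axis)
  have "unit_cube \<subseteq> cbox (0 :: real ^ 'n) 1"
    by (auto simp: unit_cube_def mem_box_cart less_imp_le)
  then have "emeasure lborel (unit_cube :: (real ^ 'n) set) \<le> emeasure lborel (cbox (0 :: real ^ 'n) 1)"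
    by (intro emeasure_mono) auto
  also have "\<dots> = 1"
    using one by (simp add: emeasure_lborel_cbox_eq)
  finally show "emeasure lborel (unit_cube :: (real ^ 'n) set) \<le> 1" .
  have "1 = emeasure lborel (box (0 :: real ^ 'n) 1)"
    using one by (simp add: emeasure_lborel_box_eq)
  also have "\<dots> \<le> emeasure lborel (unit_cube :: (real ^ 'n) set)"
    by (intro emeasure_mono) (auto simp: unit_cube_def mem_box_cart less_imp_le)
  finally show "1 \<le> emeasure lborel (unit_cube :: (real ^ 'n) set)" .
qed

lemma emeasure_cube_measure [simp]: "emeasure cube_measure UNIV = 1"
  by (simp add: cube_measure_def emeasure_density ennreal_indicator emeasure_unit_cube)

interpretation cube_measure: finite_borel_measure "cube_measure :: (real ^ 'n) measure"
  by (intro finite_borel_measure.intro finite_measureI finite_borel_measure_axioms.intro) simp_all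

lemma measure_cube_measure [simp]: "measure cube_measure UNIV = 1"
  by (simp add: measure_def)

text \<open>
  A translate of the cube also meets every coset of the integer vectors exactly once.
\<close>

lemma nn_integral_cube_translate:
  fixes f :: "real ^ 'n \<Rightarrow> ennreal"
  assumes [measurable]: "f \<in> borel_measurable borel" and per: "\<And>\<omega> k. f (\<omega> + of_int_vec k) = f \<omega>"
  shows "(\<integral>\<^sup>+\<omega>. f (\<omega> + c) \<partial>cube_measure) = (\<integral>\<^sup>+\<omega>. f \<omega> \<partial>cube_measure)"
proof -
  have "(\<integral>\<^sup>+\<omega>. f (\<omega> + c) \<partial>cube_measure) = (\<integral>\<^sup>+\<omega>. indicator unit_cube \<omega> * f (\<omega> + c) \<partial>lborel)"
    by (rule nn_integral_cube_measure) measurable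
  also have "\<dots> = (\<integral>\<^sup>+\<omega>. indicator unit_cube (\<omega> - c) * f \<omega> \<partial>lborel)"
    using nn_integral_translate[of "\<lambda>\<omega>. indicator unit_cube (\<omega> - c) * f \<omega>" c] by simp
  also have "\<dots> = (\<integral>\<^sup>+\<omega>. indicator unit_cube \<omega> *
      (\<integral>\<^sup>+k. indicator unit_cube (\<omega> - c + of_int_vec k) * f \<omega> \<partial>count_space UNIV) \<partial>lborel)"
    by (subst nn_integral_tiling) (auto simp: per algebra_simps)
  also have "\<dots> = (\<integral>\<^sup>+\<omega>. indicator unit_cube \<omega> * f \<omega> \<partial>lborel)"
    by (simp add: nn_integral_multc nn_integral_indicator_cube_translates)
  also have "\<dots> = (\<integral>\<^sup>+\<omega>. f \<omega> \<partial>cube_measure)"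
    by (rule nn_integral_cube_measure[symmetric]) measurable
  finally show ?thesis .
qed

lemma integral_cube_translate:
  fixes g :: "real ^ 'n \<Rightarrow> real"
  assumes [measurable]: "g \<in> borel_measurable borel" and per: "\<And>\<omega> k. g (\<omega> + of_int_vec k) = g \<omega>"
    and bound: "\<And>\<omega>. \<bar>g \<omega>\<bar> \<le> 1"
  shows "(LINT \<omega>|cube_measure. g (\<omega> + c)) = (LINT \<omega>|cube_measure. g \<omega>)"
proof -
  have int: "integrable cube_measure (\<lambda>\<omega>. g (\<omega> + d))" for d
    using bound by (intro cube_measure.integrable_const_bound[where B = 1]) auto
  \<comment> \<open>adding \<open>1\<close> makes the integrand nonnegative\<close>
  have nonneg: "0 \<le> 1 + g \<omega>" for \<omega>
    using bound[of \<omega>] by linarith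
  have "ennreal (1 + (LINT \<omega>|cube_measure. g (\<omega> + d))) = (\<integral>\<^sup>+\<omega>. ennreal (1 + g (\<omega> + d)) \<partial>cube_measure)" for d
  proof -
    have "(\<integral>\<^sup>+\<omega>. ennreal (1 + g (\<omega> + d)) \<partial>cube_measure) = ennreal (LINT \<omega>|cube_measure. 1 + g (\<omega> + d))"
      using int[of d] nonneg by (intro nn_integral_eq_integral) auto
    also have "(LINT \<omega>|cube_measure. 1 + g (\<omega> + d)) = 1 + (LINT \<omega>|cube_measure. g (\<omega> + d))"
      using int[of d] by simp
    finally show ?thesis ..
  qed
  from this[of c] this[of 0]
  have "ennreal (1 + (LINT \<omega>|cube_measure. g (\<omega> + c))) = ennreal (1 + (LINT \<omega>|cube_measure. g \<omega>))"
    using nn_integral_cube_translate[of "\<lambda>\<omega>. ennreal (1 + g \<omega>)" c] by (simp add: per)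
  moreover have "0 \<le> 1 + (LINT \<omega>|cube_measure. g (\<omega> + d))" for d
  proof -
    have "- 1 \<le> g (\<omega> + d)" for \<omega>
      using bound[of "\<omega> + d"] by linarith
    then have "(LINT \<omega>|(cube_measure :: (real ^ 'n) measure). - 1) \<le> (LINT \<omega>|cube_measure. g (\<omega> + d))"
      by (intro Bochner_Integration.integral_mono int) auto
    then show ?thesis
      by simp
  qed
  from this[of c] this[of 0] have "0 \<le> 1 + (LINT \<omega>|cube_measure. g (\<omega> + c))" "0 \<le> 1 + (LINT \<omega>|cube_measure. g \<omega>)"
    by simp_all
  ultimately show ?thesis
    by simp
qed

section \<open>Fourier series\<close>

text \<open>
  A nontrivial character changes sign under some translation, while its integral over the cube
  does not change.
\<close>

lemma integral_wave_cube:
  "(LINT \<omega>|cube_measure. wave (of_int_vec k) \<omega>) = (if k = 0 then 1 else 0)"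
proof (cases "k = 0")
  case True
  then show ?thesis
    by simp
next
  case False
  then obtain i where i: "k $ i \<noteq> 0"
    by (auto simp: vec_eq_iff)
  \<comment> \<open>half a period of the character in a direction in which it is not constant\<close>
  define c :: "real ^ 'a" where "c = axis i (1 / (2 * k $ i))"
  have half: "c \<bullet> of_int_vec k = 1/2"
    using i by (simp add: c_def inner_axis' of_int_vec_def)
  have "wave (of_int_vec k) c = -1"
    unfolding wave_cis half by (simp add: complex_eq_iff)
  then have neg: "wave (of_int_vec k) (\<omega> + c) = - wave (of_int_vec k) \<omega>" for \<omega>
    by (simp add: wave_add_right)
  have bd: "\<bar>Re (wave (of_int_vec k) \<omega>)\<bar> \<le> 1" "\<bar>Im (wave (of_int_vec k) \<omega>)\<bar> \<le> 1" for \<omega> :: "real ^ 'a"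
    using abs_Re_le_cmod[of "wave (of_int_vec k) \<omega>"] abs_Im_le_cmod[of "wave (of_int_vec k) \<omega>"] by simp_all
  have int: "integrable cube_measure (wave (of_int_vec k))"
    by (intro cube_measure.integrable_const_bound[where B = 1]) auto
  have "(LINT \<omega>|cube_measure. Re (wave (of_int_vec k) \<omega>)) = 0"
    using integral_cube_translate[of "\<lambda>\<omega>. Re (wave (of_int_vec k) \<omega>)" c] bd by (simp add: neg)
  moreover have "(LINT \<omega>|cube_measure. Im (wave (of_int_vec k) \<omega>)) = 0"
    using integral_cube_translate[of "\<lambda>\<omega>. Im (wave (of_int_vec k) \<omega>)" c] bd by (simp add: neg)
  ultimately show ?thesis
    using int False by (simp add: complex_eq_iff)
qed

lemma rep_L2_character': 
  "AE \<omega> in lborel. rep_L2 (character k) \<omega> = indicator unit_cube \<omega> *\<^sub>R wave (of_int_vec k) \<omega>"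
  using rep_L2_character[of k] by eventually_elim (simp add: wave_def)

lemma cinner_character_right:
  "cinner u (character k) = (LINT \<omega>|cube_measure. rep_L2 u \<omega> * wave (- of_int_vec k) \<omega>)"
proof -
  have "cinner u (character k) = (LINT \<omega>|lborel. indicator unit_cube \<omega> *\<^sub>R (rep_L2 u \<omega> * wave (- of_int_vec k) \<omega>))"
    unfolding cinner.rep_eq
    by (rule integral_cong_AE, measurable)
       (use rep_L2_character'[of k] in eventually_elim, simp add: wave_minus mult.commute)
  then show ?thesis
    by (subst integral_cube_measure) auto
qed

lemma cinner_character: "cinner (character k) (character l) = (if k = l then 1 else 0)"
proof -
  have "cinner (character k) (character l)
      = (LINT \<omega>|lborel. indicator unit_cube \<omega> *\<^sub>R wave (of_int_vec (k - l)) \<omega>)"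
    unfolding cinner.rep_eq
    by (rule integral_cong_AE, measurable)
       (use rep_L2_character'[of k] rep_L2_character'[of l] in eventually_elim,
        simp add: of_int_vec_diff wave_add_left[of _ "- of_int_vec l", simplified] wave_minus indicator_def)
  also have "\<dots> = (if k - l = 0 then 1 else 0)"
    unfolding integral_wave_cube[symmetric] by (subst integral_cube_measure) auto
  finally show ?thesis
    by simp
qed

subsection \<open>Orthonormal expansions\<close>

text \<open>
  The partial sum over \<open>F\<close> is the best approximation of \<open>u\<close> by combinations of the \<open>e k\<close> with
  \<open>k \<in> F\<close>, so that it is at least as good as any approximation that uses fewer of the \<open>e k\<close>.
  This gives convergence along the net of finite sets.
\<close>

lemma orthonormal_expansion:
  fixes e :: "'k \<Rightarrow> 'n::finite L2"
  assumes orth: "\<And>k l. cinner (e k) (e l) = (if k = l then 1 else 0)"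
    and u: "u \<in> closure (cspan (range e))"
  shows "((\<lambda>k. cinner u (e k) *\<^sub>C e k) has_sum u) UNIV"
    and "((\<lambda>k. (cmod (cinner u (e k)))\<^sup>2) has_sum (norm u)\<^sup>2) UNIV"
proof -
  define S where "S = (\<lambda>F. \<Sum>k\<in>F. cinner u (e k) *\<^sub>C e k)"
  have coeff: "cinner (u - S F) (e k) = 0" if "finite F" "k \<in> F" for F k
    using that by (simp add: S_def cinner_diff_left cinner_sum_left cinner_scaleC_left orth
        if_distrib[of "\<lambda>x. _ * x"] cong: if_cong)
  have Pyth: "(norm u)\<^sup>2 = (norm (u - S F))\<^sup>2 + (\<Sum>k\<in>F. (cmod (cinner u (e k)))\<^sup>2)" if "finite F" for F
  proof -
    have "cinner (u - S F) (S F) = 0"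
      using coeff[OF that] by (subst (2) S_def) (simp add: cinner_sum_right cinner_scaleC_right)
    then have "(norm u)\<^sup>2 = (norm (u - S F))\<^sup>2 + (norm (S F))\<^sup>2"
      using norm_add_sq_L2[of "u - S F" "S F"] by simp
    moreover have "complex_of_real ((norm (S F))\<^sup>2) = complex_of_real (\<Sum>k\<in>F. (cmod (cinner u (e k)))\<^sup>2)"
      unfolding cinner_norm[symmetric] using that
      by (simp add: S_def cinner_sum_left cinner_sum_right cinner_scaleC_left cinner_scaleC_right orth
          complex_norm_square mult_ac if_distrib[of "\<lambda>x. _ * x"] del: of_real_power cong: if_cong)
    then have "(norm (S F))\<^sup>2 = (\<Sum>k\<in>F. (cmod (cinner u (e k)))\<^sup>2)"
      using of_real_eq_iff by blast
    ultimately show ?thesis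
      by simp
  qed
  have lim: "(S \<longlongrightarrow> u) (finite_subsets_at_top UNIV)"
  proof (rule tendstoI)
    fix \<epsilon> :: real assume "\<epsilon> > 0"
    obtain v where v: "v \<in> cspan (range e)" "dist v u < \<epsilon>"
      using u \<open>\<epsilon> > 0\<close> unfolding closure_approachable by blast
    then obtain t r where t: "finite t" "t \<subseteq> range e" "v = (\<Sum>a\<in>t. r a *\<^sub>C a)"
      unfolding L2_complex.span_explicit by blast
    then obtain F0 where F0: "finite F0" "t = e ` F0"
      using finite_subset_image by metis
    have "dist (S F) u < \<epsilon>" if F: "finite F" "F0 \<subseteq> F" for F
    proof -
      have o1: "cinner (u - S F) (S F) = 0"
        using coeff[OF F(1)] by (subst (2) S_def) (simp add: cinner_sum_right cinner_scaleC_right)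
      have o2: "cinner (u - S F) v = 0"
        using coeff[OF F(1)] F F0 by (auto simp: t(3) cinner_sum_right cinner_scaleC_right intro!: sum.neutral)
      have "(norm (u - v))\<^sup>2 = (norm (u - S F))\<^sup>2 + (norm (S F - v))\<^sup>2"
        using norm_add_sq_L2[of "u - S F" "S F - v"] o1 o2 by (simp add: cinner_diff_right)
      then have "(norm (u - S F))\<^sup>2 \<le> (norm (u - v))\<^sup>2"
        by simp
      then have "norm (u - S F) \<le> norm (u - v)"
        by (rule power2_le_imp_le) simp
      then show ?thesis
        using v(2) by (simp add: dist_norm norm_minus_commute)
    qed
    then show "\<forall>\<^sub>F F in finite_subsets_at_top UNIV. dist (S F) u < \<epsilon>"
      unfolding eventually_finite_subsets_at_top using F0(1) by auto
  qed
  then show "((\<lambda>k. cinner u (e k) *\<^sub>C e k) has_sum u) UNIV"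
    unfolding has_sum_def S_def .
  have "((\<lambda>F. (norm u)\<^sup>2 - (norm (u - S F))\<^sup>2) \<longlongrightarrow> (norm u)\<^sup>2 - (norm (u - u))\<^sup>2) (finite_subsets_at_top UNIV)"
    by (intro tendsto_intros lim)
  moreover have "\<forall>\<^sub>F F in finite_subsets_at_top UNIV.
      (norm u)\<^sup>2 - (norm (u - S F))\<^sup>2 = (\<Sum>k\<in>F. (cmod (cinner u (e k)))\<^sup>2)"
    unfolding eventually_finite_subsets_at_top using Pyth by (intro exI[of _ "{}"]) simp
  ultimately show "((\<lambda>k. (cmod (cinner u (e k)))\<^sup>2) has_sum (norm u)\<^sup>2) UNIV"
    unfolding has_sum_def by (simp add: tendsto_cong)
qed

lemma nn_integral_count_space_has_sum:
  fixes f :: "'k \<Rightarrow> real"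
  assumes "(f has_sum s) UNIV" and nonneg: "\<And>k. 0 \<le> f k"
  shows "(\<integral>\<^sup>+k. ennreal (f k) \<partial>count_space UNIV) = ennreal s"
proof -
  have "(\<lambda>k. norm (f k)) summable_on UNIV"
    using assms by (auto simp: has_sum_imp_summable)
  then have abs: "Infinite_Set_Sum.abs_summable_on f UNIV"
    unfolding abs_summable_equivalent .
  then have "integrable (count_space UNIV) f"
    by (simp add: Infinite_Set_Sum.abs_summable_on_def)
  then have "(\<integral>\<^sup>+k. ennreal (f k) \<partial>count_space UNIV) = ennreal (integral\<^sup>L (count_space UNIV) f)"
    using nonneg by (intro nn_integral_eq_integral) auto
  also have "integral\<^sup>L (count_space UNIV) f = infsetsum f UNIV"
    by (simp add: infsetsum_def)
  also have "\<dots> = s"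
    using abs assms by (simp add: infsetsum_infsum infsumI)
  finally show ?thesis .
qed

section \<open>Multiplication operators\<close>

definition bounded_borel :: "(real ^ 'n \<Rightarrow> complex) \<Rightarrow> bool" where
  "bounded_borel m \<longleftrightarrow> m \<in> borel_measurable borel \<and> (\<exists>B. \<forall>\<omega>. cmod (m \<omega>) \<le> B)"

lemma periodic_multiplier_bounded_borel: "periodic_multiplier m \<Longrightarrow> bounded_borel m"
  by (auto simp: periodic_multiplier_def bounded_borel_def)

lemma sq_integrable_bounded_mult:
  assumes m: "bounded_borel m" and f: "sq_integrable f"
  shows "sq_integrable (\<lambda>\<omega>. m \<omega> * f \<omega>)"
proof -
  have [measurable]: "m \<in> borel_measurable borel" "f \<in> borel_measurable borel"
    using m f by (auto simp: bounded_borel_def sq_integrable_def)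
  obtain B where B: "\<And>\<omega>. cmod (m \<omega>) \<le> B"
    using m by (auto simp: bounded_borel_def)
  have "integrable lborel (\<lambda>\<omega>. (cmod (m \<omega> * f \<omega>))\<^sup>2)"
  proof (rule Bochner_Integration.integrable_bound)
    show "integrable lborel (\<lambda>\<omega>. B\<^sup>2 * (cmod (f \<omega>))\<^sup>2)"
      using f by (simp add: sq_integrable_def)
    show "AE \<omega> in lborel. norm ((cmod (m \<omega> * f \<omega>))\<^sup>2) \<le> norm (B\<^sup>2 * (cmod (f \<omega>))\<^sup>2)"
      using B by (auto simp: norm_mult power_mult_distrib intro!: mult_right_mono power_mono)
  qed measurable
  then show ?thesis
    by (simp add: sq_integrable_def)
qed

definition mult_op :: "(real ^ 'n \<Rightarrow> complex) \<Rightarrow> 'n::finite L2 \<Rightarrow> 'n L2" where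
  "mult_op m f = abs_L2 (\<lambda>\<omega>. m \<omega> * rep_L2 f \<omega>)"

lemma rep_mult_op: "bounded_borel m \<Longrightarrow> AE \<omega> in lborel. rep_L2 (mult_op m f) \<omega> = m \<omega> * rep_L2 f \<omega>"
  unfolding mult_op_def by (intro rep_abs_L2 sq_integrable_bounded_mult sq_integrable_rep_L2)

lemma L2_eqI: "AE \<omega> in lborel. rep_L2 f \<omega> = rep_L2 g \<omega> \<Longrightarrow> f = g"
  by (simp add: L2_eq_iff)

lemma bounded_borelD:
  assumes "bounded_borel m"
  shows "m \<in> borel_measurable borel" "\<exists>B. \<forall>\<omega>. cmod (m \<omega>) \<le> B"
  using assms by (auto simp: bounded_borel_def)

lemma mult_op_add:
  assumes m: "bounded_borel m"
  shows "mult_op m (f + g) = mult_op m f + mult_op m g"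
  by (rule L2_eqI)
     (use rep_L2_add[of f g] rep_mult_op[OF m, of f] rep_mult_op[OF m, of g]
        rep_mult_op[OF m, of "f + g"] rep_L2_add[of "mult_op m f" "mult_op m g"]
      in eventually_elim, simp add: distrib_left)

lemma mult_op_scaleC:
  assumes m: "bounded_borel m"
  shows "mult_op m (c *\<^sub>C f) = c *\<^sub>C mult_op m f"
  by (rule L2_eqI)
     (use rep_L2_scaleC[of c f] rep_mult_op[OF m, of f] rep_mult_op[OF m, of "c *\<^sub>C f"]
        rep_L2_scaleC[of c "mult_op m f"] in eventually_elim, simp)

lemma mult_op_diff:
  assumes m: "bounded_borel m"
  shows "mult_op m (f - g) = mult_op m f - mult_op m g"
  unfolding minus_L2_def by (simp only: mult_op_add[OF m] mult_op_scaleC[OF m])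

lemma mult_op_mult:
  assumes m: "bounded_borel m" and l: "bounded_borel l" and lm: "bounded_borel (\<lambda>\<omega>. m \<omega> * l \<omega>)"
  shows "mult_op m (mult_op l f) = mult_op (\<lambda>\<omega>. m \<omega> * l \<omega>) f"
  by (rule L2_eqI)
     (use rep_mult_op[OF m, of "mult_op l f"] rep_mult_op[OF l, of f] rep_mult_op[OF lm, of f]
      in eventually_elim, simp)

lemma mult_op_plus:
  assumes m: "bounded_borel m" and l: "bounded_borel l" and lm: "bounded_borel (\<lambda>\<omega>. m \<omega> + l \<omega>)"
  shows "mult_op (\<lambda>\<omega>. m \<omega> + l \<omega>) f = mult_op m f + mult_op l f"
  by (rule L2_eqI)
     (use rep_mult_op[OF m, of f] rep_mult_op[OF l, of f] rep_mult_op[OF lm, of f]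
        rep_L2_add[of "mult_op m f" "mult_op l f"]
      in eventually_elim, simp add: distrib_right)

lemma bounded_borel_const: "bounded_borel (\<lambda>_. c)"
  by (auto simp: bounded_borel_def)

lemma mult_op_const: "mult_op (\<lambda>_. c) f = c *\<^sub>C f"
  by (rule L2_eqI)
     (use rep_mult_op[OF bounded_borel_const, of c f] rep_L2_scaleC[of c f] in eventually_elim, simp)

lemma norm_mult_op_diff:
  assumes m: "bounded_borel m" and l: "bounded_borel l"
  shows "ennreal ((norm (mult_op m f - mult_op l f))\<^sup>2)
    = (\<integral>\<^sup>+\<omega>. ennreal ((cmod (m \<omega> - l \<omega>))\<^sup>2) * ennreal ((cmod (rep_L2 f \<omega>))\<^sup>2) \<partial>lborel)"
  unfolding ennreal_norm_diff_L2_sq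
  by (rule nn_integral_cong_AE)
     (use rep_mult_op[OF m, of f] rep_mult_op[OF l, of f] in eventually_elim,
      simp add: norm_mult power_mult_distrib ennreal_mult flip: left_diff_distrib)

lemma norm_mult_op_le:
  assumes m: "bounded_borel m" and B: "\<And>\<omega>. cmod (m \<omega>) \<le> B"
  shows "norm (mult_op m f) \<le> B * norm f"
proof -
  have "0 \<le> B"
    using B norm_ge_zero order_trans by blast
  have "ennreal ((norm (mult_op m f))\<^sup>2) = (\<integral>\<^sup>+\<omega>. ennreal ((cmod (m \<omega> * rep_L2 f \<omega>))\<^sup>2) \<partial>lborel)"
    unfolding ennreal_norm_L2_sq
    by (rule nn_integral_cong_AE) (use rep_mult_op[OF m, of f] in eventually_elim, simp)
  also have "\<dots> \<le> (\<integral>\<^sup>+\<omega>. ennreal (B\<^sup>2) * ennreal ((cmod (rep_L2 f \<omega>))\<^sup>2) \<partial>lborel)"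
    using B by (intro nn_integral_mono)
      (simp add: norm_mult power_mult_distrib mult_right_mono power_mono flip: ennreal_mult)
  also have "\<dots> = ennreal (B\<^sup>2) * ennreal ((norm f)\<^sup>2)"
    unfolding ennreal_norm_L2_sq by (rule nn_integral_cmult) measurable
  also have "\<dots> = ennreal ((B * norm f)\<^sup>2)"
    by (simp add: power_mult_distrib ennreal_mult)
  finally have "(norm (mult_op m f))\<^sup>2 \<le> (B * norm f)\<^sup>2"
    by simp
  then show ?thesis
    by (rule power2_le_imp_le) (simp add: \<open>0 \<le> B\<close>)
qed

lemma tendsto_mult_op:
  assumes m: "\<And>n. bounded_borel (m n)" and B: "\<And>n \<omega>. cmod (m n \<omega>) \<le> 1"
    and lim: "\<And>\<omega>. (\<lambda>n. m n \<omega>) \<longlonglongrightarrow> 1"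
  shows "(\<lambda>n. mult_op (m n) f) \<longlonglongrightarrow> f"
proof -
  have [measurable]: "m n \<in> borel_measurable borel" for n
    using m bounded_borelD(1) by blast
  have one: "bounded_borel (\<lambda>_. 1)" "mult_op (\<lambda>_. 1) f = f"
    by (auto simp: bounded_borel_def mult_op_const scaleC_one)
  have "(\<lambda>n. \<integral>\<^sup>+\<omega>. ennreal ((cmod (m n \<omega> - 1))\<^sup>2) * ennreal ((cmod (rep_L2 f \<omega>))\<^sup>2) \<partial>lborel)
      \<longlonglongrightarrow> (\<integral>\<^sup>+\<omega>. 0 \<partial>(lborel :: (real ^ 'a) measure))"
  proof (rule nn_integral_dominated_convergence[where w = "\<lambda>\<omega>. ennreal (2\<^sup>2) * ennreal ((cmod (rep_L2 f \<omega>))\<^sup>2)"])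
    show "AE \<omega> in lborel. ennreal ((cmod (m n \<omega> - 1))\<^sup>2) * ennreal ((cmod (rep_L2 f \<omega>))\<^sup>2)
        \<le> ennreal (2\<^sup>2) * ennreal ((cmod (rep_L2 f \<omega>))\<^sup>2)" for n
    proof (intro AE_I2 mult_right_mono ennreal_leI power_mono)
      show "cmod (m n \<omega> - 1) \<le> 2" for \<omega>
        using norm_triangle_ineq4[of "m n \<omega>" 1] B[of n \<omega>] by simp
    qed auto
    have "(\<integral>\<^sup>+\<omega>. ennreal (2\<^sup>2) * ennreal ((cmod (rep_L2 f \<omega>))\<^sup>2) \<partial>lborel) = ennreal (2\<^sup>2) * ennreal ((norm f)\<^sup>2)"
      unfolding ennreal_norm_L2_sq by (rule nn_integral_cmult) measurable
    then show "(\<integral>\<^sup>+\<omega>. ennreal (2\<^sup>2) * ennreal ((cmod (rep_L2 f \<omega>))\<^sup>2) \<partial>lborel) < \<infinity>"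
      by (simp add: ennreal_mult_less_top)
    show "AE \<omega> in lborel. (\<lambda>n. ennreal ((cmod (m n \<omega> - 1))\<^sup>2) * ennreal ((cmod (rep_L2 f \<omega>))\<^sup>2)) \<longlonglongrightarrow> 0"
    proof (rule AE_I2)
      fix \<omega>
      have "(\<lambda>n. ennreal ((cmod (m n \<omega> - 1))\<^sup>2 * (cmod (rep_L2 f \<omega>))\<^sup>2))
          \<longlonglongrightarrow> ennreal ((cmod (1 - 1 :: complex))\<^sup>2 * (cmod (rep_L2 f \<omega>))\<^sup>2)"
        by (intro tendsto_intros lim)
      then show "(\<lambda>n. ennreal ((cmod (m n \<omega> - 1))\<^sup>2) * ennreal ((cmod (rep_L2 f \<omega>))\<^sup>2)) \<longlonglongrightarrow> 0"
        by (simp add: ennreal_mult)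
    qed
  qed measurable
  then have "(\<lambda>n. ennreal ((norm (mult_op (m n) f - f))\<^sup>2)) \<longlonglongrightarrow> ennreal 0"
    unfolding norm_mult_op_diff[OF m one(1), of _ f, unfolded one(2)] by simp
  then have "(\<lambda>n. (norm (mult_op (m n) f - f))\<^sup>2) \<longlonglongrightarrow> 0"
    by (subst (asm) tendsto_ennreal_iff) auto
  then have "(\<lambda>n. sqrt ((norm (mult_op (m n) f - f))\<^sup>2)) \<longlonglongrightarrow> sqrt 0"
    by (intro tendsto_intros)
  then have "(\<lambda>n. norm (mult_op (m n) f - f)) \<longlonglongrightarrow> 0"
    by simp
  from LIM_zero_cancel[OF tendsto_norm_zero_cancel[OF this]] show ?thesis .
qed

lemma cinner_mult_op:
  assumes m: "bounded_borel m" and c: "bounded_borel (\<lambda>\<omega>. cnj (m \<omega>))"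
  shows "cinner (mult_op m f) g = cinner f (mult_op (\<lambda>\<omega>. cnj (m \<omega>)) g)"
  unfolding cinner.rep_eq
proof (rule integral_cong_AE)
  have [measurable]: "m \<in> borel_measurable borel"
    using m by (rule bounded_borelD)
  show "AE x in lborel. rep_L2 (mult_op m f) x * cnj (rep_L2 g x)
      = rep_L2 f x * cnj (rep_L2 (mult_op (\<lambda>\<omega>. cnj (m \<omega>)) g) x)"
    using rep_mult_op[OF m, of f] rep_mult_op[OF c, of g] by eventually_elim simp
qed measurable

section \<open>Completeness of the characters\<close>

lemma trig_poly_in_span_characters:
  assumes "trig_poly p"
  shows "\<exists>v\<in>cspan (range character). AE \<omega> in lborel. rep_L2 v \<omega> = indicator unit_cube \<omega> *\<^sub>R p \<omega>"
  using assms
proof (induction rule: trig_poly.induct)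
  case (wave k)
  show ?case
    using rep_L2_character'[of k] by (intro bexI[of _ "character k"] L2_complex.span_base) auto
next
  case (add p q)
  then obtain u v where uv: "u \<in> cspan (range character)" "v \<in> cspan (range character)"
    "AE \<omega> in lborel. rep_L2 u \<omega> = indicator unit_cube \<omega> *\<^sub>R p \<omega>"
    "AE \<omega> in lborel. rep_L2 v \<omega> = indicator unit_cube \<omega> *\<^sub>R q \<omega>"
    by blast
  have "AE \<omega> in lborel. rep_L2 (u + v) \<omega> = indicator unit_cube \<omega> *\<^sub>R (p \<omega> + q \<omega>)"
    using uv(3,4) rep_L2_add[of u v] by eventually_elim (simp add: scaleR_right_distrib)
  then show ?case
    using uv by (intro bexI[of _ "u + v"] L2_complex.span_add)
next
  case (scale p c)
  then obtain u where u: "u \<in> cspan (range character)"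
    "AE \<omega> in lborel. rep_L2 u \<omega> = indicator unit_cube \<omega> *\<^sub>R p \<omega>"
    by blast
  have "AE \<omega> in lborel. rep_L2 (c *\<^sub>C u) \<omega> = indicator unit_cube \<omega> *\<^sub>R (c * p \<omega>)"
    using u(2) rep_L2_scaleC[of c u] by eventually_elim simp
  then show ?case
    using u by (intro bexI[of _ "c *\<^sub>C u"] L2_complex.span_scale)
qed

lemma multiplier_in_closure_characters:
  assumes m: "periodic_multiplier m"
    and u: "AE \<omega> in lborel. rep_L2 u \<omega> = indicator unit_cube \<omega> *\<^sub>R m \<omega>"
  shows "u \<in> closure (cspan (range character))"
  unfolding closure_approachable
proof (intro allI impI)
  fix \<epsilon> :: real assume "\<epsilon> > 0"
  then obtain p where p: "trig_poly p"
      "(\<integral>\<^sup>+\<omega>. ennreal ((cmod (m \<omega> - p \<omega>))\<^sup>2) \<partial>cube_measure) < ennreal (\<epsilon>\<^sup>2)"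
    using cube_measure.trig_poly_dense[OF m, of "\<epsilon>\<^sup>2"] by auto
  obtain v where v: "v \<in> cspan (range character)"
      "AE \<omega> in lborel. rep_L2 v \<omega> = indicator unit_cube \<omega> *\<^sub>R p \<omega>"
    using trig_poly_in_span_characters[OF p(1)] by blast
  have [measurable]: "m \<in> borel_measurable borel" "p \<in> borel_measurable borel"
    using periodic_multiplierD(1)[OF m] trig_poly_measurable[OF p(1)] by auto
  have "ennreal ((norm (v - u))\<^sup>2)
      = (\<integral>\<^sup>+\<omega>. indicator unit_cube \<omega> * ennreal ((cmod (m \<omega> - p \<omega>))\<^sup>2) \<partial>lborel)"
    unfolding ennreal_norm_diff_L2_sq
    by (rule nn_integral_cong_AE)
       (use u v(2) in eventually_elim, simp add: indicator_def norm_minus_commute)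
  also have "\<dots> = (\<integral>\<^sup>+\<omega>. ennreal ((cmod (m \<omega> - p \<omega>))\<^sup>2) \<partial>cube_measure)"
    by (rule nn_integral_cube_measure[symmetric]) measurable
  finally have "ennreal ((norm (v - u))\<^sup>2) < ennreal (\<epsilon>\<^sup>2)"
    using p(2) by (simp only:)
  then have "(norm (v - u))\<^sup>2 < \<epsilon>\<^sup>2"
    by (subst (asm) ennreal_less_iff) auto
  then have "norm (v - u) < \<epsilon>"
    by (rule power2_less_imp_less) (use \<open>\<epsilon> > 0\<close> in simp)
  then show "\<exists>v\<in>cspan (range character). dist v u < \<epsilon>"
    using v(1) by (auto simp: dist_norm)
qed

text \<open>
  Only bounded functions extend to periodic multipliers, so \<open>f\<close> is first truncated where its
  modulus exceeds \<open>n\<close>.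
\<close>

lemma cube_supported_in_closure_characters:
  fixes f :: "'n::finite L2"
  assumes f: "AE \<omega> in lborel. \<omega> \<notin> unit_cube \<longrightarrow> rep_L2 f \<omega> = 0"
  shows "f \<in> closure (cspan (range character))"
proof -
  define t where "t = (\<lambda>n \<omega>. if cmod (rep_L2 f \<omega>) \<le> real n then 1 else 0 :: complex)"
  have t: "bounded_borel (t n)" for n
    unfolding bounded_borel_def t_def by (auto intro!: exI[of _ 1])
  have lim: "(\<lambda>n. mult_op (t n) f) \<longlonglongrightarrow> f"
  proof (rule tendsto_mult_op[OF t])
    show "cmod (t n \<omega>) \<le> 1" for n \<omega>
      by (simp add: t_def)
    show "(\<lambda>n. t n \<omega>) \<longlonglongrightarrow> 1" for \<omega>
    proof (rule tendsto_eventually)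
      obtain N where N: "cmod (rep_L2 f \<omega>) \<le> real N"
        using real_arch_simple by blast
      show "\<forall>\<^sub>F n in sequentially. t n \<omega> = 1"
        using eventually_ge_at_top[of N] by eventually_elim (use N in \<open>simp add: t_def\<close>)
    qed
  qed
  have "mult_op (t n) f \<in> closure (cspan (range character))" for n
  proof (rule multiplier_in_closure_characters)
    let ?m = "\<lambda>\<omega>. t n (frac_vec \<omega>) * rep_L2 f (frac_vec \<omega>)"
    have [measurable]: "t n \<in> borel_measurable borel"
      using t by (rule bounded_borelD)
    show "periodic_multiplier ?m"
      unfolding periodic_multiplier_def
      by (auto simp: t_def intro!: exI[of _ "real n"])
    show "AE \<omega> in lborel. rep_L2 (mult_op (t n) f) \<omega> = indicator unit_cube \<omega> *\<^sub>R ?m \<omega>"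
      using rep_mult_op[OF t, of n f] f
      by eventually_elim (auto simp: indicator_def frac_vec_cube)
  qed
  then show ?thesis
    using closed_sequentially[OF closed_closure _ lim] by blast
qed

lemmas character_expansion = orthonormal_expansion[OF cinner_character cube_supported_in_closure_characters]

lemma Parseval_cube:
  assumes "AE \<omega> in lborel. \<omega> \<notin> unit_cube \<longrightarrow> rep_L2 u \<omega> = 0"
  shows "(\<integral>\<^sup>+k. ennreal ((cmod (cinner u (character k)))\<^sup>2) \<partial>count_space UNIV) = ennreal ((norm u)\<^sup>2)"
  by (rule nn_integral_count_space_has_sum[OF character_expansion(2)[OF assms]]) simp

section \<open>The Fourier transform\<close>

lemma borel_measurable_wave_pair [measurable (raw)]:
  "f \<in> borel_measurable M \<Longrightarrow> g \<in> borel_measurable M \<Longrightarrow> (\<lambda>x. wave (f x) (g x)) \<in> borel_measurable M"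
  unfolding wave_def by measurable

lemma fourier_integral_wave: "fourier_integral f \<omega> = (LINT x|lborel. f x * wave x \<omega>)"
  by (simp add: fourier_integral_def wave_def)

lemma borel_measurable_fourier_integral [measurable]:
  assumes [measurable]: "f \<in> borel_measurable borel"
  shows "fourier_integral f \<in> borel_measurable borel"
  unfolding fourier_integral_wave[abs_def] by measurable

lemma integrable_times_wave:
  assumes f: "integrable lborel f"
  shows "integrable lborel (\<lambda>x. f x * wave x \<omega>)"
proof (rule Bochner_Integration.integrable_bound[OF f])
  have [measurable]: "f \<in> borel_measurable borel"
    using borel_measurable_integrable[OF f] by simp
  show "(\<lambda>x. f x * wave x \<omega>) \<in> borel_measurable lborel"
    by measurable
qed (simp add: norm_mult)

lemma fourier_integral_cong_AE:
  assumes [measurable]: "f \<in> borel_measurable borel" "g \<in> borel_measurable borel"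
    and eq: "AE x in lborel. f x = g x"
  shows "fourier_integral f = fourier_integral g"
proof
  fix \<omega> show "fourier_integral f \<omega> = fourier_integral g \<omega>"
    unfolding fourier_integral_wave
    by (rule integral_cong_AE, measurable) (use eq in eventually_elim, simp)
qed

lemma integrable_translate:
  fixes f :: "real ^ 'n \<Rightarrow> complex"
  assumes f: "integrable lborel f"
  shows "integrable lborel (\<lambda>x. f (x + c))"
proof -
  have [measurable]: "f \<in> borel_measurable borel"
    using borel_measurable_integrable[OF f] by simp
  have "integrable (distr lborel borel ((+) c)) f"
    using f by (simp add: lborel_distr_plus)
  then show ?thesis
    by (subst (asm) integrable_distr_eq) (auto simp: add.commute)
qed

lemma integrable_indicator_cube_mult:
  assumes f: "integrable lborel f"
  shows "integrable lborel (\<lambda>x. indicator unit_cube (x - c) *\<^sub>R (f x :: complex))"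
proof (rule Bochner_Integration.integrable_bound[OF f])
  have [measurable]: "f \<in> borel_measurable borel"
    using borel_measurable_integrable[OF f] by simp
  show "(\<lambda>x. indicator unit_cube (x - c) *\<^sub>R f x) \<in> borel_measurable lborel"
    by measurable
qed (simp add: indicator_def)

subsection \<open>Plancherel's theorem for functions supported on finitely many cubes\<close>

text \<open>
  The Zak transform.  The values of the Fourier transform of \<open>f\<close> on the coset of \<open>\<theta>\<close> are the
  Fourier coefficients on the cube of the product of \<open>zak J f \<theta>\<close> and \<open>wave \<theta>\<close>.
\<close>

definition zak :: "(int ^ 'n) set \<Rightarrow> (real ^ 'n \<Rightarrow> complex) \<Rightarrow> real ^ 'n \<Rightarrow> real ^ 'n \<Rightarrow> complex" where
  "zak J f \<theta> x = (\<Sum>j\<in>J. f (x + of_int_vec j) * wave (of_int_vec j) \<theta>)"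

lemma borel_measurable_zak [measurable (raw)]:
  assumes [measurable]: "f \<in> borel_measurable borel" "g \<in> borel_measurable M" "h \<in> borel_measurable M"
  shows "(\<lambda>x. zak J f (g x) (h x)) \<in> borel_measurable M"
  unfolding zak_def by measurable

lemma sum_indicator_cube:
  assumes "finite J"
  shows "(\<Sum>j\<in>J. indicator unit_cube (x - of_int_vec j)) = (if floor_vec x \<in> J then 1 else 0 :: real)"
proof -
  have "(\<Sum>j\<in>J. indicator unit_cube (x - of_int_vec j)) = (\<Sum>j\<in>J. if j = floor_vec x then 1 else 0 :: real)"
    by (intro sum.cong) (auto simp: indicator_def diff_of_int_vec_in_cube)
  then show ?thesis
    using assms by simp
qed

text \<open>
  Cut \<open>f\<close> into its pieces on the cubes and move all of them to the unit cube.  At the frequency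
  \<open>\<theta> + of_int_vec k\<close> the phases caused by the moves do not depend on \<open>k\<close>.
\<close>

lemma fourier_integral_zak:
  fixes f :: "real ^ 'n \<Rightarrow> complex"
  assumes f: "integrable lborel f" and J: "finite J" and supp: "\<And>x. floor_vec x \<notin> J \<Longrightarrow> f x = 0"
  shows "fourier_integral f (\<theta> + of_int_vec k)
    = (LINT x|lborel. indicator unit_cube x *\<^sub>R (zak J f \<theta> x * wave \<theta> x * wave (of_int_vec k) x))"
proof -
  let ?\<omega> = "\<theta> + of_int_vec k"
  let ?g = "\<lambda>x. f x * wave x ?\<omega>"
  have g: "integrable lborel ?g"
    using f by (rule integrable_times_wave)
  then have [measurable]: "?g \<in> borel_measurable borel"
    using borel_measurable_integrable by fastforce
  have "?g x = (\<Sum>j\<in>J. indicator unit_cube (x - of_int_vec j) *\<^sub>R ?g x)" for x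
    unfolding scaleR_left.sum[symmetric] using sum_indicator_cube[OF J, of x] supp[of x] by simp
  then have "fourier_integral f ?\<omega> = (LINT x|lborel. (\<Sum>j\<in>J. indicator unit_cube (x - of_int_vec j) *\<^sub>R ?g x))"
    unfolding fourier_integral_wave by presburger
  also have "\<dots> = (\<Sum>j\<in>J. LINT x|lborel. indicator unit_cube (x - of_int_vec j) *\<^sub>R ?g x)"
    by (intro Bochner_Integration.integral_sum integrable_indicator_cube_mult g)
  also have "\<dots> = (\<Sum>j\<in>J. LINT x|lborel. indicator unit_cube x *\<^sub>R ?g (x + of_int_vec j))"
  proof (rule sum.cong[OF refl])
    fix j
    show "(LINT x|lborel. indicator unit_cube (x - of_int_vec j) *\<^sub>R ?g x)
        = (LINT x|lborel. indicator unit_cube x *\<^sub>R ?g (x + of_int_vec j))"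
      using integral_translate[of "\<lambda>x. indicator unit_cube (x - of_int_vec j) *\<^sub>R ?g x" "of_int_vec j"]
      by simp
  qed
  also have "\<dots> = (LINT x|lborel. (\<Sum>j\<in>J. indicator unit_cube x *\<^sub>R ?g (x + of_int_vec j)))"
    by (rule Bochner_Integration.integral_sum[symmetric])
       (use integrable_indicator_cube_mult[OF integrable_translate[OF g], of 0] in simp)
  also have "\<dots> = (LINT x|lborel. indicator unit_cube x *\<^sub>R (zak J f \<theta> x * wave \<theta> x * wave (of_int_vec k) x))"
  proof (rule arg_cong[where f = "integral\<^sup>L lborel"], rule ext)
    fix x
    have gx: "?g (x + of_int_vec j)
        = f (x + of_int_vec j) * wave (of_int_vec j) \<theta> * (wave \<theta> x * wave (of_int_vec k) x)" for j
      by (simp add: wave_add_left wave_add_right wave_commute[of x] mult_ac)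
    show "(\<Sum>j\<in>J. indicator unit_cube x *\<^sub>R ?g (x + of_int_vec j))
        = indicator unit_cube x *\<^sub>R (zak J f \<theta> x * wave \<theta> x * wave (of_int_vec k) x)"
      unfolding gx by (simp add: zak_def sum_distrib_right scaleR_sum_right mult.assoc)
  qed
  finally show ?thesis .
qed

lemma sq_integrable_sum:
  assumes "\<And>i. i \<in> I \<Longrightarrow> sq_integrable (f i)"
  shows "sq_integrable (\<lambda>x. \<Sum>i\<in>I. f i x)"
  using assms
  by (induction I rule: infinite_finite_induct) (auto simp: sq_integrable_zero sq_integrable_add)

lemma sq_integrable_zak:
  assumes f: "sq_integrable f"
  shows "sq_integrable (\<lambda>x. zak J f \<theta> x)"
  unfolding zak_def
proof (rule sq_integrable_sum)
  fix j
  have "sq_integrable (\<lambda>x. f (x - - of_int_vec j))"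
    by (rule sq_integrable_translate[OF f])
  from sq_integrable_cmult[OF this, of "wave (of_int_vec j) \<theta>"]
  show "sq_integrable (\<lambda>x. f (x + of_int_vec j) * wave (of_int_vec j) \<theta>)"
    by (simp add: mult.commute)
qed

lemma nn_integral_fourier_coset:
  fixes f :: "real ^ 'n::finite \<Rightarrow> complex"
  assumes f: "integrable lborel f" "sq_integrable f"
    and J: "finite J" and supp: "\<And>x. floor_vec x \<notin> J \<Longrightarrow> f x = 0"
  shows "(\<integral>\<^sup>+k. ennreal ((cmod (fourier_integral f (\<theta> + of_int_vec k)))\<^sup>2) \<partial>count_space UNIV)
    = (\<integral>\<^sup>+x. indicator unit_cube x * ennreal ((cmod (zak J f \<theta> x))\<^sup>2) \<partial>lborel)"
proof -
  have [measurable]: "f \<in> borel_measurable borel"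
    using f(2) by (simp add: sq_integrable_def)
  have bb: "bounded_borel (\<lambda>x. indicator unit_cube x *\<^sub>R wave \<theta> x)"
    by (auto simp: bounded_borel_def indicator_def intro!: exI[of _ 1])
  have sq: "sq_integrable (\<lambda>x. indicator unit_cube x *\<^sub>R wave \<theta> x * zak J f \<theta> x)"
    by (rule sq_integrable_bounded_mult[OF bb sq_integrable_zak[OF f(2)]])
  define u where "u = abs_L2 (\<lambda>x. indicator unit_cube x *\<^sub>R wave \<theta> x * zak J f \<theta> x)"
  have u: "AE x in lborel. rep_L2 u x = indicator unit_cube x *\<^sub>R wave \<theta> x * zak J f \<theta> x"
    unfolding u_def by (rule rep_abs_L2[OF sq])
  have coeff: "fourier_integral f (\<theta> + of_int_vec k) = cinner u (character (- k))" for k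
  proof -
    have "cinner u (character (- k)) = (LINT x|lborel. indicator unit_cube x *\<^sub>R (rep_L2 u x * wave (of_int_vec k) x))"
      unfolding cinner_character_right by (subst integral_cube_measure) (auto simp: of_int_vec_minus)
    also have "\<dots> = fourier_integral f (\<theta> + of_int_vec k)"
      by (subst fourier_integral_zak[OF f(1) J supp], assumption, rule integral_cong_AE, measurable)
         (use u in eventually_elim, simp add: indicator_def mult.commute)
    finally show ?thesis ..
  qed
  have "(\<integral>\<^sup>+k. ennreal ((cmod (fourier_integral f (\<theta> + of_int_vec k)))\<^sup>2) \<partial>count_space UNIV)
      = (\<integral>\<^sup>+k. ennreal ((cmod (cinner u (character k)))\<^sup>2) \<partial>count_space UNIV)"
    unfolding coeff
    by (rule nn_integral_bij_count_space[of uminus UNIV UNIV "\<lambda>k. ennreal ((cmod (cinner u (character k)))\<^sup>2)"])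
       (simp add: bij_uminus)
  also have "\<dots> = ennreal ((norm u)\<^sup>2)"
  proof (rule Parseval_cube)
    show "AE x in lborel. x \<notin> unit_cube \<longrightarrow> rep_L2 u x = 0"
      using u by eventually_elim simp
  qed
  also have "\<dots> = (\<integral>\<^sup>+x. indicator unit_cube x * ennreal ((cmod (zak J f \<theta> x))\<^sup>2) \<partial>lborel)"
    unfolding ennreal_norm_L2_sq
    by (rule nn_integral_cong_AE) (use u in eventually_elim, simp add: indicator_def norm_mult)
  finally show ?thesis .
qed

lemma nn_integral_sum_waves:
  fixes c :: "int ^ 'n::finite \<Rightarrow> complex"
  assumes J: "finite J"
  shows "(\<integral>\<^sup>+\<theta>. indicator unit_cube \<theta> * ennreal ((cmod (\<Sum>j\<in>J. c j * wave (of_int_vec j) \<theta>))\<^sup>2) \<partial>lborel)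
    = ennreal (\<Sum>j\<in>J. (cmod (c j))\<^sup>2)"
proof -
  define v where "v = (\<Sum>j\<in>J. c j *\<^sub>C character j)"
  have "AE \<theta> in lborel. \<forall>j. rep_L2 (character j) \<theta> = indicator unit_cube \<theta> *\<^sub>R wave (of_int_vec j) \<theta>"
    by (subst AE_all_countable) (use rep_L2_character' in blast)
  moreover have "AE \<theta> in lborel. \<forall>j. rep_L2 (c j *\<^sub>C character j) \<theta> = c j * rep_L2 (character j) \<theta>"
    by (subst AE_all_countable) (use rep_L2_scaleC in blast)
  ultimately have v: "AE \<theta> in lborel. rep_L2 v \<theta> = indicator unit_cube \<theta> *\<^sub>R (\<Sum>j\<in>J. c j * wave (of_int_vec j) \<theta>)"
    using rep_L2_sum[of "\<lambda>j. c j *\<^sub>C character j" J] unfolding v_def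
    by eventually_elim (simp add: scaleR_sum_right)
  have "(\<integral>\<^sup>+\<theta>. indicator unit_cube \<theta> * ennreal ((cmod (\<Sum>j\<in>J. c j * wave (of_int_vec j) \<theta>))\<^sup>2) \<partial>lborel)
      = ennreal ((norm v)\<^sup>2)"
    unfolding ennreal_norm_L2_sq
    by (rule nn_integral_cong_AE) (use v in eventually_elim, simp add: indicator_def)
  also have "complex_of_real ((norm v)\<^sup>2) = complex_of_real (\<Sum>j\<in>J. (cmod (c j))\<^sup>2)"
    unfolding cinner_norm[symmetric] using J
    by (simp add: v_def cinner_sum_left cinner_sum_right cinner_scaleC_left cinner_scaleC_right
        cinner_character complex_norm_square mult_ac if_distrib[of "\<lambda>x. _ * x"] del: of_real_power cong: if_cong)
  then have "(norm v)\<^sup>2 = (\<Sum>j\<in>J. (cmod (c j))\<^sup>2)"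
    using of_real_eq_iff by blast
  finally show ?thesis .
qed

text \<open>
  On each coset of frequencies apply Parseval in the variable \<open>x\<close>; then integrate over the
  representatives \<open>\<theta>\<close> of the cosets and use the orthonormality of the characters in \<open>\<theta>\<close>.
\<close>

lemma Plancherel_finite_cubes:
  fixes f :: "real ^ 'n::finite \<Rightarrow> complex"
  assumes f: "integrable lborel f" "sq_integrable f"
    and J: "finite J" and supp: "\<And>x. floor_vec x \<notin> J \<Longrightarrow> f x = 0"
  shows "(\<integral>\<^sup>+\<omega>. ennreal ((cmod (fourier_integral f \<omega>))\<^sup>2) \<partial>lborel) = (\<integral>\<^sup>+x. ennreal ((cmod (f x))\<^sup>2) \<partial>lborel)"
proof -
  have [measurable]: "f \<in> borel_measurable borel"
    using f(2) by (simp add: sq_integrable_def)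
  have "(\<integral>\<^sup>+\<omega>. ennreal ((cmod (fourier_integral f \<omega>))\<^sup>2) \<partial>lborel)
      = (\<integral>\<^sup>+\<theta>. indicator unit_cube \<theta> * (\<integral>\<^sup>+x. indicator unit_cube x * ennreal ((cmod (zak J f \<theta> x))\<^sup>2) \<partial>lborel) \<partial>lborel)"
    by (subst nn_integral_tiling) (auto simp: nn_integral_fourier_coset[OF f J supp])
  also have "\<dots> = (\<integral>\<^sup>+\<theta>. (\<integral>\<^sup>+x. indicator unit_cube \<theta> * (indicator unit_cube x * ennreal ((cmod (zak J f \<theta> x))\<^sup>2)) \<partial>lborel) \<partial>lborel)"
    by (simp add: nn_integral_cmult)
  also have "\<dots> = (\<integral>\<^sup>+x. (\<integral>\<^sup>+\<theta>. indicator unit_cube \<theta> * (indicator unit_cube x * ennreal ((cmod (zak J f \<theta> x))\<^sup>2)) \<partial>lborel) \<partial>lborel)"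
    by (rule lborel_pair.Fubini') measurable
  also have "\<dots> = (\<integral>\<^sup>+x. indicator unit_cube x * (\<integral>\<^sup>+\<theta>. indicator unit_cube \<theta> * ennreal ((cmod (zak J f \<theta> x))\<^sup>2) \<partial>lborel) \<partial>lborel)"
    by (subst nn_integral_cmult[symmetric]) (auto simp: mult_ac)
  also have "\<dots> = (\<integral>\<^sup>+x. indicator unit_cube x * (\<Sum>j\<in>J. ennreal ((cmod (f (x + of_int_vec j)))\<^sup>2)) \<partial>lborel)"
    unfolding zak_def nn_integral_sum_waves[OF J] by simp
  also have "\<dots> = (\<integral>\<^sup>+x. indicator unit_cube x * (\<integral>\<^sup>+j. ennreal ((cmod (f (x + of_int_vec j)))\<^sup>2) \<partial>count_space UNIV) \<partial>lborel)"
  proof (rule nn_integral_cong)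
    fix x :: "real ^ 'n"
    show "indicator unit_cube x * (\<Sum>j\<in>J. ennreal ((cmod (f (x + of_int_vec j)))\<^sup>2))
        = indicator unit_cube x * (\<integral>\<^sup>+j. ennreal ((cmod (f (x + of_int_vec j)))\<^sup>2) \<partial>count_space UNIV)"
    proof (cases "x \<in> unit_cube")
      case True
      then have "(\<integral>\<^sup>+j. ennreal ((cmod (f (x + of_int_vec j)))\<^sup>2) \<partial>count_space UNIV)
          = (\<Sum>j\<in>J. ennreal ((cmod (f (x + of_int_vec j)))\<^sup>2))"
        using supp floor_vec_cube_shift[OF True] by (intro nn_integral_count_space' J) auto
      then show ?thesis
        by simp
    qed simp
  qed
  also have "\<dots> = (\<integral>\<^sup>+x. ennreal ((cmod (f x))\<^sup>2) \<partial>lborel)"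
    by (rule nn_integral_tiling[symmetric]) measurable
  finally show ?thesis .
qed

subsection \<open>The transform on square-integrable functions\<close>

text \<open>
  The indicator of the union of the cubes in \<open>J\<close>, as a sum in order to make measurability evident.
\<close>

definition cube_cut :: "(int ^ 'n) set \<Rightarrow> real ^ 'n \<Rightarrow> complex" where
  "cube_cut J x = complex_of_real (\<Sum>j\<in>J. indicator unit_cube (x - of_int_vec j))"

lemma cube_cut_eq: "finite J \<Longrightarrow> cube_cut J x = (if floor_vec x \<in> J then 1 else 0)"
  by (simp add: cube_cut_def sum_indicator_cube)

lemma bounded_borel_cube_cut: "finite J \<Longrightarrow> bounded_borel (cube_cut J)"
  unfolding bounded_borel_def
proof (intro conjI exI[of _ 1] allI)
  show "cube_cut J \<in> borel_measurable borel"
    unfolding cube_cut_def[abs_def] by measurable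
  show "finite J \<Longrightarrow> cmod (cube_cut J x) \<le> 1" for x
    by (simp add: cube_cut_eq)
qed

text \<open>
  Square-integrable functions that are supported on finitely many cubes are integrable, so that the
  integral transform applies to them.
\<close>

definition boxed :: "(int ^ 'n) set \<Rightarrow> 'n::finite L2 \<Rightarrow> bool" where
  "boxed J f \<longleftrightarrow> finite J \<and> (AE x in lborel. floor_vec x \<notin> J \<longrightarrow> rep_L2 f x = 0)"

lemma integrable_rep_boxed:
  assumes "boxed J f"
  shows "integrable lborel (rep_L2 f)"
proof (rule Bochner_Integration.integrable_bound)
  have "integrable lborel (\<lambda>x. indicator unit_cube (x - of_int_vec j) :: real)" for j :: "int ^ 'a"
  proof (rule integrableI_bounded)
    have "(\<integral>\<^sup>+x. ennreal (norm (indicator unit_cube (x - of_int_vec j) :: real)) \<partial>lborel)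
        = (\<integral>\<^sup>+x. indicator unit_cube (x - of_int_vec j) \<partial>lborel)"
      by (intro nn_integral_cong) (simp add: indicator_def)
    also have "\<dots> = (\<integral>\<^sup>+x. indicator (unit_cube :: (real ^ 'a) set) x \<partial>lborel)"
      using nn_integral_translate[of "\<lambda>x. indicator unit_cube (x - of_int_vec j)" "of_int_vec j"] by simp
    also have "\<dots> < \<infinity>"
      by (simp add: emeasure_unit_cube)
    finally show "(\<integral>\<^sup>+x. ennreal (norm (indicator unit_cube (x - of_int_vec j) :: real)) \<partial>lborel) < \<infinity>" .
  qed measurable
  then show "integrable lborel (\<lambda>x. (\<Sum>j\<in>J. indicator unit_cube (x - of_int_vec j)) + (cmod (rep_L2 f x))\<^sup>2)"
    using sq_integrable_rep_L2[of f] by (auto simp: sq_integrable_def)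
  have supp: "AE x in lborel. floor_vec x \<notin> J \<longrightarrow> rep_L2 f x = 0" and J: "finite J"
    using assms by (auto simp: boxed_def)
  from supp show "AE x in lborel. norm (rep_L2 f x)
      \<le> norm ((\<Sum>j\<in>J. indicator unit_cube (x - of_int_vec j)) + (cmod (rep_L2 f x))\<^sup>2)"
  proof eventually_elim
    case (elim x)
    have "0 \<le> (cmod (rep_L2 f x) - 1)\<^sup>2" "0 \<le> (cmod (rep_L2 f x))\<^sup>2"
      by simp_all
    then have "cmod (rep_L2 f x) \<le> 1 + (cmod (rep_L2 f x))\<^sup>2"
      using norm_ge_zero[of "rep_L2 f x"] by (simp only: power2_diff power_one mult_1_right)
    then show ?case
      using elim by (simp add: sum_indicator_cube[OF J])
  qed
qed measurable

lemma boxed_add: "boxed J f \<Longrightarrow> boxed K g \<Longrightarrow> boxed (J \<union> K) (f + g)"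
  unfolding boxed_def using rep_L2_add[of f g] by (auto elim: eventually_elim2)

lemma boxed_scaleC: "boxed J f \<Longrightarrow> boxed J (c *\<^sub>C f)"
  unfolding boxed_def using rep_L2_scaleC[of c f] by (auto elim: eventually_elim2)

lemma boxed_diff: "boxed J f \<Longrightarrow> boxed K g \<Longrightarrow> boxed (J \<union> K) (f - g)"
  unfolding minus_L2_def by (intro boxed_add boxed_scaleC)

lemma fourier_integral_add:
  assumes "integrable lborel (rep_L2 f)" "integrable lborel (rep_L2 g)"
  shows "fourier_integral (rep_L2 (f + g)) \<omega> = fourier_integral (rep_L2 f) \<omega> + fourier_integral (rep_L2 g) \<omega>"
proof -
  have "fourier_integral (rep_L2 (f + g)) = fourier_integral (\<lambda>x. rep_L2 f x + rep_L2 g x)"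
    using rep_L2_add by (intro fourier_integral_cong_AE) auto
  then show ?thesis
    using assms by (simp add: fourier_integral_wave distrib_right integrable_times_wave)
qed

lemma fourier_integral_scaleC:
  "fourier_integral (rep_L2 (c *\<^sub>C f)) \<omega> = c * fourier_integral (rep_L2 f) \<omega>"
proof -
  have "fourier_integral (rep_L2 (c *\<^sub>C f)) = fourier_integral (\<lambda>x. c * rep_L2 f x)"
    using rep_L2_scaleC by (intro fourier_integral_cong_AE) auto
  then show ?thesis
    by (simp add: fourier_integral_wave mult.assoc)
qed

definition fourier_boxed :: "'n::finite L2 \<Rightarrow> 'n L2" where
  "fourier_boxed f = abs_L2 (fourier_integral (rep_L2 f))"

lemma nn_integral_fourier_boxed:
  assumes "boxed J f"
  shows "(\<integral>\<^sup>+\<omega>. ennreal ((cmod (fourier_integral (rep_L2 f) \<omega>))\<^sup>2) \<partial>lborel) = ennreal ((norm f)\<^sup>2)"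
proof -
  have J: "finite J" and supp: "AE x in lborel. floor_vec x \<notin> J \<longrightarrow> rep_L2 f x = 0"
    using assms by (auto simp: boxed_def)
  have bb: "bounded_borel (cube_cut J)"
    using J by (rule bounded_borel_cube_cut)
  then have [measurable]: "cube_cut J \<in> borel_measurable borel"
    by (rule bounded_borelD)
  let ?g = "\<lambda>x. cube_cut J x * rep_L2 f x"
  have eq: "AE x in lborel. rep_L2 f x = ?g x"
    using supp by eventually_elim (auto simp: cube_cut_eq[OF J])
  have "integrable lborel ?g \<longleftrightarrow> integrable lborel (rep_L2 f)"
    by (rule integrable_cong_AE) (use eq in \<open>auto elim: eventually_mono\<close>)
  then have int: "integrable lborel ?g"
    using integrable_rep_boxed[OF assms] by simp
  have "fourier_integral (rep_L2 f) = fourier_integral ?g"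
    by (rule fourier_integral_cong_AE[OF _ _ eq]) auto
  then have "(\<integral>\<^sup>+\<omega>. ennreal ((cmod (fourier_integral (rep_L2 f) \<omega>))\<^sup>2) \<partial>lborel)
      = (\<integral>\<^sup>+x. ennreal ((cmod (?g x))\<^sup>2) \<partial>lborel)"
    using Plancherel_finite_cubes[OF int sq_integrable_bounded_mult[OF bb sq_integrable_rep_L2] J]
    by (simp add: cube_cut_eq[OF J])
  also have "\<dots> = ennreal ((norm f)\<^sup>2)"
    unfolding ennreal_norm_L2_sq by (rule nn_integral_cong_AE) (use eq in eventually_elim, metis)
  finally show ?thesis .
qed

lemma rep_fourier_boxed:
  assumes "boxed J f"
  shows "AE \<omega> in lborel. rep_L2 (fourier_boxed f) \<omega> = fourier_integral (rep_L2 f) \<omega>"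
proof -
  have "integrable lborel (\<lambda>\<omega>. (cmod (fourier_integral (rep_L2 f) \<omega>))\<^sup>2)"
    by (rule integrableI_bounded) (auto simp: nn_integral_fourier_boxed[OF assms])
  then have "sq_integrable (fourier_integral (rep_L2 f))"
    by (simp add: sq_integrable_def)
  then show ?thesis
    unfolding fourier_boxed_def by (rule rep_abs_L2)
qed

lemma norm_fourier_boxed:
  assumes "boxed J f"
  shows "norm (fourier_boxed f) = norm f"
proof -
  have "ennreal ((norm (fourier_boxed f))\<^sup>2) = ennreal ((norm f)\<^sup>2)"
    unfolding nn_integral_fourier_boxed[OF assms, symmetric] ennreal_norm_L2_sq[of "fourier_boxed f"]
    by (rule nn_integral_cong_AE) (use rep_fourier_boxed[OF assms] in eventually_elim, simp)
  then show ?thesis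
    by (simp add: power2_eq_iff_nonneg)
qed

lemma fourier_boxed_add:
  assumes f: "boxed J f" and g: "boxed K g"
  shows "fourier_boxed (f + g) = fourier_boxed f + fourier_boxed g"
  by (rule L2_eqI)
     (use rep_fourier_boxed[OF f] rep_fourier_boxed[OF g] rep_fourier_boxed[OF boxed_add[OF f g]]
        rep_L2_add[of "fourier_boxed f" "fourier_boxed g"]
      in eventually_elim,
      simp add: fourier_integral_add[OF integrable_rep_boxed[OF f] integrable_rep_boxed[OF g]])

lemma fourier_boxed_scaleC:
  assumes f: "boxed J f"
  shows "fourier_boxed (c *\<^sub>C f) = c *\<^sub>C fourier_boxed f"
  by (rule L2_eqI)
     (use rep_fourier_boxed[OF f] rep_fourier_boxed[OF boxed_scaleC[OF f, of c]]
        rep_L2_scaleC[of c "fourier_boxed f"]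
      in eventually_elim, simp add: fourier_integral_scaleC)

lemma fourier_boxed_diff:
  assumes f: "boxed J f" and g: "boxed K g"
  shows "fourier_boxed (f - g) = fourier_boxed f - fourier_boxed g"
  unfolding minus_L2_def
  by (simp only: fourier_boxed_add[OF f boxed_scaleC[OF g]] fourier_boxed_scaleC[OF g])

definition cubes_upto :: "nat \<Rightarrow> (int ^ 'n::finite) set" where
  "cubes_upto N = from_nat ` {..N}"

lemma finite_cubes_upto [simp]: "finite (cubes_upto N)"
  by (simp add: cubes_upto_def)

lemma eventually_in_cubes_upto: "eventually (\<lambda>N. k \<in> cubes_upto N) sequentially"
  using eventually_ge_at_top[of "to_nat k"]
  by eventually_elim (auto simp: cubes_upto_def intro!: image_eqI[of _ _ "to_nat k"])

definition truncate :: "nat \<Rightarrow> 'n::finite L2 \<Rightarrow> 'n L2" where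
  "truncate N = mult_op (cube_cut (cubes_upto N))"

lemma tendsto_cube_cut: "(\<lambda>N. cube_cut (cubes_upto N) x) \<longlonglongrightarrow> 1"
  by (rule tendsto_eventually)
     (use eventually_in_cubes_upto[of "floor_vec x"] in eventually_elim, simp add: cube_cut_eq)

lemma boxed_truncate: "boxed (cubes_upto N) (truncate N f)"
  unfolding boxed_def truncate_def
  using rep_mult_op[OF bounded_borel_cube_cut[OF finite_cubes_upto], of N f]
  by (auto simp: cube_cut_eq elim: eventually_mono)

lemma truncate_tendsto: "(\<lambda>N. truncate N f) \<longlonglongrightarrow> f"
  unfolding truncate_def
  by (rule tendsto_mult_op[OF bounded_borel_cube_cut[OF finite_cubes_upto] _ tendsto_cube_cut])
     (simp add: cube_cut_eq)

text \<open>
  The limit exists because the transform is isometric on functions supported on finitely many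
  cubes, and these are dense.
\<close>

definition plancherel :: "'n::finite L2 \<Rightarrow> 'n L2" where
  "plancherel f = lim (\<lambda>N. fourier_boxed (truncate N f))"

lemma plancherel_tendsto: "(\<lambda>N. fourier_boxed (truncate N f)) \<longlonglongrightarrow> plancherel f"
proof -
  have "Cauchy (\<lambda>N. truncate N f)"
    using truncate_tendsto LIMSEQ_imp_Cauchy by blast
  then have "Cauchy (\<lambda>N. fourier_boxed (truncate N f))"
    unfolding Cauchy_def dist_norm
    by (simp add: fourier_boxed_diff[OF boxed_truncate boxed_truncate, symmetric]
        norm_fourier_boxed[OF boxed_diff[OF boxed_truncate boxed_truncate]])
  then show ?thesis
    unfolding plancherel_def by (simp add: Cauchy_convergent_iff convergent_LIMSEQ_iff)
qed

lemma plancherel_add: "plancherel (f + g) = plancherel f + plancherel g"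
proof (rule LIMSEQ_unique[OF plancherel_tendsto])
  have "fourier_boxed (truncate N (f + g)) = fourier_boxed (truncate N f) + fourier_boxed (truncate N g)" for N
    using fourier_boxed_add[OF boxed_truncate boxed_truncate]
    by (simp add: truncate_def mult_op_add[OF bounded_borel_cube_cut[OF finite_cubes_upto]])
  then show "(\<lambda>N. fourier_boxed (truncate N (f + g))) \<longlonglongrightarrow> plancherel f + plancherel g"
    using tendsto_add[OF plancherel_tendsto[of f] plancherel_tendsto[of g]] by simp
qed

lemma plancherel_scaleC: "plancherel (c *\<^sub>C f) = c *\<^sub>C plancherel f"
proof (rule LIMSEQ_unique[OF plancherel_tendsto])
  have "fourier_boxed (truncate N (c *\<^sub>C f)) = c *\<^sub>C fourier_boxed (truncate N f)" for N
    using fourier_boxed_scaleC[OF boxed_truncate]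
    by (simp add: truncate_def mult_op_scaleC[OF bounded_borel_cube_cut[OF finite_cubes_upto]])
  then show "(\<lambda>N. fourier_boxed (truncate N (c *\<^sub>C f))) \<longlonglongrightarrow> c *\<^sub>C plancherel f"
    using tendsto_scaleC[OF plancherel_tendsto[of f], of c] by simp
qed

lemma norm_plancherel: "norm (plancherel f) = norm f"
proof (rule LIMSEQ_unique)
  show "(\<lambda>N. norm (fourier_boxed (truncate N f))) \<longlonglongrightarrow> norm (plancherel f)"
    by (intro tendsto_norm plancherel_tendsto)
  show "(\<lambda>N. norm (fourier_boxed (truncate N f))) \<longlonglongrightarrow> norm f"
    unfolding norm_fourier_boxed[OF boxed_truncate] by (intro tendsto_norm truncate_tendsto)
qed

lemma bounded_linear_plancherel: "bounded_linear plancherel"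
  by (rule bounded_linear_intro[where K = 1])
     (simp_all add: plancherel_add scaleR_L2_def plancherel_scaleC norm_plancherel)

text \<open>
  The transforms of the truncations converge to the left side almost everywhere along a
  subsequence, and to the right side everywhere, by dominated convergence.
\<close>

lemma plancherel_fourier_integral:
  assumes f: "integrable lborel (rep_L2 f)"
  shows "AE \<omega> in lborel. rep_L2 (plancherel f) \<omega> = fourier_integral (rep_L2 f) \<omega>"
proof -
  obtain r where r: "strict_mono r"
    and lim: "AE \<omega> in lborel. (\<lambda>N. rep_L2 (fourier_boxed (truncate (r N) f)) \<omega>) \<longlonglongrightarrow> rep_L2 (plancherel f) \<omega>"
    using AE_tendsto_subsequence[OF plancherel_tendsto] by blast
  have eq: "AE \<omega> in lborel. \<forall>N. rep_L2 (fourier_boxed (truncate N f)) \<omega> = fourier_integral (rep_L2 (truncate N f)) \<omega>"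
    by (subst AE_all_countable) (use rep_fourier_boxed[OF boxed_truncate] in blast)
  have conv: "(\<lambda>N. fourier_integral (rep_L2 (truncate N f)) \<omega>) \<longlonglongrightarrow> fourier_integral (rep_L2 f) \<omega>" for \<omega>
  proof -
    have cut: "bounded_borel (cube_cut (cubes_upto N))" for N
      by (rule bounded_borel_cube_cut) simp
    have [measurable]: "cube_cut (cubes_upto N) \<in> borel_measurable borel" for N
      using cut by (rule bounded_borelD)
    have "fourier_integral (rep_L2 (truncate N f)) = fourier_integral (\<lambda>x. cube_cut (cubes_upto N) x * rep_L2 f x)" for N
      unfolding truncate_def by (rule fourier_integral_cong_AE[OF _ _ rep_mult_op[OF cut]]) auto
    moreover have "(\<lambda>N. fourier_integral (\<lambda>x. cube_cut (cubes_upto N) x * rep_L2 f x) \<omega>) \<longlonglongrightarrow> fourier_integral (rep_L2 f) \<omega>"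
      unfolding fourier_integral_wave
    proof (rule integral_dominated_convergence[where w = "\<lambda>x. cmod (rep_L2 f x)"])
      show "integrable lborel (\<lambda>x. cmod (rep_L2 f x))"
        using f by simp
      show "AE x in lborel. (\<lambda>N. cube_cut (cubes_upto N) x * rep_L2 f x * wave x \<omega>) \<longlonglongrightarrow> rep_L2 f x * wave x \<omega>"
      proof (rule AE_I2)
        fix x
        have "(\<lambda>N. cube_cut (cubes_upto N) x * rep_L2 f x * wave x \<omega>) \<longlonglongrightarrow> 1 * rep_L2 f x * wave x \<omega>"
          by (intro tendsto_intros tendsto_cube_cut)
        then show "(\<lambda>N. cube_cut (cubes_upto N) x * rep_L2 f x * wave x \<omega>) \<longlonglongrightarrow> rep_L2 f x * wave x \<omega>"
          by simp
      qed
      show "AE x in lborel. norm (cube_cut (cubes_upto N) x * rep_L2 f x * wave x \<omega>) \<le> cmod (rep_L2 f x)" for N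
        by (rule AE_I2) (simp add: norm_mult cube_cut_eq)
    qed measurable
    ultimately show ?thesis
      by simp
  qed
  show ?thesis
    using lim eq
  proof eventually_elim
    case (elim \<omega>)
    have "(\<lambda>N. fourier_integral (rep_L2 (truncate (r N) f)) \<omega>) \<longlonglongrightarrow> fourier_integral (rep_L2 f) \<omega>"
      using LIMSEQ_subseq_LIMSEQ[OF conv r] by (simp add: o_def)
    then show ?case
      using elim LIMSEQ_unique by simp
  qed
qed

theorem fourier_L2_plancherel: "fourier_L2 = (plancherel :: 'n::finite L2 \<Rightarrow> 'n L2)"
  unfolding fourier_L2_def
proof (rule the_equality)
  show "bounded_linear (plancherel :: 'n L2 \<Rightarrow> 'n L2) \<and> (\<forall>f :: 'n L2. integrable lborel (rep_L2 f) \<longrightarrow>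
      (AE \<omega> in lborel. rep_L2 (plancherel f) \<omega> = fourier_integral (rep_L2 f) \<omega>))"
    using bounded_linear_plancherel plancherel_fourier_integral by blast
  fix F :: "'n L2 \<Rightarrow> 'n L2"
  assume F: "bounded_linear F \<and> (\<forall>f. integrable lborel (rep_L2 f) \<longrightarrow>
      (AE \<omega> in lborel. rep_L2 (F f) \<omega> = fourier_integral (rep_L2 f) \<omega>))"
  have eq: "F f = plancherel f" if f: "integrable lborel (rep_L2 f)" for f
  proof (rule L2_eqI)
    have "AE \<omega> in lborel. rep_L2 (F f) \<omega> = fourier_integral (rep_L2 f) \<omega>"
      using F f by blast
    then show "AE \<omega> in lborel. rep_L2 (F f) \<omega> = rep_L2 (plancherel f) \<omega>"
      using plancherel_fourier_integral[OF f] by eventually_elim simp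
  qed
  show "F = plancherel"
  proof
    fix f
    have "(\<lambda>N. F (truncate N f)) \<longlonglongrightarrow> F f"
      using F by (intro bounded_linear.tendsto[OF _ truncate_tendsto]) blast
    then have "(\<lambda>N. plancherel (truncate N f)) \<longlonglongrightarrow> F f"
      by (simp add: eq[OF integrable_rep_boxed[OF boxed_truncate]])
    moreover have "(\<lambda>N. plancherel (truncate N f)) \<longlonglongrightarrow> plancherel f"
      by (rule bounded_linear.tendsto[OF bounded_linear_plancherel truncate_tendsto])
    ultimately show "F f = plancherel f"
      by (rule LIMSEQ_unique)
  qed
qed

lemma fourier_L2_add: "fourier_L2 (f + g) = fourier_L2 f + fourier_L2 g"
  and fourier_L2_scaleC: "fourier_L2 (c *\<^sub>C f) = c *\<^sub>C fourier_L2 f"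
  and norm_fourier_L2 [simp]: "norm (fourier_L2 f) = norm f"
  and bounded_linear_fourier_L2: "bounded_linear fourier_L2"
  and rep_fourier_L2: "integrable lborel (rep_L2 f) \<Longrightarrow>
      AE \<omega> in lborel. rep_L2 (fourier_L2 f) \<omega> = fourier_integral (rep_L2 f) \<omega>"
  unfolding fourier_L2_plancherel
  by (fact plancherel_add plancherel_scaleC norm_plancherel bounded_linear_plancherel
      plancherel_fourier_integral)+

lemma fourier_L2_diff: "fourier_L2 (f - g) = fourier_L2 f - fourier_L2 g"
  unfolding minus_L2_def by (simp only: fourier_L2_add fourier_L2_scaleC)

lemma fourier_L2_inject: "fourier_L2 f = fourier_L2 g \<longleftrightarrow> f = g"
proof
  assume "fourier_L2 f = fourier_L2 g"
  then have "norm (fourier_L2 (f - g)) = 0"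
    by (simp add: fourier_L2_diff)
  then show "f = g"
    by simp
qed simp

subsection \<open>Surjectivity\<close>

definition conj_L2 :: "'n::finite L2 \<Rightarrow> 'n L2" where
  "conj_L2 f = abs_L2 (\<lambda>x. cnj (rep_L2 f x))"

lemma rep_conj_L2: "AE x in lborel. rep_L2 (conj_L2 f) x = cnj (rep_L2 f x)"
  unfolding conj_L2_def
  by (rule rep_abs_L2) (use sq_integrable_rep_L2[of f] in \<open>simp add: sq_integrable_def\<close>)

lemma norm_conj_L2_diff: "norm (conj_L2 f - conj_L2 g) = norm (f - g)"
proof -
  have "ennreal ((norm (conj_L2 f - conj_L2 g))\<^sup>2) = ennreal ((norm (f - g))\<^sup>2)"
    unfolding ennreal_norm_diff_L2_sq
    by (rule nn_integral_cong_AE)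
       (use rep_conj_L2[of f] rep_conj_L2[of g] in eventually_elim, simp flip: complex_cnj_diff)
  then show ?thesis
    by (simp add: power2_eq_iff_nonneg)
qed

lemma conj_L2_tendsto: "x \<longlonglongrightarrow> f \<Longrightarrow> (\<lambda>N. conj_L2 (x N)) \<longlonglongrightarrow> conj_L2 f"
  unfolding tendsto_iff dist_norm norm_conj_L2_diff .

lemma norm_conj_L2:
  fixes f :: "'n::finite L2"
  shows "norm (conj_L2 f) = norm f"
proof -
  have "conj_L2 0 = (0 :: 'n L2)"
    by (rule L2_eqI) (use rep_conj_L2[of 0] rep_L2_zero in eventually_elim, simp)
  then show ?thesis
    using norm_conj_L2_diff[of f 0] by simp
qed

lemma boxed_conj_L2: "boxed J f \<Longrightarrow> boxed J (conj_L2 f)"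
  unfolding boxed_def using rep_conj_L2[of f] by (auto elim: eventually_elim2)

text \<open>
  The adjoint of the Fourier transform.  It is an isometry because the transform is one, and an
  isometry with isometric adjoint is onto.
\<close>

definition fourier_inv :: "'n::finite L2 \<Rightarrow> 'n L2" where
  "fourier_inv g = conj_L2 (fourier_L2 (conj_L2 g))"

lemma norm_fourier_inv: "norm (fourier_inv g) = norm g"
  by (simp add: fourier_inv_def norm_conj_L2)

text \<open>Exchanging the order of integration in \<open>\<integral> \<integral> f x * wave x \<omega> * cnj (g \<omega>)\<close>.\<close>

lemma cinner_fourier_boxed:
  assumes f: "boxed J f" and g: "boxed K g"
  shows "cinner (fourier_L2 f) g = cinner f (fourier_inv g)"
proof -
  have fi: "integrable lborel (rep_L2 f)" and gi: "integrable lborel (rep_L2 g)"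
    and ci: "integrable lborel (rep_L2 (conj_L2 g))"
    using f g boxed_conj_L2 integrable_rep_boxed by blast+
  let ?k = "\<lambda>(x, \<omega>). rep_L2 f x * wave x \<omega> * cnj (rep_L2 g \<omega>)"
  have int: "integrable (lborel \<Otimes>\<^sub>M lborel) ?k"
  proof (rule lborel_pair.Fubini_integrable)
    have "integrable lborel (\<lambda>x. cmod (rep_L2 f x) * (LINT \<omega>|lborel. cmod (rep_L2 g \<omega>)))"
      using fi by (intro integrable_mult_left) simp
    then show "integrable lborel (\<lambda>x. LINT \<omega>|lborel. norm (?k (x, \<omega>)))"
      by (simp add: norm_mult)
    have "integrable lborel (\<lambda>\<omega>. rep_L2 f x * (wave x \<omega> * cnj (rep_L2 g \<omega>)))" for x
    proof (intro integrable_mult_right)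
      show "integrable lborel (\<lambda>\<omega>. wave x \<omega> * cnj (rep_L2 g \<omega>))"
        by (rule Bochner_Integration.integrable_bound[OF gi]) (auto simp: norm_mult)
    qed
    then show "AE x in lborel. integrable lborel (\<lambda>\<omega>. ?k (x, \<omega>))"
      by (simp add: mult.assoc)
  qed measurable
  have "cinner (fourier_L2 f) g = (LINT \<omega>|lborel. (LINT x|lborel. ?k (x, \<omega>)))"
    unfolding cinner.rep_eq
  proof (rule integral_cong_AE)
    show "AE \<omega> in lborel. rep_L2 (fourier_L2 f) \<omega> * cnj (rep_L2 g \<omega>) = (LINT x|lborel. ?k (x, \<omega>))"
      using rep_fourier_L2[OF fi] by eventually_elim (simp add: fourier_integral_wave)
  qed measurable
  also have "\<dots> = (LINT x|lborel. (LINT \<omega>|lborel. ?k (x, \<omega>)))"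
    using lborel_pair.Fubini_integral[of "\<lambda>x \<omega>. ?k (x, \<omega>)"] int by simp
  also have "\<dots> = cinner f (fourier_inv g)"
    unfolding cinner.rep_eq
  proof (rule integral_cong_AE)
    have "fourier_integral (rep_L2 (conj_L2 g)) = fourier_integral (\<lambda>x. cnj (rep_L2 g x))"
      by (rule fourier_integral_cong_AE[OF _ _ rep_conj_L2]) auto
    then have fc: "fourier_integral (rep_L2 (conj_L2 g)) x = (LINT \<omega>|lborel. wave x \<omega> * cnj (rep_L2 g \<omega>))" for x
      by (simp add: fourier_integral_wave mult.commute wave_commute[of x])
    show "AE x in lborel. (LINT \<omega>|lborel. ?k (x, \<omega>)) = rep_L2 f x * cnj (rep_L2 (fourier_inv g) x)"
      using rep_fourier_L2[OF ci] rep_conj_L2[of "fourier_L2 (conj_L2 g)"]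
      unfolding fourier_inv_def by eventually_elim (simp add: mult.assoc fc)
  qed measurable
  finally show ?thesis .
qed

lemma cinner_fourier_L2: "cinner (fourier_L2 f) g = cinner f (fourier_inv g)"
proof (rule LIMSEQ_unique)
  show "(\<lambda>N. cinner (fourier_L2 (truncate N f)) (truncate N g)) \<longlonglongrightarrow> cinner (fourier_L2 f) g"
    by (intro tendsto_cinner truncate_tendsto bounded_linear.tendsto[OF bounded_linear_fourier_L2])
  have "(\<lambda>N. cinner (truncate N f) (fourier_inv (truncate N g))) \<longlonglongrightarrow> cinner f (fourier_inv g)"
    unfolding fourier_inv_def
    by (intro tendsto_cinner truncate_tendsto conj_L2_tendsto bounded_linear.tendsto[OF bounded_linear_fourier_L2])
  then show "(\<lambda>N. cinner (fourier_L2 (truncate N f)) (truncate N g)) \<longlonglongrightarrow> cinner f (fourier_inv g)"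
    by (simp add: cinner_fourier_boxed[OF boxed_truncate boxed_truncate])
qed

lemma fourier_L2_inv [simp]: "fourier_L2 (fourier_inv g) = g"
proof -
  have "(norm (fourier_L2 (fourier_inv g) - g))\<^sup>2
      = (norm g)\<^sup>2 - 2 * Re (cinner (fourier_inv g) (fourier_inv g)) + (norm g)\<^sup>2"
    by (simp add: norm_diff_sq_L2 norm_fourier_inv cinner_fourier_L2)
  also have "\<dots> = 0"
    by (simp add: cinner_norm norm_fourier_inv)
  finally show ?thesis
    by simp
qed

lemma fourier_inv_L2 [simp]: "fourier_inv (fourier_L2 f) = f"
  using fourier_L2_inject fourier_L2_inv by blast

lemma cinner_fourier: "cinner (fourier_L2 f) (fourier_L2 g) = cinner f g"
  by (simp add: cinner_fourier_L2)

subsection \<open>Translations become characters\<close>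

lemma norm_shift: "norm (shift k f) = norm f"
proof -
  have "ennreal ((norm (shift k f))\<^sup>2) = (\<integral>\<^sup>+x. ennreal ((cmod (rep_L2 f (x - of_int_vec k)))\<^sup>2) \<partial>lborel)"
    unfolding ennreal_norm_L2_sq
    by (rule nn_integral_cong_AE) (use rep_L2_shift[of k f] in eventually_elim, simp)
  also have "\<dots> = ennreal ((norm f)\<^sup>2)"
    unfolding ennreal_norm_L2_sq
    using nn_integral_translate[of "\<lambda>x. ennreal ((cmod (rep_L2 f x))\<^sup>2)" "- of_int_vec k"] by simp
  finally show ?thesis
    by (simp add: power2_eq_iff_nonneg)
qed

lemma shift_add: "shift k (f + g) = shift k f + shift k g"
proof (rule L2_eqI)
  have "AE x in lborel. rep_L2 (f + g) (x - of_int_vec k) = rep_L2 f (x - of_int_vec k) + rep_L2 g (x - of_int_vec k)"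
    by (rule AE_lborel_translate[OF rep_L2_add])
  then show "AE x in lborel. rep_L2 (shift k (f + g)) x = rep_L2 (shift k f + shift k g) x"
    using rep_L2_shift[of k f] rep_L2_shift[of k g] rep_L2_shift[of k "f + g"] rep_L2_add[of "shift k f" "shift k g"]
    by eventually_elim simp
qed

lemma shift_scaleC: "shift k (c *\<^sub>C f) = c *\<^sub>C shift k f"
proof (rule L2_eqI)
  have "AE x in lborel. rep_L2 (c *\<^sub>C f) (x - of_int_vec k) = c * rep_L2 f (x - of_int_vec k)"
    by (rule AE_lborel_translate[OF rep_L2_scaleC])
  then show "AE x in lborel. rep_L2 (shift k (c *\<^sub>C f)) x = rep_L2 (c *\<^sub>C shift k f) x"
    using rep_L2_shift[of k f] rep_L2_shift[of k "c *\<^sub>C f"] rep_L2_scaleC[of c "shift k f"]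
    by eventually_elim simp
qed

lemma bounded_linear_shift: "bounded_linear (shift k)"
  by (rule bounded_linear_intro[where K = 1])
     (simp_all add: shift_add scaleR_L2_def shift_scaleC norm_shift)

lemma bounded_borel_wave: "bounded_borel (wave x)"
  by (auto simp: bounded_borel_def intro!: exI[of _ 1])

lemma bounded_linear_mult_op:
  assumes m: "bounded_borel m"
  shows "bounded_linear (mult_op m)"
proof -
  obtain B where B: "\<And>\<omega>. cmod (m \<omega>) \<le> B"
    using bounded_borelD[OF m] by blast
  show ?thesis
    by (rule bounded_linear_intro[where K = B])
       (simp_all add: mult_op_add[OF m] scaleR_L2_def mult_op_scaleC[OF m] norm_mult_op_le[OF m B] mult.commute)
qed

lemma fourier_shift: "fourier_L2 (shift k f) = mult_op (wave (of_int_vec k)) (fourier_L2 f)"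
proof (rule LIMSEQ_unique)
  have boxed: "fourier_L2 (shift k f) = mult_op (wave (of_int_vec k)) (fourier_L2 f)" if "boxed J f" for J f
  proof -
    have f: "integrable lborel (rep_L2 f)"
      using that by (rule integrable_rep_boxed)
    have sf: "integrable lborel (\<lambda>x. rep_L2 f (x - of_int_vec k))"
      using integrable_translate[OF f, of "- of_int_vec k"] by simp
    then have int: "integrable lborel (rep_L2 (shift k f))"
      by (subst integrable_cong_AE[OF _ _ rep_L2_shift]) auto
    have "fourier_integral (rep_L2 (shift k f)) \<omega> = wave (of_int_vec k) \<omega> * fourier_integral (rep_L2 f) \<omega>" for \<omega>
    proof -
      have "fourier_integral (rep_L2 (shift k f)) = fourier_integral (\<lambda>x. rep_L2 f (x - of_int_vec k))"
        by (rule fourier_integral_cong_AE[OF _ _ rep_L2_shift]) auto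
      then have "fourier_integral (rep_L2 (shift k f)) \<omega> = (LINT x|lborel. rep_L2 f (x - of_int_vec k) * wave x \<omega>)"
        by (simp add: fourier_integral_wave)
      also have "\<dots> = (LINT x|lborel. wave (of_int_vec k) \<omega> * (rep_L2 f x * wave x \<omega>))"
        using integral_translate[of "\<lambda>x. rep_L2 f (x - of_int_vec k) * wave x \<omega>" "of_int_vec k"]
        by (simp add: wave_add_left mult_ac)
      finally show ?thesis
        by (simp add: fourier_integral_wave)
    qed
    then show ?thesis
      by (intro L2_eqI)
         (use rep_fourier_L2[OF f] rep_fourier_L2[OF int] rep_mult_op[OF bounded_borel_wave, of "of_int_vec k" "fourier_L2 f"]
          in eventually_elim, simp)
  qed
  show "(\<lambda>N. fourier_L2 (shift k (truncate N f))) \<longlonglongrightarrow> fourier_L2 (shift k f)"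
    by (intro bounded_linear.tendsto[OF bounded_linear_fourier_L2] bounded_linear.tendsto[OF bounded_linear_shift] truncate_tendsto)
  show "(\<lambda>N. fourier_L2 (shift k (truncate N f))) \<longlonglongrightarrow> mult_op (wave (of_int_vec k)) (fourier_L2 f)"
    unfolding boxed[OF boxed_truncate]
    by (intro bounded_linear.tendsto[OF bounded_linear_mult_op[OF bounded_borel_wave]]
        bounded_linear.tendsto[OF bounded_linear_fourier_L2] truncate_tendsto)
qed

section \<open>Operators given by periodic multipliers\<close>

definition multiplier :: "(real ^ 'n \<Rightarrow> complex) \<Rightarrow> 'n::finite L2 \<Rightarrow> 'n L2" where
  "multiplier m f = fourier_inv (mult_op m (fourier_L2 f))"

lemma fourier_multiplier [simp]: "fourier_L2 (multiplier m f) = mult_op m (fourier_L2 f)"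
  by (simp add: multiplier_def)

lemma L2_eqI_fourier: "fourier_L2 f = fourier_L2 g \<Longrightarrow> f = g"
  by (simp only: fourier_L2_inject)

lemma multiplier_add: "periodic_multiplier m \<Longrightarrow> multiplier m (f + g) = multiplier m f + multiplier m g"
  by (rule L2_eqI_fourier)
     (simp only: fourier_multiplier fourier_L2_add mult_op_add[OF periodic_multiplier_bounded_borel])

lemma multiplier_scaleC: "periodic_multiplier m \<Longrightarrow> multiplier m (c *\<^sub>C f) = c *\<^sub>C multiplier m f"
  by (rule L2_eqI_fourier)
     (simp only: fourier_multiplier fourier_L2_scaleC mult_op_scaleC[OF periodic_multiplier_bounded_borel])

lemma multiplier_diff: "periodic_multiplier m \<Longrightarrow> multiplier m (f - g) = multiplier m f - multiplier m g"
  by (rule L2_eqI_fourier)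
     (simp only: fourier_multiplier fourier_L2_diff mult_op_diff[OF periodic_multiplier_bounded_borel])

lemma multiplier_mult:
  assumes "periodic_multiplier m" "periodic_multiplier l"
  shows "multiplier m (multiplier l f) = multiplier (\<lambda>\<omega>. m \<omega> * l \<omega>) f"
  by (rule L2_eqI_fourier)
     (simp add: assms periodic_multiplier_mult mult_op_mult periodic_multiplier_bounded_borel)

lemma multiplier_commute:
  assumes "periodic_multiplier m" "periodic_multiplier l"
  shows "multiplier m (multiplier l f) = multiplier l (multiplier m f)"
  using assms by (simp add: multiplier_mult mult.commute)

lemma multiplier_plus:
  assumes "periodic_multiplier m" "periodic_multiplier l"
  shows "multiplier (\<lambda>\<omega>. m \<omega> + l \<omega>) f = multiplier m f + multiplier l f"
  by (rule L2_eqI_fourier)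
     (simp add: assms periodic_multiplier_add fourier_L2_add mult_op_plus periodic_multiplier_bounded_borel)

lemma multiplier_const: "multiplier (\<lambda>_. c) f = c *\<^sub>C f"
  by (rule L2_eqI_fourier) (simp add: fourier_L2_scaleC mult_op_const)

lemma multiplier_wave: "multiplier (wave (of_int_vec k)) f = shift k f"
  by (rule L2_eqI_fourier) (simp add: fourier_shift)

lemma cinner_multiplier:
  assumes "periodic_multiplier m"
  shows "cinner (multiplier m f) g = cinner f (multiplier (\<lambda>\<omega>. cnj (m \<omega>)) g)"
proof -
  have "cinner (multiplier m f) g = cinner (mult_op m (fourier_L2 f)) (fourier_L2 g)"
    using cinner_fourier[of "multiplier m f" g] by simp
  also have "\<dots> = cinner (fourier_L2 f) (mult_op (\<lambda>\<omega>. cnj (m \<omega>)) (fourier_L2 g))"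
    using assms periodic_multiplier_cnj[OF assms]
    by (intro cinner_mult_op periodic_multiplier_bounded_borel)
  also have "\<dots> = cinner f (multiplier (\<lambda>\<omega>. cnj (m \<omega>)) g)"
    using cinner_fourier[of f "multiplier (\<lambda>\<omega>. cnj (m \<omega>)) g"] by simp
  finally show ?thesis .
qed

lemma bounded_linear_multiplier:
  assumes "periodic_multiplier m"
  shows "bounded_linear (multiplier m)"
proof -
  obtain B where B: "\<And>\<omega>. cmod (m \<omega>) \<le> B"
    using periodic_multiplierD(2)[OF assms] by blast
  have norm: "norm (multiplier m f) = norm (mult_op m (fourier_L2 f))" for f
    by (simp add: multiplier_def norm_fourier_inv)
  show ?thesis
  proof (rule bounded_linear_intro[where K = B])
    show "norm (multiplier m f) \<le> norm f * B" for f
      unfolding norm using norm_mult_op_le[OF periodic_multiplier_bounded_borel[OF assms] B, of "fourier_L2 f"]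
      by (simp add: mult.commute)
  qed (simp_all add: multiplier_add[OF assms] scaleR_L2_def multiplier_scaleC[OF assms])
qed

lemma rep_fourier_multiplier:
  "periodic_multiplier m \<Longrightarrow>
    AE \<omega> in lborel. rep_L2 (fourier_L2 (multiplier m f)) \<omega> = m \<omega> * rep_L2 (fourier_L2 f) \<omega>"
  by (simp add: rep_mult_op periodic_multiplier_bounded_borel)

text \<open>
  On the fibers, \<open>multiplier m\<close> is multiplication by the scalar \<open>m \<omega>\<close>; as a function on the
  cube, \<open>m\<close> is the sum of its Fourier series.
\<close>

lemma Lambda_eq_multiplier:
  assumes m: "periodic_multiplier m"
    and a: "AE \<omega> in lborel. \<omega> \<in> unit_cube \<longrightarrow> rep_L2 (symbol a) \<omega> = m \<omega>"
  shows "Lambda a = multiplier m"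
proof
  fix f
  have iff: "(AE \<omega> in lborel. \<omega> \<in> unit_cube \<longrightarrow>
      fiberization g \<omega> = (\<lambda>k. rep_L2 (symbol a) \<omega> * fiberization f \<omega> k)) \<longleftrightarrow> g = multiplier m f" for g
  proof -
    have "(AE \<omega> in lborel. \<omega> \<in> unit_cube \<longrightarrow>
        fiberization g \<omega> = (\<lambda>k. rep_L2 (symbol a) \<omega> * fiberization f \<omega> k)) \<longleftrightarrow>
      (AE \<omega> in lborel. \<omega> \<in> unit_cube \<longrightarrow> (\<forall>k. rep_L2 (fourier_L2 g) (\<omega> + of_int_vec k)
          = m (\<omega> + of_int_vec k) * rep_L2 (fourier_L2 f) (\<omega> + of_int_vec k)))" (is "?A \<longleftrightarrow> ?B")
    proof
      assume ?A
      with a show ?B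
        by eventually_elim (auto simp: fiberization_def fun_eq_iff periodic_multiplierD(3)[OF m])
    next
      assume ?B
      with a show ?A
        by eventually_elim (auto simp: fiberization_def fun_eq_iff periodic_multiplierD(3)[OF m])
    qed
    also have "\<dots> \<longleftrightarrow> (AE \<omega> in lborel. rep_L2 (fourier_L2 g) \<omega> = m \<omega> * rep_L2 (fourier_L2 f) \<omega>)"
      by (rule AE_cube_iff[symmetric])
    also have "\<dots> \<longleftrightarrow> (AE \<omega> in lborel. rep_L2 (fourier_L2 g) \<omega> = rep_L2 (fourier_L2 (multiplier m f)) \<omega>)"
      (is "?A \<longleftrightarrow> ?B")
    proof
      assume ?A
      with rep_fourier_multiplier[OF m, of f] show ?B
        by eventually_elim simp
    next
      assume ?B
      with rep_fourier_multiplier[OF m, of f] show ?A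
        by eventually_elim simp
    qed
    also have "\<dots> \<longleftrightarrow> g = multiplier m f"
      unfolding L2_eq_iff[symmetric] by (rule fourier_L2_inject)
    finally show ?thesis .
  qed
  show "Lambda a f = multiplier m f"
    unfolding Lambda_def iff by simp
qed

text \<open>
  The coefficients are the Fourier coefficients of \<open>m\<close> on the cube.
\<close>

lemma multiplier_is_Lambda:
  assumes m: "periodic_multiplier m"
  shows "\<exists>a. bounded_spectrum a \<and> Lambda a = multiplier m"
proof -
  obtain B where B: "\<And>\<omega>. cmod (m \<omega>) \<le> B"
    using periodic_multiplierD(2)[OF m] by blast
  have [measurable]: "m \<in> borel_measurable borel"
    using periodic_multiplierD(1)[OF m] .
  have "sq_integrable (\<lambda>\<omega>. m \<omega> * (if \<omega> \<in> unit_cube then exp (- 2 * pi * \<i> * (\<omega> \<bullet> of_int_vec 0)) else 0))"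
    by (intro sq_integrable_bounded_mult sq_integrable_character periodic_multiplier_bounded_borel m)
  then have sq: "sq_integrable (\<lambda>\<omega>. if \<omega> \<in> unit_cube then m \<omega> else 0)"
    by (simp add: if_distrib cong: if_cong)
  define u where "u = abs_L2 (\<lambda>\<omega>. if \<omega> \<in> unit_cube then m \<omega> else 0)"
  have u: "AE \<omega> in lborel. rep_L2 u \<omega> = (if \<omega> \<in> unit_cube then m \<omega> else 0)"
    unfolding u_def by (rule rep_abs_L2[OF sq])
  then have supp: "AE \<omega> in lborel. \<omega> \<notin> unit_cube \<longrightarrow> rep_L2 u \<omega> = 0"
    by eventually_elim simp
  define a where "a = (\<lambda>k. cinner u (character k))"
  have sym: "symbol a = u"
    unfolding symbol_def a_def using character_expansion(1)[OF supp] by (rule infsumI)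
  have "bounded_spectrum a"
    unfolding bounded_spectrum_def
  proof
    show "(\<lambda>k. (cmod (a k))\<^sup>2) summable_on UNIV"
      unfolding a_def using character_expansion(2)[OF supp] by (rule has_sum_imp_summable)
    show "\<exists>C. AE \<omega> in lborel. \<omega> \<in> unit_cube \<longrightarrow> cmod (rep_L2 (symbol a) \<omega>) \<le> C"
      unfolding sym using u by (intro exI[of _ B]) (auto simp: B elim: eventually_mono)
  qed
  moreover have "Lambda a = multiplier m"
    by (rule Lambda_eq_multiplier[OF m]) (use u sym in \<open>auto elim: eventually_mono\<close>)
  ultimately show ?thesis by blast
qed

subsection \<open>Shift-preserving operators commute with multipliers\<close>

text \<open>
  By Plancherel, \<open>norm (multiplier p f - multiplier m f)\<close> is the distance of \<open>p\<close> and \<open>m\<close> in the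
  mean with respect to the density \<open>(cmod (fourier_L2 f))\<^sup>2\<close>; adding the densities of \<open>f\<close> and \<open>g\<close>
  gives a finite measure that controls both.
\<close>

lemma multiplier_approximation:
  fixes f g :: "'n::finite L2"
  assumes m: "periodic_multiplier m"
  shows "\<exists>p. (\<forall>n. trig_poly (p n)) \<and> (\<lambda>n. multiplier (p n) f) \<longlonglongrightarrow> multiplier m f
    \<and> (\<lambda>n. multiplier (p n) g) \<longlonglongrightarrow> multiplier m g"
proof -
  let ?F = "rep_L2 (fourier_L2 f)" and ?G = "rep_L2 (fourier_L2 g)"
  define w where "w = (\<lambda>\<omega>. ennreal ((cmod (?F \<omega>))\<^sup>2) + ennreal ((cmod (?G \<omega>))\<^sup>2))"
  have w [measurable]: "w \<in> borel_measurable borel"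
    unfolding w_def by measurable
  define \<mu> where "\<mu> = density lborel w"
  have "emeasure \<mu> UNIV = ennreal ((norm f)\<^sup>2) + ennreal ((norm g)\<^sup>2)"
    by (simp add: \<mu>_def emeasure_density w_def nn_integral_add flip: ennreal_norm_L2_sq)
  then interpret finite_borel_measure \<mu>
    by (intro finite_borel_measure.intro finite_measureI finite_borel_measure_axioms.intro)
       (simp_all add: \<mu>_def)
  have "\<exists>p. trig_poly p \<and> norm (multiplier p f - multiplier m f) < 1 / Suc n
      \<and> norm (multiplier p g - multiplier m g) < 1 / Suc n" for n
  proof -
    let ?e = "1 / Suc n :: real"
    obtain p where p: "trig_poly p" "(\<integral>\<^sup>+\<omega>. ennreal ((cmod (m \<omega> - p \<omega>))\<^sup>2) \<partial>\<mu>) < ennreal (?e\<^sup>2)"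
      using trig_poly_dense[OF m, of "?e\<^sup>2"] by auto
    have [measurable]: "m \<in> borel_measurable borel" "p \<in> borel_measurable borel"
      using m p(1) trig_poly_measurable periodic_multiplierD(1) by auto
    have close: "norm (multiplier p h - multiplier m h) < ?e"
      if h: "\<And>\<omega>. ennreal ((cmod (rep_L2 (fourier_L2 h) \<omega>))\<^sup>2) \<le> w \<omega>" for h
    proof -
      have "norm (multiplier m h - multiplier p h) = norm (mult_op m (fourier_L2 h) - mult_op p (fourier_L2 h))"
        using norm_fourier_L2[of "multiplier m h - multiplier p h"] by (simp add: fourier_L2_diff)
      then have "ennreal ((norm (multiplier m h - multiplier p h))\<^sup>2)
          = (\<integral>\<^sup>+\<omega>. ennreal ((cmod (m \<omega> - p \<omega>))\<^sup>2) * ennreal ((cmod (rep_L2 (fourier_L2 h) \<omega>))\<^sup>2) \<partial>lborel)"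
        using m p(1) by (simp add: norm_mult_op_diff periodic_multiplier_bounded_borel trig_poly_multiplier)
      also have "\<dots> \<le> (\<integral>\<^sup>+\<omega>. w \<omega> * ennreal ((cmod (m \<omega> - p \<omega>))\<^sup>2) \<partial>lborel)"
        using h by (intro nn_integral_mono) (simp add: mult.commute mult_right_mono)
      also have "\<dots> = (\<integral>\<^sup>+\<omega>. ennreal ((cmod (m \<omega> - p \<omega>))\<^sup>2) \<partial>\<mu>)"
        unfolding \<mu>_def by (rule nn_integral_density[symmetric]) measurable
      finally have "ennreal ((norm (multiplier m h - multiplier p h))\<^sup>2) < ennreal (?e\<^sup>2)"
        using p(2) by (rule le_less_trans)
      then have "(norm (multiplier m h - multiplier p h))\<^sup>2 < ?e\<^sup>2"
        by (subst (asm) ennreal_less_iff) auto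
      then have "norm (multiplier m h - multiplier p h) < ?e"
        by (rule power2_less_imp_less) simp
      then show ?thesis
        by (simp add: norm_minus_commute)
    qed
    show ?thesis
      using p(1) close[of f] close[of g] by (auto simp: w_def)
  qed
  then obtain p where p: "\<And>n. trig_poly (p n)"
      "\<And>n. norm (multiplier (p n) f - multiplier m f) < 1 / Suc n"
      "\<And>n. norm (multiplier (p n) g - multiplier m g) < 1 / Suc n"
    by metis
  have lim: "x \<longlonglongrightarrow> l" if "\<And>n. norm (x n - l) < 1 / Suc n" for x and l :: "'n L2"
  proof -
    have "(\<lambda>n. x n - l) \<longlonglongrightarrow> 0"
      by (rule Lim_null_comparison[OF _ LIMSEQ_inverse_real_of_nat])
         (intro always_eventually allI less_imp_le, use that in \<open>simp add: inverse_eq_divide\<close>)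
    then show ?thesis
      by (rule LIM_zero_cancel)
  qed
  show ?thesis
    using p(1) lim[OF p(2)] lim[OF p(3)] by (intro exI[of _ p]) simp
qed

locale shift_preserving_operator =
  fixes V :: "'n::finite L2 set" and L :: "'n L2 \<Rightarrow> 'n L2"
  assumes shift_inv: "shift_invariant V" and shift_pres: "shift_preserving V L"
begin

sublocale bounded_operator_on V L
  using shift_inv shift_pres
  by unfold_locales (auto simp: shift_invariant_def shift_preserving_def)

lemma
  assumes p: "trig_poly p" and f: "f \<in> V"
  shows trig_multiplier_in: "multiplier p f \<in> V"
    and L_trig_multiplier: "L (multiplier p f) = multiplier p (L f)"
proof -
  have "multiplier p f \<in> V \<and> L (multiplier p f) = multiplier p (L f)"
    using p
  proof (induction rule: trig_poly.induct)
    case (wave k)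
    show ?case
      using shift_inv shift_pres f
      by (simp add: multiplier_wave shift_invariant_def shift_preserving_def)
  next
    case (add p q)
    then show ?case
      by (simp add: multiplier_plus trig_poly_multiplier L_add V_add)
  next
    case (scale p c)
    have "multiplier (\<lambda>\<omega>. c * p \<omega>) h = c *\<^sub>C multiplier p h" for h
      using multiplier_mult[OF periodic_multiplier_const trig_poly_multiplier[OF scale.hyps], of c h]
      by (simp add: multiplier_const)
    with scale.IH show ?case
      by (simp add: L_scale V_scale)
  qed
  then show "multiplier p f \<in> V" "L (multiplier p f) = multiplier p (L f)"
    by auto
qed

lemma
  assumes m: "periodic_multiplier m" and f: "f \<in> V"
  shows multiplier_in: "multiplier m f \<in> V"
    and L_multiplier: "L (multiplier m f) = multiplier m (L f)"
proof -
  obtain p where p: "\<And>n. trig_poly (p n)" and lim: "(\<lambda>n. multiplier (p n) f) \<longlonglongrightarrow> multiplier m f"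
      "(\<lambda>n. multiplier (p n) (L f)) \<longlonglongrightarrow> multiplier m (L f)"
    using multiplier_approximation[OF m] by blast
  show in_V: "multiplier m f \<in> V"
    using closed_sequentially[OF closed _ lim(1)] trig_multiplier_in[OF p f] by blast
  have "(\<lambda>n. L (multiplier (p n) f)) \<longlonglongrightarrow> L (multiplier m f)"
    by (rule L_tendsto[OF trig_multiplier_in[OF p f] in_V lim(1)])
  then have "(\<lambda>n. multiplier (p n) (L f)) \<longlonglongrightarrow> L (multiplier m f)"
    by (simp add: L_trig_multiplier[OF p f])
  then show "L (multiplier m f) = multiplier m (L f)"
    using lim(2) LIMSEQ_unique by blast
qed

lemma L_power_in: "f \<in> V \<Longrightarrow> (L ^^ j) f \<in> V"
  by (induction j) (auto intro: maps)

end

section \<open>Products of linear factors annihilating a vector\<close>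

text \<open>
  Gaussian elimination, one equation at a time.
\<close>

lemma homogeneous_system_nontrivial_solution:
  fixes a :: "'j \<Rightarrow> 's \<Rightarrow> 'f::field"
  assumes "finite S" "finite J" "card S < card J"
  shows "\<exists>c. (\<exists>j\<in>J. c j \<noteq> 0) \<and> (\<forall>s\<in>S. (\<Sum>j\<in>J. c j * a j s) = 0)"
  using assms
proof (induction S arbitrary: J a rule: finite_induct)
  case empty
  then obtain j where "j \<in> J"
    by (metis card_gt_0_iff equals0I card.empty)
  then show ?case
    by (intro exI[of _ "\<lambda>_. 1"]) auto
next
  case (insert s S)
  show ?case
  proof (cases "\<forall>j\<in>J. a j s = 0")
    case True
    obtain c where "\<exists>j\<in>J. c j \<noteq> 0" "\<forall>s\<in>S. (\<Sum>j\<in>J. c j * a j s) = 0"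
      using insert.IH[of J a] insert.prems insert.hyps by auto
    with True show ?thesis
      by (intro exI[of _ c]) (auto intro!: sum.neutral)
  next
    case False
    then obtain i where i: "i \<in> J" "a i s \<noteq> 0"
      by blast
    let ?J = "J - {i}"
    have "finite ?J" "card S < card ?J"
      using insert.prems insert.hyps i by (simp_all add: card_Diff_singleton)
    then obtain c where c: "\<exists>j\<in>?J. c j \<noteq> 0"
      "\<forall>t\<in>S. (\<Sum>j\<in>?J. c j * (a j t - a j s / a i s * a i t)) = 0"
      using insert.IH[of ?J "\<lambda>j t. a j t - a j s / a i s * a i t"] by blast
    define d where "d = (\<lambda>j. if j = i then - (\<Sum>j\<in>?J. c j * a j s) / a i s else c j)"
    have split: "(\<Sum>j\<in>J. d j * a j t) = d i * a i t + (\<Sum>j\<in>?J. c j * a j t)" for t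
      using i insert.prems by (subst sum.remove[of J i]) (auto simp: d_def intro!: sum.cong)
    have "(\<Sum>j\<in>J. d j * a j s) = 0"
      unfolding split using i by (simp add: d_def)
    moreover have "(\<Sum>j\<in>J. d j * a j t) = 0" if "t \<in> S" for t
    proof -
      have "(\<Sum>j\<in>?J. c j * (a j t - a j s / a i s * a i t))
          = (\<Sum>j\<in>?J. c j * a j t) - (\<Sum>j\<in>?J. c j * a j s) / a i s * a i t"
        by (simp add: right_diff_distrib sum_subtractf sum_distrib_right sum_divide_distrib mult.assoc)
      then show ?thesis
        unfolding split using c(2) that by (simp add: d_def)
    qed
    moreover have "\<exists>j\<in>J. d j \<noteq> 0"
      using c(1) by (auto simp: d_def)
    ultimately show ?thesis
      by blast
  qed
qed

lemma bounded_coordinates_convergent_subsequence: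
  fixes x :: "nat \<Rightarrow> nat \<Rightarrow> complex"
  assumes "\<And>i j. j < n \<Longrightarrow> cmod (x i j) \<le> C"
  shows "\<exists>r l. strict_mono r \<and> (\<forall>j<n. (\<lambda>i. x (r i) j) \<longlonglongrightarrow> l j \<and> cmod (l j) \<le> C)"
  using assms
proof (induction n)
  case 0
  show ?case
    using strict_mono_id by blast
next
  case (Suc n)
  then obtain r l where r: "strict_mono r" "\<And>j. j < n \<Longrightarrow> (\<lambda>i. x (r i) j) \<longlonglongrightarrow> l j"
      "\<And>j. j < n \<Longrightarrow> cmod (l j) \<le> C"
    by (metis less_SucI)
  have "bounded (range (\<lambda>i. x (r i) n))"
    using Suc.prems by (intro boundedI[of _ C]) auto
  then obtain s m where s: "strict_mono s" "(\<lambda>i. x (r (s i)) n) \<longlonglongrightarrow> m"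
    using bounded_imp_convergent_subsequence[of "\<lambda>i. x (r i) n"] by (auto simp: o_def)
  have "cmod m \<le> C"
    using tendsto_norm[OF s(2)] Suc.prems by (intro LIMSEQ_le_const2[of "\<lambda>i. cmod (x (r (s i)) n)"]) auto
  moreover have "(\<lambda>i. x (r (s i)) j) \<longlonglongrightarrow> l j" if "j < n" for j
    using LIMSEQ_subseq_LIMSEQ[OF r(2)[OF that] s(1)] by (simp add: o_def)
  ultimately show ?case
    using s r strict_mono_o[OF r(1) s(1), unfolded o_def]
    by (intro exI[of _ "r \<circ> s"] exI[of _ "l(n := m)"]) (auto simp: less_Suc_eq o_def)
qed

text \<open>
  A sequence \<open>h\<close> of vectors stands for the orbit of \<open>h 0\<close> under a linear map; \<open>poly_apply p h\<close> is
  then the value at \<open>h 0\<close> of the polynomial \<open>p\<close> in that map, and \<open>peel n z h j\<close> applies the factors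
  with roots \<open>z 0\<close>, \<dots>, \<open>z (n - 1)\<close> to \<open>h j\<close>.
\<close>

definition poly_apply :: "complex poly \<Rightarrow> (nat \<Rightarrow> 'k \<Rightarrow> complex) \<Rightarrow> 'k \<Rightarrow> complex" where
  "poly_apply p h k = (\<Sum>i\<le>degree p. coeff p i * h i k)"

primrec peel :: "nat \<Rightarrow> (nat \<Rightarrow> complex) \<Rightarrow> (nat \<Rightarrow> 'k \<Rightarrow> complex) \<Rightarrow> nat \<Rightarrow> 'k \<Rightarrow> complex" where
  "peel 0 z h = h"
| "peel (Suc n) z h = peel n (\<lambda>i. z (Suc i)) (\<lambda>j k. h (Suc j) k - z 0 * h j k)"

lemma poly_apply_atMost: "degree p \<le> n \<Longrightarrow> poly_apply p h k = (\<Sum>i\<le>n. coeff p i * h i k)"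
  unfolding poly_apply_def
  by (intro sum.mono_neutral_left) (auto simp: coeff_eq_0)

lemma poly_apply_add: "poly_apply (p + q) h k = poly_apply p h k + poly_apply q h k"
proof -
  let ?n = "max (degree p) (degree q)"
  have "degree (p + q) \<le> ?n" "degree p \<le> ?n" "degree q \<le> ?n"
    using degree_add_le_max by auto
  then show ?thesis
    by (simp only: poly_apply_atMost) (simp add: distrib_right sum.distrib)
qed

lemma poly_apply_smult: "poly_apply (smult c p) h k = c * poly_apply p h k"
  by (simp add: poly_apply_atMost[of "smult c p" "degree p"] poly_apply_def sum_distrib_left mult.assoc degree_smult_le)

lemma poly_apply_pCons0: "poly_apply (pCons 0 p) h = poly_apply p (\<lambda>j. h (Suc j))"
proof
  fix k
  have "poly_apply (pCons 0 p) h k = (\<Sum>i\<le>Suc (degree p). coeff (pCons 0 p) i * h i k)"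
    by (rule poly_apply_atMost) (simp add: degree_pCons_le)
  then show "poly_apply (pCons 0 p) h k = poly_apply p (\<lambda>j. h (Suc j)) k"
    by (simp add: sum.atMost_Suc_shift poly_apply_def del: sum.atMost_Suc)
qed

lemma poly_apply_linear_factor:
  "poly_apply ([:- r, 1:] * p) h k = poly_apply p (\<lambda>j. h (Suc j)) k - r * poly_apply p h k"
proof -
  have "[:- r, 1:] * p = smult (- r) p + pCons 0 p"
    by simp
  then show ?thesis
    by (simp only: poly_apply_add poly_apply_smult poly_apply_pCons0) simp
qed

lemma poly_apply_linear_factor':
  "poly_apply p (\<lambda>j k. h (Suc j) k - r * h j k) = poly_apply ([:- r, 1:] * p) h"
  unfolding poly_apply_linear_factor fun_eq_iff
  by (simp add: poly_apply_def right_diff_distrib sum_subtractf sum_distrib_left mult_ac)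

definition energy :: "('k \<Rightarrow> complex) \<Rightarrow> ennreal" where
  "energy v = (\<integral>\<^sup>+k. ennreal ((cmod (v k))\<^sup>2) \<partial>count_space UNIV)"

lemma energy_scale: "energy (\<lambda>k. c * v k) = ennreal ((cmod c)\<^sup>2) * energy v"
  unfolding energy_def
  by (simp add: norm_mult power_mult_distrib ennreal_mult nn_integral_cmult)

lemma energy_eq_0: "energy v = 0 \<longleftrightarrow> v = (\<lambda>_. 0)"
  by (auto simp: energy_def nn_integral_0_iff_AE AE_count_space fun_eq_iff)

text \<open>
  The map with orbit \<open>h\<close> is bounded by \<open>C\<close> on its cyclic subspace, all of whose vectors have finite
  energy.
\<close>

definition bounded_orbit :: "real \<Rightarrow> (nat \<Rightarrow> 'k \<Rightarrow> complex) \<Rightarrow> bool" where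
  "bounded_orbit C h \<longleftrightarrow> (\<forall>p. energy (poly_apply p h) < \<infinity> \<and>
     energy (poly_apply (pCons 0 p) h) \<le> ennreal (C\<^sup>2) * energy (poly_apply p h))"

lemma bounded_orbit_Suc:
  assumes "bounded_orbit C h"
  shows "bounded_orbit C (\<lambda>j. h (Suc j))"
  unfolding bounded_orbit_def
proof
  fix p
  show "energy (poly_apply p (\<lambda>j. h (Suc j))) < \<infinity> \<and> energy (poly_apply (pCons 0 p) (\<lambda>j. h (Suc j)))
      \<le> ennreal (C\<^sup>2) * energy (poly_apply p (\<lambda>j. h (Suc j)))"
    using assms[unfolded bounded_orbit_def, rule_format, of "pCons 0 p"] by (simp add: poly_apply_pCons0)
qed

lemma bounded_orbit_linear_factor:
  assumes "bounded_orbit C h"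
  shows "bounded_orbit C (\<lambda>j k. h (Suc j) k - r * h j k)"
proof -
  have "[:- r, 1:] * pCons 0 p = pCons 0 ([:- r, 1:] * p)" for p
    by simp
  then show ?thesis
    using assms unfolding bounded_orbit_def poly_apply_linear_factor' by metis
qed

lemma bounded_orbit_annihilator_Suc:
  assumes "bounded_orbit C h" "poly_apply p h = (\<lambda>_. 0)"
  shows "poly_apply p (\<lambda>j. h (Suc j)) = (\<lambda>_. 0)"
proof -
  have "energy (poly_apply (pCons 0 p) h) \<le> ennreal (C\<^sup>2) * energy (poly_apply p h)"
    using assms(1) by (simp add: bounded_orbit_def)
  also have "energy (poly_apply p h) = 0"
    by (simp add: energy_eq_0 assms(2))
  finally have "poly_apply (pCons 0 p) h = (\<lambda>_. 0)"
    by (simp add: energy_eq_0)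
  then show ?thesis
    by (simp add: poly_apply_pCons0)
qed

text \<open>
  Split off the roots of the annihilating polynomial one at a time.  A root of modulus greater than
  the norm bound is not an eigenvalue, so that the cofactor is annihilating as well; it is replaced
  by the root \<open>0\<close> in order to keep the number of factors.
\<close>

lemma annihilating_roots:
  assumes "bounded_orbit C h" "0 \<le> C" "p \<noteq> 0" "degree p \<le> n" "poly_apply p h = (\<lambda>_. 0)"
  shows "\<exists>z. (\<forall>i. cmod (z i) \<le> C) \<and> peel n z h 0 = (\<lambda>_. 0)"
  using assms
proof (induction n arbitrary: p h)
  case 0
  then obtain c where "p = [:c:]" "c \<noteq> 0"
    by (metis degree_eq_zeroE le_zero_eq pCons_eq_0_iff)
  then have "h 0 k = 0" for k
    using fun_cong[OF "0.prems"(5), of k] by (simp add: poly_apply_def)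
  then show ?case
    using \<open>0 \<le> C\<close> by (intro exI[of _ "\<lambda>_. 0"]) auto
next
  case (Suc n)
  have small: ?case if q: "q \<noteq> 0" "degree q \<le> n" "poly_apply q h = (\<lambda>_. 0)" for q
  proof -
    obtain z where z: "\<forall>i. cmod (z i) \<le> C" "peel n z (\<lambda>j. h (Suc j)) 0 = (\<lambda>_. 0)"
      using Suc.IH[OF bounded_orbit_Suc[OF Suc.prems(1)] \<open>0 \<le> C\<close> q(1,2)
          bounded_orbit_annihilator_Suc[OF Suc.prems(1) q(3)]] by blast
    then show ?thesis
      using \<open>0 \<le> C\<close> by (intro exI[of _ "case_nat 0 z"]) (auto split: nat.split)
  qed
  show ?case
  proof (cases "degree p \<le> n")
    case True
    then show ?thesis
      using small Suc.prems by blast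
  next
    case False
    then have deg: "degree p = Suc n"
      using Suc.prems(4) by simp
    then have "\<not> constant (poly p)"
      by (simp add: constant_degree)
    then obtain r where "poly p r = 0"
      using fundamental_theorem_of_algebra by blast
    then obtain q where q: "p = [:- r, 1:] * q"
      by (auto simp: poly_eq_0_iff_dvd)
    then have "q \<noteq> 0"
      using Suc.prems(3) by auto
    moreover from this have "degree p = degree [:- r, 1:] + degree q"
      unfolding q by (intro degree_mult_eq) auto
    ultimately have q': "q \<noteq> 0" "degree q = n"
      using deg by simp_all
    show ?thesis
    proof (cases "cmod r \<le> C")
      case True
      have "poly_apply q (\<lambda>j k. h (Suc j) k - r * h j k) = (\<lambda>_. 0)"
        using Suc.prems(5) by (simp only: poly_apply_linear_factor' q)
      then obtain z where z: "\<forall>i. cmod (z i) \<le> C" "peel n z (\<lambda>j k. h (Suc j) k - r * h j k) 0 = (\<lambda>_. 0)"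
        using Suc.IH[OF bounded_orbit_linear_factor[OF Suc.prems(1)] \<open>0 \<le> C\<close> q'(1)] q'(2) by blast
      then show ?thesis
        using True by (intro exI[of _ "case_nat r z"]) (auto split: nat.split)
    next
      case False
      have "poly_apply (pCons 0 q) h k = r * poly_apply q h k" for k
        using fun_cong[OF Suc.prems(5), of k] unfolding q poly_apply_linear_factor poly_apply_pCons0
        by simp
      then have "energy (poly_apply (pCons 0 q) h) = ennreal ((cmod r)\<^sup>2) * energy (poly_apply q h)"
        using energy_scale[of r "poly_apply q h"] by presburger
      then have le: "ennreal ((cmod r)\<^sup>2) * energy (poly_apply q h) \<le> ennreal (C\<^sup>2) * energy (poly_apply q h)"
        using Suc.prems(1) by (metis bounded_orbit_def)
      have fin: "energy (poly_apply q h) < \<infinity>"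
        using Suc.prems(1) by (simp add: bounded_orbit_def)
      have "energy (poly_apply q h) = 0"
      proof (rule ccontr)
        assume "energy (poly_apply q h) \<noteq> 0"
        then obtain e where e: "energy (poly_apply q h) = ennreal e" "e > 0"
          using fin by (cases "energy (poly_apply q h)") (auto simp: less_le)
        have "(cmod r)\<^sup>2 * e \<le> C\<^sup>2 * e"
          using le e by (simp add: ennreal_mult[symmetric])
        then have "(cmod r)\<^sup>2 \<le> C\<^sup>2"
          using e(2) by simp
        then show False
          using False \<open>0 \<le> C\<close> by (simp add: power2_le_iff_abs_le)
      qed
      then show ?thesis
        using small[OF q'(1)] q'(2) by (simp add: energy_eq_0)
    qed
  qed
qed

lemma peel_cong:
  fixes h :: "nat \<Rightarrow> 'c \<Rightarrow> complex"
  shows "(\<And>i. i < n \<Longrightarrow> z i = z' i) \<Longrightarrow> peel n z h = peel n z' h"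
proof (induction n arbitrary: z z' h)
  case (Suc n)
  have "z 0 = z' 0"
    by (rule Suc.prems) simp
  moreover have "peel n (\<lambda>i. z (Suc i)) f = peel n (\<lambda>i. z' (Suc i)) f" for f :: "nat \<Rightarrow> 'c \<Rightarrow> complex"
    by (rule Suc.IH) (simp add: Suc.prems)
  ultimately show ?case
    by (simp only: peel.simps)
qed simp

lemma borel_measurable_peel:
  assumes "\<And>j k. (\<lambda>\<omega>. h \<omega> j k) \<in> borel_measurable borel"
  shows "(\<lambda>\<omega>. peel n z (h \<omega>) j k) \<in> borel_measurable borel"
  using assms by (induction n arbitrary: z h) simp_all

lemma tendsto_peel:
  assumes "\<And>i. i < n \<Longrightarrow> (\<lambda>m. x m i) \<longlonglongrightarrow> z i" "\<And>j k. (\<lambda>m. h m j k) \<longlonglongrightarrow> h' j k"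
  shows "(\<lambda>m. peel n (x m) (h m) j k) \<longlonglongrightarrow> peel n z h' j k"
  using assms
proof (induction n arbitrary: x z h h')
  case (Suc n)
  show ?case
    unfolding peel.simps using Suc.prems by (intro Suc.IH tendsto_intros) auto
qed simp

section \<open>Measurable selection of roots\<close>

text \<open>
  Continuity refers to the first \<open>n\<close> coordinates of \<open>z\<close> only, which makes a function of \<open>n\<close> complex
  variables with variable \<open>n\<close>.
\<close>

definition caratheodory :: "nat \<Rightarrow> (nat \<Rightarrow> 'w::topological_space \<Rightarrow> (nat \<Rightarrow> complex) \<Rightarrow> complex) \<Rightarrow> bool" where
  "caratheodory n g \<longleftrightarrow> (\<forall>k z. (\<lambda>\<omega>. g k \<omega> z) \<in> borel_measurable borel) \<and>
     (\<forall>k \<omega> x l. (\<forall>j<n. (\<lambda>i. x i j) \<longlonglongrightarrow> l j) \<longrightarrow> (\<lambda>i. g k \<omega> (x i)) \<longlonglongrightarrow> g k \<omega> l)"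

definition zeros :: "nat \<Rightarrow> real \<Rightarrow> (nat \<Rightarrow> 'w \<Rightarrow> (nat \<Rightarrow> complex) \<Rightarrow> complex) \<Rightarrow> 'w \<Rightarrow> (nat \<Rightarrow> complex) set" where
  "zeros n C g \<omega> = {z. (\<forall>j<n. cmod (z j) \<le> C) \<and> (\<forall>k. g k \<omega> z = 0)}"

lemma caratheodoryD:
  assumes "caratheodory n g"
  shows "(\<lambda>\<omega>. g k \<omega> z) \<in> borel_measurable borel"
    and "(\<And>j. j < n \<Longrightarrow> (\<lambda>i. x i j) \<longlonglongrightarrow> l j) \<Longrightarrow> (\<lambda>i. g k \<omega> (x i)) \<longlonglongrightarrow> g k \<omega> l"
  using assms by (auto simp: caratheodory_def)

text \<open>
  A compactness argument: approximate common zeros accumulate at a common zero.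
\<close>

lemma zeros_closed:
  assumes g: "caratheodory n g" and x: "\<And>i. \<forall>j<n. cmod (x i j) \<le> C"
    and small: "\<And>i k. k \<le> i \<Longrightarrow> cmod (g k \<omega> (x i)) \<le> 1 / Suc i"
  shows "\<exists>r l. strict_mono r \<and> l \<in> zeros n C g \<omega> \<and> (\<forall>j<n. (\<lambda>i. x (r i) j) \<longlonglongrightarrow> l j)"
proof -
  obtain r l where r: "strict_mono r" and l: "\<And>j. j < n \<Longrightarrow> (\<lambda>i. x (r i) j) \<longlonglongrightarrow> l j"
      "\<And>j. j < n \<Longrightarrow> cmod (l j) \<le> C"
    using bounded_coordinates_convergent_subsequence[of n x C] x by blast
  have "g k \<omega> l = 0" for k
  proof -
    have "(\<lambda>i. g k \<omega> (x (r i))) \<longlonglongrightarrow> g k \<omega> l"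
      by (rule caratheodoryD(2)[OF g l(1)])
    moreover have "(\<lambda>i. g k \<omega> (x (r i))) \<longlonglongrightarrow> 0"
    proof (rule Lim_null_comparison[OF _ LIMSEQ_inverse_real_of_nat])
      show "\<forall>\<^sub>F i in sequentially. norm (g k \<omega> (x (r i))) \<le> inverse (real (Suc i))"
        using eventually_ge_at_top[of k]
      proof eventually_elim
        case (elim i)
        have "i \<le> r i"
          using r by (rule seq_suble)
        then have "cmod (g k \<omega> (x (r i))) \<le> 1 / Suc (r i)"
          using elim by (intro small) simp
        also have "\<dots> \<le> inverse (real (Suc i))"
          using \<open>i \<le> r i\<close> by (simp add: field_simps)
        finally show ?case .
      qed
    qed
    ultimately show ?thesis
      by (rule LIMSEQ_unique)
  qed
  then show ?thesis
    using r l by (auto simp: zeros_def)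
qed

lemma countable_dense_coordinates:
  fixes n :: nat and C :: real
  shows "\<exists>D. countable D \<and> (\<forall>z\<in>D. \<forall>j<n. cmod (z j) \<le> C) \<and>
     (\<forall>z. (\<forall>j<n. cmod (z j) \<le> C) \<longrightarrow> (\<exists>x. (\<forall>i. x i \<in> D) \<and> (\<forall>j<n. (\<lambda>i. x i j) \<longlonglongrightarrow> z j)))"
proof -
  obtain T where T: "countable T" "T \<subseteq> cball (0 :: complex) C" "cball 0 C \<subseteq> closure T"
    using separable by metis
  define D where "D = (\<lambda>xs i. if i < length xs then xs ! i else 0) ` {xs \<in> lists T. length xs = n}"
  have "countable D"
    unfolding D_def using T(1) by (intro countable_image countable_subset[OF _ countable_lists]) auto
  moreover have "\<forall>z\<in>D. \<forall>j<n. cmod (z j) \<le> C"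
    using T(2) by (force simp: D_def in_lists_conv_set)
  moreover have "\<exists>x. (\<forall>i. x i \<in> D) \<and> (\<forall>j<n. (\<lambda>i. x i j) \<longlonglongrightarrow> z j)" if z: "\<forall>j<n. cmod (z j) \<le> C" for z
  proof -
    have "\<exists>t. (\<forall>i. t i \<in> T) \<and> t \<longlonglongrightarrow> z j" if "j < n" for j
      using T(3) z that by (auto simp: closure_sequential[symmetric])
    then obtain t where t: "\<And>j i. j < n \<Longrightarrow> t j i \<in> T" "\<And>j. j < n \<Longrightarrow> t j \<longlonglongrightarrow> z j"
      by metis
    define x where "x = (\<lambda>i j. if j < n then t j i else 0)"
    have "x i \<in> D" for i
      unfolding D_def x_def using t(1)
      by (intro image_eqI[of _ _ "map (\<lambda>j. t j i) [0..<n]"]) (auto simp: fun_eq_iff)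
    moreover have "(\<lambda>i. x i j) \<longlonglongrightarrow> z j" if "j < n" for j
      using t(2) that by (simp add: x_def)
    ultimately show ?thesis
      by blast
  qed
  ultimately show ?thesis
    by blast
qed

text \<open>
  By compactness, a common zero exists if and only if points of a countable dense set satisfy
  finitely many of the equations to any given accuracy.
\<close>

lemma sets_zeros_nonempty:
  fixes g :: "nat \<Rightarrow> 'w::topological_space \<Rightarrow> (nat \<Rightarrow> complex) \<Rightarrow> complex"
  assumes g: "caratheodory n g"
  shows "{\<omega>. zeros n C g \<omega> \<noteq> {}} \<in> sets borel"
proof -
  obtain D where D: "countable D" "\<And>z. z \<in> D \<Longrightarrow> \<forall>j<n. cmod (z j) \<le> C"
    "\<And>z. (\<forall>j<n. cmod (z j) \<le> C) \<Longrightarrow> \<exists>x. (\<forall>i. x i \<in> D) \<and> (\<forall>j<n. (\<lambda>i. x i j) \<longlonglongrightarrow> z j)"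
    using countable_dense_coordinates[of n C] by metis
  have "zeros n C g \<omega> \<noteq> {} \<longleftrightarrow> (\<forall>i. \<exists>z\<in>D. \<forall>k\<in>{..i}. cmod (g k \<omega> z) \<le> 1 / Suc i)" for \<omega>
  proof
    assume "zeros n C g \<omega> \<noteq> {}"
    then obtain z where z: "\<forall>j<n. cmod (z j) \<le> C" "\<And>k. g k \<omega> z = 0"
      by (auto simp: zeros_def)
    obtain x where x: "\<And>i. x i \<in> D" "\<And>j. j < n \<Longrightarrow> (\<lambda>i. x i j) \<longlonglongrightarrow> z j"
      using D(3)[OF z(1)] by metis
    show "\<forall>i. \<exists>z\<in>D. \<forall>k\<in>{..i}. cmod (g k \<omega> z) \<le> 1 / Suc i"
    proof
      fix i
      have "\<forall>\<^sub>F m in sequentially. \<forall>k\<in>{..i}. cmod (g k \<omega> (x m)) < 1 / Suc i"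
      proof (rule eventually_ball_finite)
        show "\<forall>k\<in>{..i}. \<forall>\<^sub>F m in sequentially. cmod (g k \<omega> (x m)) < 1 / Suc i"
        proof
          fix k
          have "(\<lambda>m. cmod (g k \<omega> (x m))) \<longlonglongrightarrow> cmod (g k \<omega> z)"
            by (intro tendsto_norm caratheodoryD(2)[OF g x(2)])
          then show "\<forall>\<^sub>F m in sequentially. cmod (g k \<omega> (x m)) < 1 / Suc i"
            by (rule order_tendstoD(2)) (simp add: z(2))
        qed
      qed simp
      then obtain m where "\<forall>k\<in>{..i}. cmod (g k \<omega> (x m)) < 1 / Suc i"
        using eventually_happens' sequentially_bot by blast
      then show "\<exists>z\<in>D. \<forall>k\<in>{..i}. cmod (g k \<omega> z) \<le> 1 / Suc i"
        using x(1)[of m] less_imp_le by blast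
    qed
  next
    assume "\<forall>i. \<exists>z\<in>D. \<forall>k\<in>{..i}. cmod (g k \<omega> z) \<le> 1 / Suc i"
    then obtain x where "\<And>i. x i \<in> D" "\<And>i. \<forall>k\<in>{..i}. cmod (g k \<omega> (x i)) \<le> 1 / Suc i"
      by metis
    then show "zeros n C g \<omega> \<noteq> {}"
      using zeros_closed[OF g, of x C \<omega>] D(2) by auto
  qed
  moreover have "{\<omega>. \<forall>i. \<exists>z\<in>D. \<forall>k\<in>{..i}. cmod (g k \<omega> z) \<le> 1 / Suc i} \<in> sets borel"
  proof -
    have [measurable]: "(\<lambda>\<omega>. g k \<omega> z) \<in> borel_measurable borel" for k z
      by (rule caratheodoryD(1)[OF g])
    have "{\<omega>. \<forall>i. \<exists>z\<in>D. \<forall>k\<in>{..i}. cmod (g k \<omega> z) \<le> 1 / Suc i}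
        = (\<Inter>i. \<Union>z\<in>D. \<Inter>k\<in>{..i}. {\<omega>. cmod (g k \<omega> z) \<le> 1 / Suc i})"
      by auto
    also have "\<dots> \<in> sets borel"
      using D(1) by (intro sets.countable_INT'' sets.countable_UN' sets.finite_INT) auto
    finally show ?thesis .
  qed
  ultimately show ?thesis
    by simp
qed

text \<open>
  The least value over the zero set of a continuous function of \<open>z\<close> is measurable, because it is at
  most \<open>t\<close> exactly where the zero set stays nonempty under one more equation.  The minimisers are
  again the zeros of such a family; doing this for the real and imaginary parts of all the
  coordinates in turn determines a single zero.
\<close>

lemma measurable_minimum:
  fixes g :: "nat \<Rightarrow> 'w::topological_space \<Rightarrow> (nat \<Rightarrow> complex) \<Rightarrow> complex" and \<rho> :: "(nat \<Rightarrow> complex) \<Rightarrow> real"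
  assumes g: "caratheodory n g"
    and \<rho>: "\<And>x l. (\<And>j. j < n \<Longrightarrow> (\<lambda>i. x i j) \<longlonglongrightarrow> l j) \<Longrightarrow> (\<lambda>i. \<rho> (x i)) \<longlonglongrightarrow> \<rho> l"
  shows "\<exists>r \<in> borel_measurable borel. \<forall>\<omega>. zeros n C g \<omega> \<noteq> {} \<longrightarrow> (\<exists>z\<in>zeros n C g \<omega>. \<rho> z = r \<omega>)"
proof -
  define r where "r = (\<lambda>\<omega>. if zeros n C g \<omega> \<noteq> {} then Inf (\<rho> ` zeros n C g \<omega>) else 0)"
  have least: "\<exists>z\<in>zeros n C g \<omega>. \<rho> z = r \<omega> \<and> (\<forall>z'\<in>zeros n C g \<omega>. \<rho> z \<le> \<rho> z')"
    if ne: "zeros n C g \<omega> \<noteq> {}" for \<omega>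
  proof -
    have limit: "\<exists>(s :: nat \<Rightarrow> nat) l. strict_mono s \<and> l \<in> zeros n C g \<omega> \<and> (\<lambda>i. \<rho> (x (s i))) \<longlonglongrightarrow> \<rho> l"
      if "\<And>i. x i \<in> zeros n C g \<omega>" for x :: "nat \<Rightarrow> nat \<Rightarrow> complex"
    proof -
      have "\<exists>s l. strict_mono s \<and> l \<in> zeros n C g \<omega> \<and> (\<forall>j<n. (\<lambda>i. x (s i) j) \<longlonglongrightarrow> l j)"
        by (rule zeros_closed[OF g, of x C \<omega>]) (use that in \<open>auto simp: zeros_def\<close>)
      then show ?thesis
        using \<rho> by metis
    qed
    have bdd: "bdd_below (\<rho> ` zeros n C g \<omega>)"
    proof (rule ccontr)
      assume nb: "\<not> bdd_below (\<rho> ` zeros n C g \<omega>)"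
      have "\<exists>z\<in>zeros n C g \<omega>. \<rho> z < - real i" for i
        using nb unfolding bdd_below_def by (metis image_iff not_le)
      then obtain x where x: "\<And>i. x i \<in> zeros n C g \<omega>" "\<And>i. \<rho> (x i) < - real i"
        by metis
      obtain s l where s: "strict_mono s" "(\<lambda>i. \<rho> (x (s i))) \<longlonglongrightarrow> \<rho> l"
        using limit[of x, OF x(1)] by blast
      obtain B where B: "\<And>i. \<bar>\<rho> (x (s i))\<bar> \<le> B"
        using convergent_imp_Bseq[of "\<lambda>i. \<rho> (x (s i))"] s(2) by (auto simp: convergent_def Bseq_def)
      obtain i where "B < real i"
        using reals_Archimedean2 by blast
      then show False
        using B[of i] x(2)[of "s i"] seq_suble[OF s(1), of i] by linarith
    qed
    have "\<exists>z\<in>zeros n C g \<omega>. \<rho> z < r \<omega> + 1 / Suc i" for i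
      using cINF_less_iff[OF ne bdd, of "r \<omega> + 1 / Suc i"] ne by (simp add: r_def)
    then obtain x where x: "\<And>i. x i \<in> zeros n C g \<omega>" "\<And>i. \<rho> (x i) < r \<omega> + 1 / Suc i"
      by metis
    obtain s l where s: "strict_mono s" "l \<in> zeros n C g \<omega>" "(\<lambda>i. \<rho> (x (s i))) \<longlonglongrightarrow> \<rho> l"
      using limit[of x, OF x(1)] by blast
    have ge: "r \<omega> \<le> \<rho> z" if "z \<in> zeros n C g \<omega>" for z
      using that ne bdd by (simp add: r_def cINF_lower)
    have "(\<lambda>i. r \<omega> + inverse (real (Suc i))) \<longlonglongrightarrow> r \<omega> + 0"
      by (intro tendsto_intros LIMSEQ_inverse_real_of_nat)
    from LIMSEQ_subseq_LIMSEQ[OF this s(1)]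
    have "(\<lambda>i. r \<omega> + inverse (real (Suc (s i)))) \<longlonglongrightarrow> r \<omega> + 0"
      by (simp add: o_def)
    with s(3) have "\<rho> l \<le> r \<omega> + 0"
      by (rule LIMSEQ_le) (use x(2) in \<open>auto simp: inverse_eq_divide intro!: exI[of _ 0] less_imp_le\<close>)
    then have "\<rho> l = r \<omega>"
      using ge[OF s(2)] by simp
    with s(2) ge show ?thesis
      by metis
  qed
  have "r \<in> borel_measurable borel"
  proof (rule borel_measurableI_le)
    fix t :: real
    let ?g = "\<lambda>k \<omega> z. case k of 0 \<Rightarrow> complex_of_real (max 0 (\<rho> z - t)) | Suc k \<Rightarrow> g k \<omega> z"
    have "caratheodory n ?g"
      unfolding caratheodory_def
    proof (intro conjI allI impI)
      show "(\<lambda>\<omega>. ?g k \<omega> z) \<in> borel_measurable borel" for k z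
        using caratheodoryD(1)[OF g] by (cases k) auto
      show "(\<lambda>i. ?g k \<omega> (x i)) \<longlonglongrightarrow> ?g k \<omega> l" if "\<forall>j<n. (\<lambda>i. x i j) \<longlonglongrightarrow> l j" for k \<omega> x l
      proof (cases k)
        case 0
        then show ?thesis
          using \<rho> that by (auto intro!: tendsto_intros)
      next
        case (Suc k)
        then show ?thesis
          using caratheodoryD(2)[OF g] that by auto
      qed
    qed
    from sets_zeros_nonempty[OF this, of C] sets_zeros_nonempty[OF g, of C]
    have [measurable]: "{\<omega>. zeros n C ?g \<omega> \<noteq> {}} \<in> sets borel" "{\<omega>. zeros n C g \<omega> \<noteq> {}} \<in> sets borel"
      by simp_all
    have z: "zeros n C ?g \<omega> = {z \<in> zeros n C g \<omega>. \<rho> z \<le> t}" for \<omega>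
    proof -
      have "(\<forall>k. ?g k \<omega> z = 0) \<longleftrightarrow> \<rho> z \<le> t \<and> (\<forall>k. g k \<omega> z = 0)" for z
      proof
        assume h: "\<forall>k. ?g k \<omega> z = 0"
        then show "\<rho> z \<le> t \<and> (\<forall>k. g k \<omega> z = 0)"
          using h[rule_format, of 0] h[rule_format, of "Suc _"] by (auto simp: max_def split: if_splits)
      qed (auto split: nat.split)
      then show ?thesis
        by (auto simp: zeros_def)
    qed
    have "{\<omega> \<in> space borel. r \<omega> \<le> t} = {\<omega>. zeros n C ?g \<omega> \<noteq> {}} \<union> (if 0 \<le> t then - {\<omega>. zeros n C g \<omega> \<noteq> {}} else {})"
    proof -
      have "r \<omega> \<le> t \<longleftrightarrow> zeros n C ?g \<omega> \<noteq> {} \<or> (0 \<le> t \<and> zeros n C g \<omega> = {})" for \<omega>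
      proof (cases "zeros n C g \<omega> = {}")
        case True
        then show ?thesis
          unfolding z by (simp add: r_def)
      next
        case False
        then show ?thesis
          unfolding z using least[OF False] by (auto intro: order_trans)
      qed
      then show ?thesis
        by auto
    qed
    also have "\<dots> \<in> sets borel"
      by auto
    finally show "{\<omega> \<in> space borel. r \<omega> \<le> t} \<in> sets borel" .
  qed
  then show ?thesis
    using least by blast
qed

lemma measurable_successive_minima:
  fixes g :: "nat \<Rightarrow> 'w::topological_space \<Rightarrow> (nat \<Rightarrow> complex) \<Rightarrow> complex"
    and \<rho> :: "nat \<Rightarrow> (nat \<Rightarrow> complex) \<Rightarrow> real"
  assumes g: "caratheodory n g"
    and \<rho>: "\<And>m x l. m < N \<Longrightarrow> (\<And>j. j < n \<Longrightarrow> (\<lambda>i. x i j) \<longlonglongrightarrow> l j) \<Longrightarrow> (\<lambda>i. \<rho> m (x i)) \<longlonglongrightarrow> \<rho> m l"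
  shows "\<exists>r. (\<forall>m<N. r m \<in> borel_measurable borel) \<and>
    (\<forall>\<omega>. zeros n C g \<omega> \<noteq> {} \<longrightarrow> (\<exists>z\<in>zeros n C g \<omega>. \<forall>m<N. \<rho> m z = r m \<omega>))"
  using \<rho>
proof (induction N)
  case 0
  then show ?case by auto
next
  case (Suc N)
  obtain r where r: "\<And>m. m < N \<Longrightarrow> r m \<in> borel_measurable borel"
    "\<And>\<omega>. zeros n C g \<omega> \<noteq> {} \<Longrightarrow> \<exists>z\<in>zeros n C g \<omega>. \<forall>m<N. \<rho> m z = r m \<omega>"
    using Suc.IH Suc.prems by (metis less_SucI)
  \<comment> \<open>the first \<open>N\<close> functions confine the zeros to the minimisers found so far\<close>
  define f where "f = (\<lambda>k \<omega> z. if k < N then complex_of_real (\<rho> k z - r k \<omega>) else g (k - N) \<omega> z)"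
  have "caratheodory n f"
    unfolding caratheodory_def
  proof (intro conjI allI impI)
    show "(\<lambda>\<omega>. f k \<omega> z) \<in> borel_measurable borel" for k z
      using caratheodoryD(1)[OF g] r(1)[of k] by (cases "k < N") (auto simp: f_def)
    show "(\<lambda>i. f k \<omega> (x i)) \<longlonglongrightarrow> f k \<omega> l" if "\<forall>j<n. (\<lambda>i. x i j) \<longlonglongrightarrow> l j" for k \<omega> x l
    proof (cases "k < N")
      case True
      then show ?thesis
        using Suc.prems[of k x l] that by (auto simp: f_def intro!: tendsto_intros)
    next
      case False
      then show ?thesis
        using caratheodoryD(2)[OF g] that by (auto simp: f_def)
    qed
  qed
  from measurable_minimum[OF this, of "\<rho> N" C] obtain s where
    s: "s \<in> borel_measurable borel" "\<And>\<omega>. zeros n C f \<omega> \<noteq> {} \<Longrightarrow> \<exists>z\<in>zeros n C f \<omega>. \<rho> N z = s \<omega>"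
    using Suc.prems[of N] by auto
  have f: "zeros n C f \<omega> = {z \<in> zeros n C g \<omega>. \<forall>m<N. \<rho> m z = r m \<omega>}" for \<omega>
  proof -
    have "(\<forall>k. f k \<omega> z = 0) \<longleftrightarrow> (\<forall>k. g k \<omega> z = 0) \<and> (\<forall>m<N. \<rho> m z = r m \<omega>)" for z
    proof
      assume h: "\<forall>k. f k \<omega> z = 0"
      then show "(\<forall>k. g k \<omega> z = 0) \<and> (\<forall>m<N. \<rho> m z = r m \<omega>)"
      proof (intro conjI allI impI)
        show "g k \<omega> z = 0" for k
          using h[rule_format, of "k + N"] by (simp add: f_def)
        show "\<rho> m z = r m \<omega>" if "m < N" for m
          using h[rule_format, of m] that by (simp add: f_def flip: of_real_diff)
      qed
    qed (simp add: f_def)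
    then show ?thesis
      by (auto simp: zeros_def)
  qed
  show ?case
  proof (intro exI[of _ "r(N := s)"] conjI allI impI)
    show "m < Suc N \<Longrightarrow> (r(N := s)) m \<in> borel_measurable borel" for m
      using r(1) s(1) by (auto simp: less_Suc_eq)
    fix \<omega> assume "zeros n C g \<omega> \<noteq> {}"
    then have "zeros n C f \<omega> \<noteq> {}"
      using r(2) by (auto simp: f)
    then obtain z where "z \<in> zeros n C f \<omega>" "\<rho> N z = s \<omega>"
      using s(2) by blast
    then show "\<exists>z\<in>zeros n C g \<omega>. \<forall>m<Suc N. \<rho> m z = (r(N := s)) m \<omega>"
      by (intro bexI[of _ z]) (auto simp: f less_Suc_eq)
  qed
qed

theorem measurable_selection_of_zeros:
  fixes g :: "nat \<Rightarrow> 'w::topological_space \<Rightarrow> (nat \<Rightarrow> complex) \<Rightarrow> complex"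
  assumes g: "caratheodory n g" and "0 \<le> C"
  shows "\<exists>\<zeta>. (\<forall>j. \<zeta> j \<in> borel_measurable borel) \<and> (\<forall>j \<omega>. cmod (\<zeta> j \<omega>) \<le> C) \<and>
    (\<forall>\<omega>. zeros n C g \<omega> \<noteq> {} \<longrightarrow> (\<lambda>j. \<zeta> j \<omega>) \<in> zeros n C g \<omega>)"
proof -
  define \<rho> where "\<rho> = (\<lambda>(m :: nat) (z :: nat \<Rightarrow> complex). if even m then Re (z (m div 2)) else Im (z (m div 2) :: complex))"
  have "\<exists>r. (\<forall>m<2*n. r m \<in> borel_measurable borel) \<and>
    (\<forall>\<omega>. zeros n C g \<omega> \<noteq> {} \<longrightarrow> (\<exists>z\<in>zeros n C g \<omega>. \<forall>m<2*n. \<rho> m z = r m \<omega>))"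
    by (rule measurable_successive_minima[OF g]) (auto simp: \<rho>_def intro!: tendsto_intros)
  then obtain r where r: "\<And>m. m < 2*n \<Longrightarrow> r m \<in> borel_measurable borel"
    "\<And>\<omega>. zeros n C g \<omega> \<noteq> {} \<Longrightarrow> \<exists>z\<in>zeros n C g \<omega>. \<forall>m<2*n. \<rho> m z = r m \<omega>"
    by blast
  define \<zeta> where "\<zeta> = (\<lambda>j \<omega>. if zeros n C g \<omega> \<noteq> {} \<and> j < n then Complex (r (2*j) \<omega>) (r (2*j+1) \<omega>) else 0)"
  have \<zeta>: "\<exists>z\<in>zeros n C g \<omega>. \<forall>j<n. \<zeta> j \<omega> = z j" if "zeros n C g \<omega> \<noteq> {}" for \<omega>
  proof -
    obtain z where z: "z \<in> zeros n C g \<omega>" "\<forall>m<2*n. \<rho> m z = r m \<omega>"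
      using r(2) \<open>zeros n C g \<omega> \<noteq> {}\<close> by blast
    have "\<zeta> j \<omega> = z j" if "j < n" for j
      using z(2)[rule_format, of "2*j"] z(2)[rule_format, of "2*j+1"] that \<open>zeros n C g \<omega> \<noteq> {}\<close>
      by (simp add: \<rho>_def \<zeta>_def complex_eq_iff)
    then show ?thesis
      using z(1) by blast
  qed
  have "\<zeta> j \<in> borel_measurable borel" for j
  proof (cases "j < n")
    case True
    then have [measurable]: "r (2*j) \<in> borel_measurable borel" "r (2*j+1) \<in> borel_measurable borel"
      by (auto intro!: r(1))
    have [measurable]: "Measurable.pred borel (\<lambda>\<omega>. zeros n C g \<omega> \<noteq> {})"
      using sets_zeros_nonempty[OF g, of C] by (simp add: pred_def)
    have "\<zeta> j = (\<lambda>\<omega>. if zeros n C g \<omega> \<noteq> {} then complex_of_real (r (2*j) \<omega>) + \<i> * complex_of_real (r (2*j+1) \<omega>) else 0)"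
      using True by (auto simp: \<zeta>_def fun_eq_iff complex_eq_iff)
    then show ?thesis
      by simp
  next
    case False
    then have "\<zeta> j = (\<lambda>_. 0)"
      by (simp add: \<zeta>_def fun_eq_iff)
    then show ?thesis
      by simp
  qed
  moreover have "cmod (\<zeta> j \<omega>) \<le> C" for j \<omega>
  proof (cases "zeros n C g \<omega> \<noteq> {} \<and> j < n")
    case True
    then show ?thesis
      using \<zeta>[of \<omega>] by (auto simp: zeros_def)
  next
    case False
    then have "\<zeta> j \<omega> = 0"
      by (auto simp: \<zeta>_def)
    then show ?thesis
      using \<open>0 \<le> C\<close> by simp
  qed
  moreover have "(\<lambda>j. \<zeta> j \<omega>) \<in> zeros n C g \<omega>" if "zeros n C g \<omega> \<noteq> {}" for \<omega>
  proof -
    obtain z where z: "z \<in> zeros n C g \<omega>" "\<And>j. j < n \<Longrightarrow> \<zeta> j \<omega> = z j"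
      using \<zeta>[OF \<open>zeros n C g \<omega> \<noteq> {}\<close>] by blast
    have "g k \<omega> (\<lambda>j. \<zeta> j \<omega>) = g k \<omega> z" for k
    proof -
      have "(\<lambda>i :: nat. g k \<omega> z) \<longlonglongrightarrow> g k \<omega> (\<lambda>j. \<zeta> j \<omega>)"
        by (rule caratheodoryD(2)[OF g]) (simp add: z(2))
      then show ?thesis
        using LIMSEQ_unique tendsto_const by blast
    qed
    then show ?thesis
      using z by (simp add: zeros_def)
  qed
  ultimately show ?thesis
    by blast
qed

section \<open>Fibers\<close>

lemma AE_translates:
  assumes "AE \<omega> in lborel. P \<omega>"
  shows "AE \<omega> in lborel. \<forall>k. P (\<omega> + of_int_vec k)"
proof (subst AE_all_countable, rule allI)
  fix k show "AE \<omega> in lborel. P (\<omega> + of_int_vec k)"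
    using AE_lborel_translate[OF assms, of "- of_int_vec k"] by simp
qed

lemma fiberization_add: "AE \<omega> in lborel. \<forall>k. fiberization (f + g) \<omega> k = fiberization f \<omega> k + fiberization g \<omega> k"
  unfolding fiberization_def fourier_L2_add by (rule AE_translates[OF rep_L2_add])

lemma fiberization_diff: "AE \<omega> in lborel. \<forall>k. fiberization (f - g) \<omega> k = fiberization f \<omega> k - fiberization g \<omega> k"
  unfolding fiberization_def fourier_L2_diff by (rule AE_translates[OF rep_L2_diff])

lemma fiberization_scaleC: "AE \<omega> in lborel. \<forall>k. fiberization (c *\<^sub>C f) \<omega> k = c * fiberization f \<omega> k"
  unfolding fiberization_def fourier_L2_scaleC by (rule AE_translates[OF rep_L2_scaleC])

lemma fiberization_multiplier:
  assumes "periodic_multiplier m"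
  shows "AE \<omega> in lborel. \<forall>k. fiberization (multiplier m f) \<omega> k = m \<omega> * fiberization f \<omega> k"
  using AE_translates[OF rep_fourier_multiplier[OF assms, of f]]
  unfolding fiberization_def periodic_multiplierD(3)[OF assms] .

lemma fiberization_diff_multiplier:
  assumes "periodic_multiplier m"
  shows "AE \<omega> in lborel. \<forall>k. fiberization (f - multiplier m g) \<omega> k = fiberization f \<omega> k - m \<omega> * fiberization g \<omega> k"
  using fiberization_diff[of f "multiplier m g"] fiberization_multiplier[OF assms, of g]
  by eventually_elim simp

lemma fiberization_zero: "AE \<omega> in lborel. \<forall>k. fiberization 0 \<omega> k = 0"
  using fiberization_scaleC[of 0 0] by simp

lemma fiberization_sum:
  assumes "finite I"
  shows "AE \<omega> in lborel. \<forall>k. fiberization (\<Sum>i\<in>I. c i *\<^sub>C f i) \<omega> k = (\<Sum>i\<in>I. c i * fiberization (f i) \<omega> k)"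
  using assms
proof (induction I rule: finite_induct)
  case empty
  then show ?case
    using fiberization_zero by simp
next
  case (insert i I)
  show ?case
    using insert.IH fiberization_add[of "c i *\<^sub>C f i" "\<Sum>i\<in>I. c i *\<^sub>C f i"] fiberization_scaleC[of "c i" "f i"]
    by eventually_elim (simp add: insert.hyps)
qed

lemma eq_0_of_fiberization:
  assumes "AE \<omega> in lborel. \<omega> \<in> unit_cube \<longrightarrow> (\<forall>k. fiberization f \<omega> k = 0)"
  shows "f = 0"
proof -
  have "AE \<omega> in lborel. rep_L2 (fourier_L2 f) \<omega> = 0"
    using assms unfolding fiberization_def by (subst AE_cube_iff)
  then have "fourier_L2 f = 0"
    using rep_L2_zero by (intro L2_eqI) (auto elim: eventually_elim2)
  then show ?thesis
    using norm_fourier_L2[of f] by simp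
qed

lemma borel_measurable_fiberization [measurable]: "(\<lambda>\<omega>. fiberization f \<omega> k) \<in> borel_measurable borel"
  unfolding fiberization_def by measurable

lemma borel_measurable_energy_fiberization [measurable]:
  "(\<lambda>\<omega>. energy (fiberization f \<omega>)) \<in> borel_measurable borel"
proof -
  interpret sigma_finite_measure "count_space (UNIV :: (int ^ 'a) set)"
    by (rule sigma_finite_measure_count_space_countable) simp
  have "(\<lambda>x. ennreal ((cmod (fiberization f (snd x) (fst x)))\<^sup>2))
      \<in> borel_measurable (count_space UNIV \<Otimes>\<^sub>M borel)"
    by (rule measurable_pair_measure_countable1) auto
  then have "(\<lambda>(\<omega>, k). ennreal ((cmod (fiberization f \<omega> k))\<^sup>2)) \<in> borel_measurable (borel \<Otimes>\<^sub>M count_space UNIV)"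
    by (subst measurable_pair_swap_iff) (simp add: case_prod_beta)
  then show ?thesis
    unfolding energy_def by (rule borel_measurable_nn_integral)
qed

lemma energy_fiberization_periodic: "energy (fiberization f (\<omega> + of_int_vec l)) = energy (fiberization f \<omega>)"
proof -
  have "energy (fiberization f (\<omega> + of_int_vec l)) = (\<integral>\<^sup>+k. ennreal ((cmod (fiberization f \<omega> (l + k)))\<^sup>2) \<partial>count_space UNIV)"
    by (simp add: energy_def fiberization_def of_int_vec_add add.assoc)
  also have "\<dots> = energy (fiberization f \<omega>)"
    unfolding energy_def by (rule nn_integral_bij_count_space) (simp add: bij_plus_right)
  finally show ?thesis .
qed

lemma nn_integral_energy_fiberization:
  "(\<integral>\<^sup>+\<omega>. indicator unit_cube \<omega> * energy (fiberization f \<omega>) \<partial>lborel) = ennreal ((norm f)\<^sup>2)"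
proof -
  have "ennreal ((norm f)\<^sup>2) = (\<integral>\<^sup>+\<omega>. ennreal ((cmod (rep_L2 (fourier_L2 f) \<omega>))\<^sup>2) \<partial>lborel)"
    using ennreal_norm_L2_sq[of "fourier_L2 f"] by simp
  also have "\<dots> = (\<integral>\<^sup>+\<omega>. indicator unit_cube \<omega> * energy (fiberization f \<omega>) \<partial>lborel)"
    by (subst nn_integral_tiling) (auto simp: energy_def fiberization_def)
  finally show ?thesis ..
qed

lemma energy_fiberization_finite: "AE \<omega> in lborel. \<omega> \<in> unit_cube \<longrightarrow> energy (fiberization f \<omega>) < \<infinity>"
proof -
  have "AE \<omega> in lborel. indicator unit_cube \<omega> * energy (fiberization f \<omega>) \<noteq> \<infinity>"
    by (rule nn_integral_PInf_AE) (auto simp: nn_integral_energy_fiberization)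
  then show ?thesis
    by eventually_elim (auto simp: less_top)
qed

subsection \<open>The operators on the fibers are uniformly bounded\<close>

text \<open>
  Test the norm bound of \<open>L\<close> on \<open>f\<close> restricted, on the Fourier side, to the periodic set where
  the pointwise bound fails.
\<close>

lemma (in shift_preserving_operator) fiber_bound:
  assumes f: "f \<in> V" and C: "0 \<le> C" "\<And>f. f \<in> V \<Longrightarrow> norm (L f) \<le> C * norm f"
  shows "AE \<omega> in lborel. \<omega> \<in> unit_cube \<longrightarrow>
    energy (fiberization (L f) \<omega>) \<le> ennreal (C\<^sup>2) * energy (fiberization f \<omega>)"
proof -
  define E where "E = {\<omega>. ennreal (C\<^sup>2) * energy (fiberization f \<omega>) < energy (fiberization (L f) \<omega>)}"
  have E [measurable]: "E \<in> sets borel"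
    unfolding E_def by measurable
  define m where "m = (\<lambda>\<omega>. indicator E \<omega> :: complex)"
  have m: "periodic_multiplier m"
    unfolding periodic_multiplier_def m_def
    by (auto simp: E_def indicator_def energy_fiberization_periodic intro!: exI[of _ 1])
  have norm_m: "ennreal ((norm (multiplier m g))\<^sup>2)
      = (\<integral>\<^sup>+\<omega>. indicator unit_cube \<omega> * (indicator E \<omega> * energy (fiberization g \<omega>)) \<partial>lborel)" for g
    unfolding nn_integral_energy_fiberization[symmetric]
  proof (rule nn_integral_cong_AE)
    show "AE \<omega> in lborel. indicator unit_cube \<omega> * energy (fiberization (multiplier m g) \<omega>)
        = indicator unit_cube \<omega> * (indicator E \<omega> * energy (fiberization g \<omega>))"
      using fiberization_multiplier[OF m, of g]
    proof eventually_elim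
      case (elim \<omega>)
      then have "energy (fiberization (multiplier m g) \<omega>) = ennreal ((cmod (m \<omega>))\<^sup>2) * energy (fiberization g \<omega>)"
        using energy_scale[of "m \<omega>" "fiberization g \<omega>"] by presburger
      then show ?case
        by (simp add: m_def indicator_def)
    qed
  qed
  let ?u = "\<lambda>\<omega>. indicator unit_cube \<omega> * (indicator E \<omega> * (ennreal (C\<^sup>2) * energy (fiberization f \<omega>)))"
  let ?v = "\<lambda>\<omega>. indicator unit_cube \<omega> * (indicator E \<omega> * energy (fiberization (L f) \<omega>))"
  have u: "(\<integral>\<^sup>+\<omega>. ?u \<omega> \<partial>lborel) = ennreal (C\<^sup>2) * ennreal ((norm (multiplier m f))\<^sup>2)"
    unfolding norm_m by (subst nn_integral_cmult[symmetric]) (auto simp: mult_ac)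
  have "(\<integral>\<^sup>+\<omega>. ?v \<omega> \<partial>lborel) = ennreal ((norm (L (multiplier m f)))\<^sup>2)"
    by (simp add: norm_m L_multiplier[OF m f])
  also have "\<dots> \<le> ennreal ((C * norm (multiplier m f))\<^sup>2)"
    using C multiplier_in[OF m f] by (intro ennreal_leI power_mono) auto
  also have "\<dots> = (\<integral>\<^sup>+\<omega>. ?u \<omega> \<partial>lborel)"
    unfolding u by (simp add: power_mult_distrib ennreal_mult)
  finally have le: "(\<integral>\<^sup>+\<omega>. ?v \<omega> \<partial>lborel) \<le> (\<integral>\<^sup>+\<omega>. ?u \<omega> \<partial>lborel)" .
  have "AE \<omega> in lborel. ?v \<omega> \<le> ?u \<omega>"
  proof (rule ccontr)
    assume "\<not> (AE \<omega> in lborel. ?v \<omega> \<le> ?u \<omega>)"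
    then have "(\<integral>\<^sup>+\<omega>. ?u \<omega> \<partial>lborel) < (\<integral>\<^sup>+\<omega>. ?v \<omega> \<partial>lborel)"
    proof (rule nn_integral_less[rotated -1])
      show "AE \<omega> in lborel. ?u \<omega> \<le> ?v \<omega>"
        by (rule AE_I2) (auto simp: indicator_def E_def less_imp_le)
      show "(\<integral>\<^sup>+\<omega>. ?u \<omega> \<partial>lborel) \<noteq> \<infinity>"
        unfolding u by (simp add: ennreal_mult_eq_top_iff)
    qed measurable
    with le show False
      by simp
  qed
  then show ?thesis
    by eventually_elim (auto simp: E_def indicator_def not_less[symmetric])
qed

lemma poly_apply_energy_tendsto:
  assumes fin: "\<And>i. energy (h i) < \<infinity>" and deg: "\<And>m. degree (q m) \<le> n" "degree p \<le> n"
    and bound: "\<And>m i. cmod (coeff (q m) i) \<le> M" and lim: "\<And>i. (\<lambda>m. coeff (q m) i) \<longlonglongrightarrow> coeff p i"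
  shows "(\<lambda>m. energy (poly_apply (q m) h)) \<longlonglongrightarrow> energy (poly_apply p h)"
    and "energy (poly_apply (q 0) h) < \<infinity>"
proof -
  define w where "w = (\<lambda>k. ennreal (real (Suc n) * M\<^sup>2) * (\<Sum>i\<le>n. ennreal ((cmod (h i k))\<^sup>2)))"
  have "(\<integral>\<^sup>+k. w k \<partial>count_space UNIV) = ennreal (real (Suc n) * M\<^sup>2) * (\<Sum>i\<le>n. energy (h i))"
    unfolding w_def energy_def by (subst nn_integral_cmult) (auto simp: nn_integral_sum simp del: sum_ennreal)
  also have "\<dots> < \<infinity>"
    using fin by (simp add: ennreal_mult_less_top)
  finally have w: "(\<integral>\<^sup>+k. w k \<partial>count_space UNIV) < \<infinity>" .
  have le: "ennreal ((cmod (poly_apply (q m) h k))\<^sup>2) \<le> w k" for m k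
  proof -
    have "cmod (poly_apply (q m) h k) \<le> (\<Sum>i\<le>n. cmod (coeff (q m) i) * cmod (h i k))"
      unfolding poly_apply_atMost[OF deg(1)] norm_mult[symmetric] by (rule norm_sum)
    then have "(cmod (poly_apply (q m) h k))\<^sup>2 \<le> (\<Sum>i\<le>n. cmod (coeff (q m) i) * cmod (h i k))\<^sup>2"
      by (intro power_mono) auto
    also have "\<dots> \<le> (\<Sum>i\<le>n. (cmod (coeff (q m) i) * cmod (h i k))\<^sup>2) * card {..n}"
      by (rule sum_squared_le_sum_of_squares)
    also have "\<dots> \<le> (\<Sum>i\<le>n. M\<^sup>2 * (cmod (h i k))\<^sup>2) * card {..n}"
      unfolding power_mult_distrib using bound
      by (intro mult_right_mono sum_mono power_mono) auto
    also have "\<dots> = real (Suc n) * M\<^sup>2 * (\<Sum>i\<le>n. (cmod (h i k))\<^sup>2)"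
      by (simp add: sum_distrib_left mult_ac)
    finally have "ennreal ((cmod (poly_apply (q m) h k))\<^sup>2) \<le> ennreal (real (Suc n) * M\<^sup>2 * (\<Sum>i\<le>n. (cmod (h i k))\<^sup>2))"
      by (rule ennreal_leI)
    also have "\<dots> = w k"
      by (simp add: w_def ennreal_mult sum_nonneg sum_ennreal)
    finally show ?thesis .
  qed
  show "(\<lambda>m. energy (poly_apply (q m) h)) \<longlonglongrightarrow> energy (poly_apply p h)"
    unfolding energy_def
  proof (rule nn_integral_dominated_convergence[where w = w])
    show "AE k in count_space UNIV. (\<lambda>m. ennreal ((cmod (poly_apply (q m) h k))\<^sup>2))
        \<longlonglongrightarrow> ennreal ((cmod (poly_apply p h k))\<^sup>2)"
    proof (rule AE_I2)
      fix k
      show "(\<lambda>m. ennreal ((cmod (poly_apply (q m) h k))\<^sup>2)) \<longlonglongrightarrow> ennreal ((cmod (poly_apply p h k))\<^sup>2)"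
        unfolding poly_apply_atMost[OF deg(1)] poly_apply_atMost[OF deg(2)]
        by (intro tendsto_intros lim)
    qed
  qed (use le w in auto)
  show "energy (poly_apply (q 0) h) < \<infinity>"
    unfolding energy_def by (rule le_less_trans[OF nn_integral_mono w]) (rule le)
qed

text \<open>By continuity it suffices to test the bound on polynomials with coefficients in a countable dense set.\<close>

lemma bounded_orbit_of_dense:
  fixes D :: "complex set"
  assumes D: "\<And>c e. e > 0 \<Longrightarrow> \<exists>d\<in>D. dist d c < e"
    and fin: "\<And>i. energy (h i) < \<infinity>"
    and le: "\<And>xs. xs \<in> lists D \<Longrightarrow> energy (poly_apply (pCons 0 (Poly xs)) h)
      \<le> ennreal (C\<^sup>2) * energy (poly_apply (Poly xs) h)"
  shows "bounded_orbit C h"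
  unfolding bounded_orbit_def
proof (intro allI conjI)
  fix p :: "complex poly"
  let ?n = "degree p"
  show "energy (poly_apply p h) < \<infinity>"
  proof (rule poly_apply_energy_tendsto(2)[of h "\<lambda>_. p" ?n p "\<Sum>i\<le>?n. cmod (coeff p i)"])
    show "cmod (coeff p i) \<le> (\<Sum>i\<le>?n. cmod (coeff p i))" for i
      by (cases "i \<le> ?n") (auto intro!: member_le_sum sum_nonneg simp: coeff_eq_0)
  qed (use fin in auto)
  define d where "d = (\<lambda>m c. SOME d. d \<in> D \<and> dist d c < 1 / Suc m)"
  have "d m c \<in> D \<and> dist (d m c) c < 1 / Suc m" for m c
    unfolding d_def by (rule someI_ex) (use D[of "1 / Suc m" c] in auto)
  then have d: "\<And>m c. d m c \<in> D" "\<And>m c. dist (d m c) c < 1 / Suc m"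
    by auto
  define q where "q = (\<lambda>m. Poly (map (\<lambda>i. d m (coeff p i)) [0..<Suc ?n]))"
  have coeff: "coeff (q m) i = (if i \<le> ?n then d m (coeff p i) else 0)" for m i
    by (simp add: q_def coeff_Poly_eq nth_default_def del: upt_Suc)
  have deg: "degree (q m) \<le> ?n" for m
    by (rule degree_le) (simp add: coeff)
  define M where "M = (\<Sum>i\<le>?n. cmod (coeff p i)) + 1"
  have bound: "cmod (coeff (q m) i) \<le> M" for m i
  proof (cases "i \<le> ?n")
    case True
    have "cmod (d m (coeff p i)) \<le> cmod (coeff p i) + dist (d m (coeff p i)) (coeff p i)"
      using norm_triangle_sub[of "d m (coeff p i)" "coeff p i"] by (simp add: dist_norm)
    moreover have "dist (d m (coeff p i)) (coeff p i) \<le> 1"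
      using d(2)[of m "coeff p i"] order_trans[of _ "1 / Suc m" 1] by (simp add: divide_le_eq)
    moreover have "cmod (coeff p i) \<le> (\<Sum>i\<le>?n. cmod (coeff p i))"
      using True by (intro member_le_sum) auto
    ultimately show ?thesis
      using True by (simp add: coeff M_def)
  next
    case False
    then show ?thesis
      by (simp add: coeff M_def sum_nonneg add_nonneg_nonneg)
  qed
  have lim: "(\<lambda>m. coeff (q m) i) \<longlonglongrightarrow> coeff p i" for i
  proof (cases "i \<le> ?n")
    case True
    have "(\<lambda>m. d m (coeff p i) - coeff p i) \<longlonglongrightarrow> 0"
    proof (rule Lim_null_comparison[OF always_eventually LIMSEQ_inverse_real_of_nat], rule allI)
      show "norm (d m (coeff p i) - coeff p i) \<le> inverse (real (Suc m))" for m
        using d(2)[of m "coeff p i"] by (simp add: dist_norm inverse_eq_divide)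
    qed
    then have "(\<lambda>m. d m (coeff p i)) \<longlonglongrightarrow> coeff p i"
      by (rule LIM_zero_cancel)
    then show ?thesis
      using True by (simp add: coeff)
  qed (simp add: coeff coeff_eq_0)
  have "(\<lambda>m. energy (poly_apply (pCons 0 (q m)) h)) \<longlonglongrightarrow> energy (poly_apply (pCons 0 p) h)"
    unfolding poly_apply_pCons0 by (rule poly_apply_energy_tendsto(1)[OF fin deg _ bound lim]) simp
  moreover have "(\<lambda>m. ennreal (C\<^sup>2) * energy (poly_apply (q m) h)) \<longlonglongrightarrow> ennreal (C\<^sup>2) * energy (poly_apply p h)"
    by (intro ennreal_tendsto_cmult poly_apply_energy_tendsto(1)[OF fin deg _ bound lim]) auto
  ultimately show "energy (poly_apply (pCons 0 p) h) \<le> ennreal (C\<^sup>2) * energy (poly_apply p h)"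
  proof (rule LIMSEQ_le)
    show "\<exists>N. \<forall>m\<ge>N. energy (poly_apply (pCons 0 (q m)) h) \<le> ennreal (C\<^sup>2) * energy (poly_apply (q m) h)"
      unfolding q_def using d(1) by (intro exI allI impI le) auto
  qed
qed

context shift_preserving_operator
begin

lemma AE_bounded_orbit:
  assumes \<phi>: "\<phi> \<in> V" and C: "0 \<le> C" "\<And>f. f \<in> V \<Longrightarrow> norm (L f) \<le> C * norm f"
  shows "AE \<omega> in lborel. \<omega> \<in> unit_cube \<longrightarrow> bounded_orbit C (\<lambda>j. fiberization ((L ^^ j) \<phi>) \<omega>)"
proof -
  let ?h = "\<lambda>\<omega> j. fiberization ((L ^^ j) \<phi>) \<omega>"
  obtain D :: "complex set" where "countable D" and D: "\<And>X. open X \<Longrightarrow> X \<noteq> {} \<Longrightarrow> \<exists>d\<in>D. d \<in> X"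
    using countable_dense_setE by metis
  have dense: "\<exists>d\<in>D. dist d c < e" if "e > 0" for c e
    using D[of "ball c e"] that by (auto simp: dist_commute)
  define v where "v = (\<lambda>p. \<Sum>i\<le>degree p. coeff p i *\<^sub>C (L ^^ i) \<phi>)"
  have v_in: "v p \<in> V" for p
    unfolding v_def by (intro L2_complex.subspace_sum[OF subspace] V_scale L_power_in \<phi>)
  have Lv: "L (v p) = (\<Sum>i\<le>degree p. coeff p i *\<^sub>C (L ^^ Suc i) \<phi>)" for p
  proof -
    have "L (\<Sum>i\<in>I. coeff p i *\<^sub>C (L ^^ i) \<phi>) = (\<Sum>i\<in>I. coeff p i *\<^sub>C (L ^^ Suc i) \<phi>)" if "finite I" for I
      using that
    proof (induction I rule: finite_induct)
      case (insert i I)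
      have "(\<Sum>i\<in>I. coeff p i *\<^sub>C (L ^^ i) \<phi>) \<in> V"
        by (intro L2_complex.subspace_sum[OF subspace] V_scale L_power_in \<phi>)
      then show ?case
        using insert by (simp add: L_add L_scale V_scale L_power_in \<phi>)
    qed (simp add: L_0)
    then show ?thesis
      by (simp add: v_def)
  qed
  have "AE \<omega> in lborel. \<forall>i. \<omega> \<in> unit_cube \<longrightarrow> energy (?h \<omega> i) < \<infinity>"
    by (subst AE_all_countable) (use energy_fiberization_finite in blast)
  moreover have "AE \<omega> in lborel. \<forall>xs\<in>lists D. \<omega> \<in> unit_cube \<longrightarrow>
      energy (poly_apply (pCons 0 (Poly xs)) (?h \<omega>)) \<le> ennreal (C\<^sup>2) * energy (poly_apply (Poly xs) (?h \<omega>))"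
  proof (subst AE_ball_countable)
    show "countable (lists D)"
      using \<open>countable D\<close> by simp
    show "\<forall>xs\<in>lists D. AE \<omega> in lborel. \<omega> \<in> unit_cube \<longrightarrow>
      energy (poly_apply (pCons 0 (Poly xs)) (?h \<omega>)) \<le> ennreal (C\<^sup>2) * energy (poly_apply (Poly xs) (?h \<omega>))"
    proof
      fix xs :: "complex list"
      let ?p = "Poly xs"
      have "AE \<omega> in lborel. \<forall>k. fiberization (v ?p) \<omega> k = poly_apply ?p (?h \<omega>) k"
        unfolding v_def poly_apply_def by (rule fiberization_sum) simp
      moreover have "AE \<omega> in lborel. \<forall>k. fiberization (L (v ?p)) \<omega> k = poly_apply (pCons 0 ?p) (?h \<omega>) k"
        unfolding Lv poly_apply_pCons0 unfolding poly_apply_def by (rule fiberization_sum) simp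
      moreover have fb: "AE \<omega> in lborel. \<omega> \<in> unit_cube \<longrightarrow> energy (fiberization (L (v ?p)) \<omega>)
          \<le> ennreal (C\<^sup>2) * energy (fiberization (v ?p) \<omega>)"
        by (rule fiber_bound[OF v_in C(1)]) (rule C(2))
      ultimately show "AE \<omega> in lborel. \<omega> \<in> unit_cube \<longrightarrow>
          energy (poly_apply (pCons 0 ?p) (?h \<omega>)) \<le> ennreal (C\<^sup>2) * energy (poly_apply ?p (?h \<omega>))"
        by eventually_elim (simp add: fun_eq_iff[symmetric])
    qed
  qed
  ultimately show ?thesis
  proof eventually_elim
    case (elim \<omega>)
    then show ?case
      using dense by (intro impI bounded_orbit_of_dense[of D]) auto
  qed
qed

subsection \<open>The dimension of the fibers\<close>

text \<open>
  The fibers of \<open>V\<close> have dimension at most the number of generators: this is clear for finite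
  combinations of translates of the generators, and normalised linear relations survive a limit,
  by compactness of the set of their coefficients.
\<close>

lemma AE_linear_relation:
  assumes \<Phi>: "finite \<Phi>" "V = closure (cspan {shift k \<phi> | k \<phi>. \<phi> \<in> \<Phi>})"
    and f: "\<And>j. f j \<in> V"
  shows "AE \<omega> in lborel. \<exists>c. (\<exists>j\<le>card \<Phi>. c j \<noteq> 0) \<and>
    (\<forall>k. (\<Sum>j\<le>card \<Phi>. c j * fiberization (f j) \<omega> k) = 0)"
proof -
  let ?n = "card \<Phi>"
  have span: "AE \<omega> in lborel. \<exists>a. \<forall>k. fiberization g \<omega> k = (\<Sum>\<phi>\<in>\<Phi>. a \<phi> * fiberization \<phi> \<omega> k)"
    if "g \<in> cspan {shift k \<phi> | k \<phi>. \<phi> \<in> \<Phi>}" for g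
    using that
  proof (rule L2_complex.span_induct)
    let ?P = "\<lambda>g. AE \<omega> in lborel. \<exists>a. \<forall>k. fiberization g \<omega> k = (\<Sum>\<phi>\<in>\<Phi>. a \<phi> * fiberization \<phi> \<omega> k)"
    show "csubspace (Collect ?P)"
      unfolding L2_complex.subspace_def
    proof (intro conjI allI impI ballI; unfold mem_Collect_eq)
      show "?P 0"
        using fiberization_zero by eventually_elim (auto intro!: exI[of _ "\<lambda>_. 0"])
    next
      fix g h assume "?P g" "?P h"
      with fiberization_add[of g h] show "?P (g + h)"
      proof eventually_elim
        case (elim \<omega>)
        then obtain a b where "\<forall>k. fiberization g \<omega> k = (\<Sum>\<phi>\<in>\<Phi>. a \<phi> * fiberization \<phi> \<omega> k)"
            "\<forall>k. fiberization h \<omega> k = (\<Sum>\<phi>\<in>\<Phi>. b \<phi> * fiberization \<phi> \<omega> k)"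
          by blast
        with elim(1) show ?case
          by (intro exI[of _ "\<lambda>\<phi>. a \<phi> + b \<phi>"]) (simp add: distrib_right sum.distrib)
      qed
    next
      fix c g assume "?P g"
      with fiberization_scaleC[of c g] show "?P (c *\<^sub>C g)"
      proof eventually_elim
        case (elim \<omega>)
        then obtain a where "\<forall>k. fiberization g \<omega> k = (\<Sum>\<phi>\<in>\<Phi>. a \<phi> * fiberization \<phi> \<omega> k)"
          by blast
        with elim(1) show ?case
          by (intro exI[of _ "\<lambda>\<phi>. c * a \<phi>"]) (simp add: sum_distrib_left mult.assoc)
      qed
    qed
    fix g assume "g \<in> {shift k \<phi> | k \<phi>. \<phi> \<in> \<Phi>}"
    then obtain l \<psi> where g: "g = shift l \<psi>" "\<psi> \<in> \<Phi>"
      by blast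
    show "?P g"
      using fiberization_multiplier[OF periodic_multiplier_wave, of l \<psi>]
    proof eventually_elim
      case (elim \<omega>)
      then have "fiberization g \<omega> k = (\<Sum>\<phi>\<in>\<Phi>. (if \<phi> = \<psi> then wave (of_int_vec l) \<omega> else 0) * fiberization \<phi> \<omega> k)" for k
        using \<Phi>(1) g by (simp add: multiplier_wave if_distrib[of "\<lambda>x. x * _"] cong: if_cong)
      then show ?case
        by (intro exI[of _ "\<lambda>\<phi>. if \<phi> = \<psi> then wave (of_int_vec l) \<omega> else 0"] allI)
    qed
  qed
  define S where "S = cspan {shift k \<phi> | k \<phi>. \<phi> \<in> \<Phi>}"
  have ex: "\<exists>g. g \<in> S \<and> norm (g - f j) \<le> (1/2)^i" for i j :: nat
  proof -
    have "0 < (1/2 :: real)^i" by simp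
    then obtain g where "g \<in> S" "dist g (f j) < (1/2)^i"
      using f[of j] unfolding \<Phi>(2) S_def[symmetric] closure_approachable by blast
    then show ?thesis
      by (auto simp: dist_norm intro!: less_imp_le)
  qed
  define g where "g = (\<lambda>i j. SOME g. g \<in> S \<and> norm (g - f j) \<le> (1/2)^i)"
  have "g i j \<in> S \<and> norm (g i j - f j) \<le> (1/2)^i" for i j
    unfolding g_def by (rule someI_ex) (rule ex)
  then have g: "\<And>i j. g i j \<in> S" "\<And>i j. norm (g i j - f j) \<le> (1/2)^i"
    by auto
  have "AE \<omega> in lborel. \<forall>i j. \<exists>a. \<forall>k. fiberization (g i j) \<omega> k = (\<Sum>\<phi>\<in>\<Phi>. a \<phi> * fiberization \<phi> \<omega> k)"
    unfolding AE_all_countable using span[OF g(1)[unfolded S_def]] by blast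
  moreover have "AE \<omega> in lborel. \<forall>j k. (\<lambda>i. fiberization (g i j) \<omega> k) \<longlonglongrightarrow> fiberization (f j) \<omega> k"
  proof (subst AE_all_countable, rule allI)
    fix j
    have "AE \<omega> in lborel. (\<lambda>i. rep_L2 (fourier_L2 (g i j)) \<omega>) \<longlonglongrightarrow> rep_L2 (fourier_L2 (f j)) \<omega>"
      by (rule AE_tendsto_of_fast_norm) (simp add: g(2) flip: fourier_L2_diff)
    then show "AE \<omega> in lborel. \<forall>k. (\<lambda>i. fiberization (g i j) \<omega> k) \<longlonglongrightarrow> fiberization (f j) \<omega> k"
      unfolding fiberization_def by (rule AE_translates)
  qed
  ultimately show ?thesis
  proof eventually_elim
    case (elim \<omega>)
    have "\<exists>c. (\<Sum>j\<le>?n. cmod (c j)) = 1 \<and> (\<forall>k. (\<Sum>j\<le>?n. c j * fiberization (g i j) \<omega> k) = 0)" for i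
    proof -
      obtain a where a: "\<And>j k. fiberization (g i j) \<omega> k = (\<Sum>\<phi>\<in>\<Phi>. a j \<phi> * fiberization \<phi> \<omega> k)"
        using elim(1) by metis
      obtain c where c: "\<exists>j\<in>{..?n}. c j \<noteq> 0" "\<And>\<phi>. \<phi> \<in> \<Phi> \<Longrightarrow> (\<Sum>j\<le>?n. c j * a j \<phi>) = 0"
        using homogeneous_system_nontrivial_solution[OF \<Phi>(1), of "{..?n}" a] by auto
      \<comment> \<open>normalised, so that the limit of the relations is not trivial\<close>
      define s where "s = (\<Sum>j\<le>?n. cmod (c j))"
      have "s \<noteq> 0"
        using c(1) by (auto simp: s_def sum_nonneg_eq_0_iff)
      moreover have "s \<ge> 0"
        by (simp add: s_def sum_nonneg)
      ultimately have "(\<Sum>j\<le>?n. cmod (c j / complex_of_real s)) = (\<Sum>j\<le>?n. cmod (c j) / s)"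
        by (simp add: norm_divide)
      also have "\<dots> = 1"
        using \<open>s \<noteq> 0\<close> by (simp add: s_def flip: sum_divide_distrib)
      finally have "(\<Sum>j\<le>?n. cmod (c j / complex_of_real s)) = 1" .
      moreover have "(\<Sum>j\<le>?n. (c j / complex_of_real s) * fiberization (g i j) \<omega> k) = 0" for k
      proof -
        have "(\<Sum>j\<le>?n. c j * fiberization (g i j) \<omega> k) = (\<Sum>\<phi>\<in>\<Phi>. (\<Sum>j\<le>?n. c j * a j \<phi>) * fiberization \<phi> \<omega> k)"
          by (subst sum_distrib_right, subst sum.swap) (simp add: a sum_distrib_left mult.assoc)
        also have "\<dots> = 0"
          using c(2) by simp
        finally show ?thesis
          by (simp flip: sum_divide_distrib)
      qed
      ultimately show ?thesis
        by (intro exI[of _ "\<lambda>j. c j / complex_of_real s"]) simp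
    qed
    then obtain c where c: "\<And>i. (\<Sum>j\<le>?n. cmod (c i j)) = 1"
        "\<And>i k. (\<Sum>j\<le>?n. c i j * fiberization (g i j) \<omega> k) = 0"
      by metis
    have "cmod (c i j) \<le> 1" if "j < Suc ?n" for i j
      using member_le_sum[of j "{..?n}" "\<lambda>j. cmod (c i j)"] c(1)[of i] that by simp
    then obtain r l where r: "strict_mono r" and l: "\<And>j. j < Suc ?n \<Longrightarrow> (\<lambda>i. c (r i) j) \<longlonglongrightarrow> l j"
      using bounded_coordinates_convergent_subsequence[of "Suc ?n" c 1] by blast
    have "(\<lambda>i. \<Sum>j\<le>?n. cmod (c (r i) j)) \<longlonglongrightarrow> (\<Sum>j\<le>?n. cmod (l j))"
      by (intro tendsto_sum tendsto_norm l) simp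
    then have "(\<Sum>j\<le>?n. cmod (l j)) = 1"
      using LIMSEQ_unique[OF _ tendsto_const] by (simp add: c(1))
    then have "\<exists>j\<le>?n. l j \<noteq> 0"
      by (metis (no_types, lifting) atMost_iff norm_zero sum.neutral zero_neq_one)
    moreover have "(\<Sum>j\<le>?n. l j * fiberization (f j) \<omega> k) = 0" for k
    proof -
      have "(\<lambda>i. fiberization (g (r i) j) \<omega> k) \<longlonglongrightarrow> fiberization (f j) \<omega> k" for j
        using LIMSEQ_subseq_LIMSEQ[OF elim(2)[rule_format] r] by (simp add: o_def)
      then have "(\<lambda>i. \<Sum>j\<le>?n. c (r i) j * fiberization (g (r i) j) \<omega> k) \<longlonglongrightarrow> (\<Sum>j\<le>?n. l j * fiberization (f j) \<omega> k)"
        by (intro tendsto_sum tendsto_mult l) simp_all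
      then show ?thesis
        using LIMSEQ_unique[OF _ tendsto_const] by (simp add: c(2))
    qed
    ultimately show ?case
      by blast
  qed
qed

section \<open>A product of factors annihilating the space\<close>

definition factor :: "(real ^ 'n \<Rightarrow> complex) \<Rightarrow> 'n L2 \<Rightarrow> 'n L2" where
  "factor m f = L f - multiplier m f"

definition factors :: "(real ^ 'n \<Rightarrow> complex) list \<Rightarrow> 'n L2 \<Rightarrow> 'n L2" where
  "factors ms = fold factor ms"

lemma factors_Nil [simp]: "factors [] f = f"
  and factors_Cons [simp]: "factors (m # ms) f = factors ms (factor m f)"
  and factors_append: "factors (ms @ ns) f = factors ns (factors ms f)"
  by (simp_all add: factors_def)

lemma factor_in: "periodic_multiplier m \<Longrightarrow> f \<in> V \<Longrightarrow> factor m f \<in> V"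
  by (simp add: factor_def V_diff maps multiplier_in)

lemma L_power_factor:
  assumes m: "periodic_multiplier m" and f: "f \<in> V"
  shows "(L ^^ j) (factor m f) = (L ^^ Suc j) f - multiplier m ((L ^^ j) f)"
  by (induction j)
     (simp_all add: factor_def L_diff L_multiplier[OF m] multiplier_in[OF m] maps L_power_in f)

text \<open>
  The recursion of \<open>peel\<close> is made to follow the passage from \<open>f\<close> to \<open>factor m f\<close>.
\<close>

lemma fiberization_factors:
  assumes "\<forall>m\<in>set ms. periodic_multiplier m" "f \<in> V"
  shows "AE \<omega> in lborel. \<forall>j k. fiberization ((L ^^ j) (factors ms f)) \<omega> k
    = peel (length ms) (\<lambda>i. (ms ! i) \<omega>) (\<lambda>j. fiberization ((L ^^ j) f) \<omega>) j k"
  using assms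
proof (induction ms arbitrary: f)
  case (Cons m ms)
  have m: "periodic_multiplier m"
    using Cons.prems by simp
  have "AE \<omega> in lborel. \<forall>k. fiberization ((L ^^ j) (factor m f)) \<omega> k
      = fiberization ((L ^^ Suc j) f) \<omega> k - m \<omega> * fiberization ((L ^^ j) f) \<omega> k" for j
    unfolding L_power_factor[OF m Cons.prems(2)] by (rule fiberization_diff_multiplier[OF m])
  then have "AE \<omega> in lborel. \<forall>j k. fiberization ((L ^^ j) (factor m f)) \<omega> k
      = fiberization ((L ^^ Suc j) f) \<omega> k - m \<omega> * fiberization ((L ^^ j) f) \<omega> k"
    by (simp only: AE_all_countable) blast
  moreover have "AE \<omega> in lborel. \<forall>j k. fiberization ((L ^^ j) (factors ms (factor m f))) \<omega> k
    = peel (length ms) (\<lambda>i. (ms ! i) \<omega>) (\<lambda>j. fiberization ((L ^^ j) (factor m f)) \<omega>) j k"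
    using Cons.prems m by (intro Cons.IH factor_in) auto
  ultimately show ?case
  proof eventually_elim
    case (elim \<omega>)
    have eq: "(\<lambda>j. fiberization ((L ^^ j) (factor m f)) \<omega>)
        = (\<lambda>j k. fiberization ((L ^^ Suc j) f) \<omega> k - m \<omega> * fiberization ((L ^^ j) f) \<omega> k)"
      by (intro ext) (rule elim(1)[rule_format])
    show ?case
      using elim(2) unfolding eq factors_Cons length_Cons peel.simps nth_Cons_0 nth_Cons_Suc .
  qed
qed simp

text \<open>
  Almost everywhere the \<open>card \<Phi> + 1\<close> vectors of the orbit of \<open>\<phi>\<close> are linearly dependent in the
  fiber, so that a product of \<open>card \<Phi>\<close> linear factors with roots in the disc of radius \<open>C\<close>
  annihilates \<open>\<phi>\<close> there.  The roots are selected measurably and become multipliers.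
\<close>

theorem annihilating_factors:
  assumes \<Phi>: "finite \<Phi>" "V = closure (cspan {shift k \<phi> | k \<phi>. \<phi> \<in> \<Phi>})" and \<phi>: "\<phi> \<in> V"
  shows "\<exists>ms. (\<forall>m\<in>set ms. periodic_multiplier m) \<and> factors ms \<phi> = 0"
proof -
  let ?n = "card \<Phi>" and ?h = "\<lambda>\<omega> j. fiberization ((L ^^ j) \<phi>) \<omega>"
  obtain C where C: "0 < C" "\<And>f. f \<in> V \<Longrightarrow> norm (L f) \<le> C * norm f"
    using L_bound by blast
  define g where "g = (\<lambda>i \<omega> z. peel ?n z (?h \<omega>) 0 (from_nat i :: int ^ 'n))"
  have g: "caratheodory ?n g"
    unfolding caratheodory_def g_def
    by (auto intro!: borel_measurable_peel tendsto_peel)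
  have zeros_iff: "z \<in> zeros ?n C g \<omega> \<longleftrightarrow> (\<forall>i<?n. cmod (z i) \<le> C) \<and> peel ?n z (?h \<omega>) 0 = (\<lambda>_. 0)" for z \<omega>
    unfolding zeros_def g_def by (auto simp: fun_eq_iff) (metis from_nat_to_nat)
  have orbit: "AE \<omega> in lborel. \<omega> \<in> unit_cube \<longrightarrow> bounded_orbit C (?h \<omega>)"
    by (rule AE_bounded_orbit[OF \<phi>]) (use C in auto)
  have ne: "AE \<omega> in lborel. \<omega> \<in> unit_cube \<longrightarrow> zeros ?n C g \<omega> \<noteq> {}"
    using AE_linear_relation[OF \<Phi>, of "\<lambda>j. (L ^^ j) \<phi>", OF L_power_in[OF \<phi>]] orbit
  proof eventually_elim
    case (elim \<omega>)
    then obtain c where c: "\<exists>j\<le>?n. c j \<noteq> 0" "\<And>k. (\<Sum>j\<le>?n. c j * ?h \<omega> j k) = 0"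
      by blast
    define p where "p = Poly (map c [0..<Suc ?n])"
    have coeff: "coeff p i = (if i \<le> ?n then c i else 0)" for i
      by (simp add: p_def coeff_Poly_eq nth_default_def del: upt_Suc)
    have deg: "degree p \<le> ?n"
      by (rule degree_le) (simp add: coeff)
    have "p \<noteq> 0"
      using c(1) coeff by (metis coeff_0)
    moreover have "poly_apply p (?h \<omega>) = (\<lambda>_. 0)"
      unfolding poly_apply_atMost[OF deg] fun_eq_iff by (simp add: coeff c(2))
    ultimately show ?case
      using annihilating_roots[OF _ less_imp_le[OF C(1)] _ deg, of "?h \<omega>"] elim(2) zeros_iff by blast
  qed
  obtain \<zeta> where \<zeta>: "\<And>j. \<zeta> j \<in> borel_measurable borel" "\<And>j \<omega>. cmod (\<zeta> j \<omega>) \<le> C"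
      "\<And>\<omega>. zeros ?n C g \<omega> \<noteq> {} \<Longrightarrow> (\<lambda>j. \<zeta> j \<omega>) \<in> zeros ?n C g \<omega>"
    using measurable_selection_of_zeros[OF g, of C] C(1) less_imp_le by metis
  \<comment> \<open>the roots are needed on the cube only and are continued periodically\<close>
  define ms where "ms = map (\<lambda>j \<omega>. \<zeta> j (frac_vec \<omega>)) [0..<?n]"
  have ms: "\<forall>m\<in>set ms. periodic_multiplier m"
    using \<zeta>(1,2) by (auto simp: ms_def periodic_multiplier_def)
  have "factors ms \<phi> = 0"
  proof (rule eq_0_of_fiberization)
    show "AE \<omega> in lborel. \<omega> \<in> unit_cube \<longrightarrow> (\<forall>k. fiberization (factors ms \<phi>) \<omega> k = 0)"
      using fiberization_factors[OF ms \<phi>] ne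
    proof eventually_elim
      case (elim \<omega>)
      show ?case
      proof
        assume \<omega>: "\<omega> \<in> unit_cube"
        have "peel (length ms) (\<lambda>i. (ms ! i) \<omega>) (?h \<omega>) = peel ?n (\<lambda>j. \<zeta> j \<omega>) (?h \<omega>)"
          unfolding ms_def length_map length_upt diff_zero
          by (rule peel_cong) (simp add: frac_vec_cube[OF \<omega>])
        moreover have "peel ?n (\<lambda>j. \<zeta> j \<omega>) (?h \<omega>) 0 = (\<lambda>_. 0)"
          using \<zeta>(3) elim(2) \<omega> zeros_iff by blast
        ultimately show "\<forall>k. fiberization (factors ms \<phi>) \<omega> k = 0"
          using elim(1)[rule_format, of 0] by simp
      qed
    qed
  qed
  with ms show ?thesis
    by blast
qed

end

context shift_preserving_operator
begin

lemma factor_add: "periodic_multiplier m \<Longrightarrow> f \<in> V \<Longrightarrow> g \<in> V \<Longrightarrow> factor m (f + g) = factor m f + factor m g"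
  by (simp add: factor_def L_add multiplier_add)

lemma factor_scaleC: "periodic_multiplier m \<Longrightarrow> f \<in> V \<Longrightarrow> factor m (c *\<^sub>C f) = c *\<^sub>C factor m f"
  by (simp add: factor_def L_scale multiplier_scaleC scaleC_diff_right)

lemma factor_multiplier:
  "periodic_multiplier m \<Longrightarrow> periodic_multiplier l \<Longrightarrow> f \<in> V \<Longrightarrow>
    factor m (multiplier l f) = multiplier l (factor m f)"
  by (simp add: factor_def L_multiplier multiplier_diff multiplier_commute)

lemma factor_commute:
  assumes "periodic_multiplier m" "periodic_multiplier l" "f \<in> V"
  shows "factor m (factor l f) = factor l (factor m f)"
proof -
  have expand: "factor m (factor l f)
      = L (L f) - multiplier l (L f) - (multiplier m (L f) - multiplier m (multiplier l f))"
    if "periodic_multiplier m" "periodic_multiplier l" for m l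
    using that assms(3)
    by (simp add: factor_def L_diff multiplier_diff L_multiplier maps multiplier_in)
  show ?thesis
    unfolding expand[OF assms(1,2)] expand[OF assms(2,1)] multiplier_commute[OF assms(2,1)]
    by simp
qed

lemma factor_tendsto:
  assumes "periodic_multiplier m" "\<And>n. x n \<in> V" "l \<in> V" "x \<longlonglongrightarrow> l"
  shows "(\<lambda>n. factor m (x n)) \<longlonglongrightarrow> factor m l"
  unfolding factor_def
  using assms by (intro tendsto_diff L_tendsto bounded_linear.tendsto[OF bounded_linear_multiplier])

lemma factor_0: "periodic_multiplier m \<Longrightarrow> factor m 0 = 0"
  using factor_scaleC[of m 0 0] V_0 by simp

lemma factors_0: "\<forall>m\<in>set ms. periodic_multiplier m \<Longrightarrow> factors ms 0 = 0"
  by (induction ms) (simp_all add: factor_0)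

lemma factors_add:
  "\<forall>m\<in>set ms. periodic_multiplier m \<Longrightarrow> f \<in> V \<Longrightarrow> g \<in> V \<Longrightarrow> factors ms (f + g) = factors ms f + factors ms g"
  by (induction ms arbitrary: f g) (simp_all add: factor_add factor_in)

lemma factors_scaleC:
  "\<forall>m\<in>set ms. periodic_multiplier m \<Longrightarrow> f \<in> V \<Longrightarrow> factors ms (c *\<^sub>C f) = c *\<^sub>C factors ms f"
  by (induction ms arbitrary: f) (simp_all add: factor_scaleC factor_in)

lemma factors_multiplier:
  "\<forall>m\<in>set ms. periodic_multiplier m \<Longrightarrow> periodic_multiplier l \<Longrightarrow> f \<in> V \<Longrightarrow>
    factors ms (multiplier l f) = multiplier l (factors ms f)"
  by (induction ms arbitrary: f) (simp_all add: factor_multiplier factor_in)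

lemma factors_factor:
  "\<forall>m\<in>set ms. periodic_multiplier m \<Longrightarrow> periodic_multiplier l \<Longrightarrow> f \<in> V \<Longrightarrow>
    factors ms (factor l f) = factor l (factors ms f)"
proof (induction ms arbitrary: f)
  case (Cons m ms)
  then have "factors ms (factor l (factor m f)) = factor l (factors ms (factor m f))"
    by (intro Cons.IH factor_in) auto
  moreover have "factor m (factor l f) = factor l (factor m f)"
    using Cons.prems by (intro factor_commute) auto
  ultimately show ?case
    by simp
qed simp

lemma factors_commute:
  "\<forall>m\<in>set ms. periodic_multiplier m \<Longrightarrow> \<forall>m\<in>set ns. periodic_multiplier m \<Longrightarrow> f \<in> V \<Longrightarrow>
    factors ms (factors ns f) = factors ns (factors ms f)"
proof (induction ns arbitrary: f)
  case (Cons n ns)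
  then have "factors ms (factors ns (factor n f)) = factors ns (factors ms (factor n f))"
    by (intro Cons.IH factor_in) auto
  also have "factors ms (factor n f) = factor n (factors ms f)"
    using Cons.prems by (intro factors_factor) auto
  finally show ?case
    by (simp only: factors_Cons)
qed simp

lemma factors_tendsto:
  assumes "\<forall>m\<in>set ms. periodic_multiplier m" "\<And>n. x n \<in> V" "l \<in> V" "x \<longlonglongrightarrow> l"
  shows "(\<lambda>n. factors ms (x n)) \<longlonglongrightarrow> factors ms l"
  using assms
proof (induction ms arbitrary: x l)
  case (Cons m ms)
  then show ?case
    unfolding factors_Cons by (intro Cons.IH factor_in factor_tendsto) auto
qed simp

text \<open>
  The factors commute, so that the concatenation of the lists for the single generators annihilates
  all generators; the kernel of the product is a closed shift-invariant subspace.
\<close>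

theorem factors_annihilate:
  assumes \<Phi>: "finite \<Phi>" "V = closure (cspan {shift k \<phi> | k \<phi>. \<phi> \<in> \<Phi>})"
  shows "\<exists>ms. (\<forall>m\<in>set ms. periodic_multiplier m) \<and> (\<forall>f\<in>V. factors ms f = 0)"
proof -
  have wave_0: "wave (of_int_vec 0) = (\<lambda>_. 1)"
    by (simp add: fun_eq_iff)
  have shift_0: "shift 0 f = f" for f :: "'n L2"
    using multiplier_wave[of 0 f] unfolding wave_0 by (simp add: multiplier_const scaleC_one)
  have \<Phi>V: "\<Phi> \<subseteq> V"
  proof
    fix \<phi> assume "\<phi> \<in> \<Phi>"
    then have "shift 0 \<phi> \<in> {shift k \<phi> | k \<phi>. \<phi> \<in> \<Phi>}"
      by blast
    from subsetD[OF closure_subset L2_complex.span_base[OF this]] show "\<phi> \<in> V"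
      unfolding shift_0 \<Phi>(2)[symmetric] .
  qed
  have "\<exists>ms. (\<forall>m\<in>set ms. periodic_multiplier m) \<and> (\<forall>\<phi>\<in>\<Phi>. factors ms \<phi> = 0)"
    using \<Phi>(1) \<Phi>V
  proof (induction \<Phi> rule: finite_induct)
    case empty
    show ?case
      by (intro exI[of _ "[]"]) simp
  next
    case (insert \<phi> \<Psi>)
    obtain ms where ms: "\<forall>m\<in>set ms. periodic_multiplier m" "\<forall>\<psi>\<in>\<Psi>. factors ms \<psi> = 0"
      using insert by auto
    obtain ns where ns: "\<forall>m\<in>set ns. periodic_multiplier m" "factors ns \<phi> = 0"
      using annihilating_factors[OF \<Phi>, of \<phi>] insert.prems by blast
    have "factors (ns @ ms) \<phi> = 0"
      by (simp add: factors_append ns(2) factors_0[OF ms(1)])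
    moreover have "factors (ns @ ms) \<psi> = 0" if "\<psi> \<in> \<Psi>" for \<psi>
      using that insert.prems factors_commute[OF ms(1) ns(1), of \<psi>] ms(2) factors_0[OF ns(1)]
      by (auto simp: factors_append)
    ultimately show ?case
      using ms ns by (intro exI[of _ "ns @ ms"]) auto
  qed
  then obtain ms where ms: "\<forall>m\<in>set ms. periodic_multiplier m" "\<forall>\<phi>\<in>\<Phi>. factors ms \<phi> = 0"
    by blast
  define K where "K = {f \<in> V. factors ms f = 0}"
  have "csubspace K"
    unfolding L2_complex.subspace_def K_def
    using V_0 V_add V_scale factors_0[OF ms(1)] factors_add[OF ms(1)] factors_scaleC[OF ms(1)] by auto
  moreover have "{shift k \<phi> | k \<phi>. \<phi> \<in> \<Phi>} \<subseteq> K"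
  proof
    fix g assume "g \<in> {shift k \<phi> | k \<phi>. \<phi> \<in> \<Phi>}"
    then obtain k \<phi> where g: "g = multiplier (wave (of_int_vec k)) \<phi>" "\<phi> \<in> \<Phi>"
      by (auto simp: multiplier_wave)
    then have "factors ms g = multiplier (wave (of_int_vec k)) 0"
      using ms \<Phi>V factors_multiplier[OF ms(1) periodic_multiplier_wave] by auto
    then show "g \<in> K"
      using g \<Phi>V multiplier_in[OF periodic_multiplier_wave] multiplier_scaleC[OF periodic_multiplier_wave, of _ 0 0]
      by (auto simp: K_def)
  qed
  ultimately have "cspan {shift k \<phi> | k \<phi>. \<phi> \<in> \<Phi>} \<subseteq> K"
    by (intro L2_complex.span_minimal)
  moreover have "closed K"
    unfolding closed_sequential_limits
  proof (intro allI impI, elim conjE)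
    fix x l assume x: "\<forall>n. x n \<in> K" and l: "x \<longlonglongrightarrow> l"
    then have "l \<in> V"
      using closed_sequentially[OF closed _ l] by (auto simp: K_def)
    then have "(\<lambda>n. factors ms (x n)) \<longlonglongrightarrow> factors ms l"
      using x l by (intro factors_tendsto[OF ms(1)]) (auto simp: K_def)
    then have "factors ms l = 0"
      using x LIMSEQ_unique[OF _ tendsto_const] by (simp add: K_def)
    then show "l \<in> K"
      using \<open>l \<in> V\<close> by (simp add: K_def)
  qed
  ultimately have "V \<subseteq> K"
    unfolding \<Phi>(2) by (rule closure_minimal)
  then show ?thesis
    using ms(1) by (auto simp: K_def)
qed

end

section \<open>Reducing subspaces and the decomposition\<close>

locale normal_shift_preserving_operator = shift_preserving_operator V L
  for V :: "'n::finite L2 set" and L +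
  assumes normal: "normal_on V L"
begin

lemma L_adj: "f \<in> V \<Longrightarrow> L (adj f) = adj (L f)"
  using normal by (simp add: normal_on_def)

lemma adj_multiplier:
  assumes m: "periodic_multiplier m" and g: "g \<in> V"
  shows "adj (multiplier m g) = multiplier m (adj g)"
proof -
  let ?c = "multiplier (\<lambda>\<omega>. cnj (m \<omega>))" and ?d = "adj (multiplier m g) - multiplier m (adj g)"
  have c: "periodic_multiplier (\<lambda>\<omega>. cnj (m \<omega>))"
    using m by (rule periodic_multiplier_cnj)
  have "cinner f (adj (multiplier m g)) = cinner f (multiplier m (adj g))" if f: "f \<in> V" for f
  proof -
    have "cinner f (adj (multiplier m g)) = cinner (L f) (multiplier m g)"
      using f g m by (simp add: adj multiplier_in)
    also have "\<dots> = cinner (L (?c f)) g"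
      using cinner_multiplier[OF c, of "L f" g] by (simp add: L_multiplier[OF c f])
    also have "\<dots> = cinner (?c f) (adj g)"
      using f g c by (simp add: adj multiplier_in)
    also have "\<dots> = cinner f (multiplier m (adj g))"
      using cinner_multiplier[OF c, of f "adj g"] by simp
    finally show ?thesis .
  qed
  moreover have "?d \<in> V"
    using m g by (intro V_diff adj_in multiplier_in)
  ultimately have "cinner ?d ?d = 0"
    by (simp add: cinner_diff_right)
  then show ?thesis
    using cinner_self_eq_0 by fastforce
qed

text \<open>
  Invariance under all multipliers includes invariance under translations, and lets orthogonal
  complements be formed: the adjoint of a multiplier is again a multiplier.
\<close>

definition reducing :: "'n L2 set \<Rightarrow> bool" where
  "reducing U \<longleftrightarrow> csubspace U \<and> closed U \<and> U \<subseteq> V \<and> (\<forall>f\<in>U. L f \<in> U \<and> adj f \<in> U) \<and>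
     (\<forall>m. periodic_multiplier m \<longrightarrow> (\<forall>f\<in>U. multiplier m f \<in> U))"

lemma reducingD:
  assumes "reducing U"
  shows "csubspace U" "closed U" "U \<subseteq> V" "f \<in> U \<Longrightarrow> L f \<in> U" "f \<in> U \<Longrightarrow> adj f \<in> U"
    "periodic_multiplier m \<Longrightarrow> f \<in> U \<Longrightarrow> multiplier m f \<in> U"
  using assms by (auto simp: reducing_def)

lemma reducing_V: "reducing V"
  by (simp add: reducing_def subspace closed maps adj_in multiplier_in)

lemma reducing_shift_invariant: "reducing U \<Longrightarrow> shift_invariant U"
  using reducingD(6)[OF _ periodic_multiplier_wave]
  by (auto simp: shift_invariant_def reducing_def multiplier_wave)

text \<open>
  Normality enters here: if \<open>L f = multiplier m f\<close>, then \<open>L (adj f) = adj (L f) = multiplier m (adj f)\<close>.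
\<close>

lemma reducing_kernel:
  assumes U: "reducing U" and m: "periodic_multiplier m"
  shows "reducing {f \<in> U. L f = multiplier m f}"
proof -
  note r = reducingD[OF U]
  have V: "f \<in> V" if "f \<in> U" for f
    using r(3) that by blast
  show ?thesis
    unfolding reducing_def
  proof (intro conjI ballI allI impI)
    show "csubspace {f \<in> U. L f = multiplier m f}"
      unfolding L2_complex.subspace_def
      using L2_complex.subspace_0[OF r(1)] L2_complex.subspace_add[OF r(1)] L2_complex.subspace_scale[OF r(1)]
        L_0 L_add[OF V V] L_scale[OF V] multiplier_add[OF m] multiplier_scaleC[OF m] multiplier_scaleC[OF m, of 0 0]
      by auto
    show "closed {f \<in> U. L f = multiplier m f}"
      unfolding closed_sequential_limits
    proof (intro allI impI, elim conjE)
      fix x l assume x: "\<forall>n. x n \<in> {f \<in> U. L f = multiplier m f}" and l: "x \<longlonglongrightarrow> l"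
      then have "l \<in> U"
        using closed_sequentially[OF r(2) _ l] by auto
      then have "(\<lambda>n. L (x n)) \<longlonglongrightarrow> L l"
        using x l V by (intro L_tendsto) auto
      moreover have "(\<lambda>n. multiplier m (x n)) \<longlonglongrightarrow> multiplier m l"
        by (rule bounded_linear.tendsto[OF bounded_linear_multiplier[OF m] l])
      ultimately have "L l = multiplier m l"
        using x LIMSEQ_unique by simp
      then show "l \<in> {f \<in> U. L f = multiplier m f}"
        using \<open>l \<in> U\<close> by simp
    qed
    show "{f \<in> U. L f = multiplier m f} \<subseteq> V"
      using r(3) by blast
    fix f assume f: "f \<in> {f \<in> U. L f = multiplier m f}"
    then show "L f \<in> {f \<in> U. L f = multiplier m f}"
      using r(4)[of f] r(6)[OF m, of f] L_multiplier[OF m V, of f] by auto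
    show "adj f \<in> {f \<in> U. L f = multiplier m f}"
      using f r(5)[of f] L_adj[OF V, of f] adj_multiplier[OF m V, of f] by auto
  next
    fix l :: "real ^ 'n \<Rightarrow> complex" and f assume l: "periodic_multiplier l" and f: "f \<in> {f \<in> U. L f = multiplier m f}"
    then show "multiplier l f \<in> {f \<in> U. L f = multiplier m f}"
      using r(6)[OF l, of f] L_multiplier[OF l V, of f] multiplier_commute[OF l m, of f] by auto
  qed
qed

lemma reducing_orthogonal:
  assumes U: "reducing U" and W: "reducing W"
  shows "reducing {f \<in> U. \<forall>g\<in>W. cinner f g = 0}"
proof -
  note u = reducingD[OF U] and w = reducingD[OF W]
  have V: "f \<in> V" if "f \<in> U \<or> f \<in> W" for f
    using u(3) w(3) that by blast
  show ?thesis
    unfolding reducing_def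
  proof (intro conjI ballI allI impI)
    show "csubspace {f \<in> U. \<forall>g\<in>W. cinner f g = 0}"
      unfolding L2_complex.subspace_def
      using L2_complex.subspace_0[OF u(1)] L2_complex.subspace_add[OF u(1)] L2_complex.subspace_scale[OF u(1)]
      by (auto simp: cinner_add_left cinner_scaleC_left)
    show "closed {f \<in> U. \<forall>g\<in>W. cinner f g = 0}"
      unfolding closed_sequential_limits
    proof (intro allI impI, elim conjE)
      fix x l assume x: "\<forall>n. x n \<in> {f \<in> U. \<forall>g\<in>W. cinner f g = 0}" and l: "x \<longlonglongrightarrow> l"
      then have "l \<in> U"
        using closed_sequentially[OF u(2) _ l] by auto
      moreover have "cinner l g = 0" if "g \<in> W" for g
      proof -
        have "(\<lambda>n. cinner (x n) g) \<longlonglongrightarrow> cinner l g"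
          by (intro tendsto_cinner l tendsto_const)
        then show ?thesis
          using x that LIMSEQ_unique[OF _ tendsto_const] by simp
      qed
      ultimately show "l \<in> {f \<in> U. \<forall>g\<in>W. cinner f g = 0}"
        by simp
    qed
    show "{f \<in> U. \<forall>g\<in>W. cinner f g = 0} \<subseteq> V"
      using u(3) by blast
    fix f assume f: "f \<in> {f \<in> U. \<forall>g\<in>W. cinner f g = 0}"
    have "cinner (L f) g = 0" if "g \<in> W" for g
      using f that adj[of g f] V w(5) by simp
    then show "L f \<in> {f \<in> U. \<forall>g\<in>W. cinner f g = 0}"
      using f u(4) by simp
    have "cinner (adj f) g = 0" if "g \<in> W" for g
    proof -
      have "cinner g (adj f) = cinner (L g) f"
        using f that adj[of f g] V by simp
      also have "\<dots> = cnj (cinner f (L g))"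
        by (rule cinner_commute)
      finally have "cinner g (adj f) = 0"
        using f that w(4) by simp
      then show ?thesis
        by (subst cinner_commute) simp
    qed
    then show "adj f \<in> {f \<in> U. \<forall>g\<in>W. cinner f g = 0}"
      using f u(5) by simp
  next
    fix m :: "real ^ 'n \<Rightarrow> complex" and f assume m: "periodic_multiplier m" and f: "f \<in> {f \<in> U. \<forall>g\<in>W. cinner f g = 0}"
    then show "multiplier m f \<in> {f \<in> U. \<forall>g\<in>W. cinner f g = 0}"
      using u(6)[OF m] w(6)[OF periodic_multiplier_cnj[OF m]] by (simp add: cinner_multiplier[OF m])
  qed
qed

text \<open>
  Peel off the kernels one after the other, each inside the orthogonal complement of the preceding
  ones.  What remains is reducing, and every factor is injective on it.
\<close>

lemma kernel_decomposition:
  assumes "reducing U" "\<forall>m\<in>set ms. periodic_multiplier m"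
  shows "\<exists>W R. (\<forall>j<length ms. reducing (W j) \<and> W j \<subseteq> U \<and> (\<forall>f\<in>W j. L f = multiplier (ms ! j) f)) \<and>
    (\<forall>i<length ms. \<forall>j<length ms. i \<noteq> j \<longrightarrow> (\<forall>f\<in>W i. \<forall>g\<in>W j. cinner f g = 0)) \<and>
    reducing R \<and> R \<subseteq> U \<and> (\<forall>m\<in>set ms. \<forall>f\<in>R. factor m f = 0 \<longrightarrow> f = 0) \<and>
    (\<forall>f\<in>U. \<exists>w. (\<forall>j<length ms. w j \<in> W j) \<and> f - (\<Sum>j<length ms. w j) \<in> R)"
  using assms
proof (induction ms arbitrary: U)
  case Nil
  then show ?case
    by (intro exI[of _ "\<lambda>_. {}"] exI[of _ U]) simp
next
  case (Cons m ms)
  have m: "periodic_multiplier m"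
    using Cons.prems by simp
  define K where "K = {f \<in> U. L f = multiplier m f}"
  define U' where "U' = {f \<in> U. \<forall>g\<in>K. cinner f g = 0}"
  have K: "reducing K"
    unfolding K_def by (rule reducing_kernel[OF Cons.prems(1) m])
  have U': "reducing U'"
    unfolding U'_def by (rule reducing_orthogonal[OF Cons.prems(1) K])
  have "\<forall>m\<in>set ms. periodic_multiplier m"
    using Cons.prems(2) by simp
  from Cons.IH[OF U' this] obtain W R where
    W': "\<forall>j<length ms. reducing (W j) \<and> W j \<subseteq> U' \<and> (\<forall>f\<in>W j. L f = multiplier (ms ! j) f)"
    and orth': "\<forall>i<length ms. \<forall>j<length ms. i \<noteq> j \<longrightarrow> (\<forall>f\<in>W i. \<forall>g\<in>W j. cinner f g = 0)"
    and R: "reducing R" "R \<subseteq> U'" "\<forall>m\<in>set ms. \<forall>f\<in>R. factor m f = 0 \<longrightarrow> f = 0"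
    and dec: "\<forall>f\<in>U'. \<exists>w. (\<forall>j<length ms. w j \<in> W j) \<and> f - (\<Sum>j<length ms. w j) \<in> R"
    by (elim exE conjE) (rule that)
  have W: "reducing (W j)" "W j \<subseteq> U'" "f \<in> W j \<Longrightarrow> L f = multiplier (ms ! j) f" if "j < length ms" for j f
    using W' that by auto
  have orth: "cinner f g = 0" if "i < length ms" "j < length ms" "i \<noteq> j" "f \<in> W i" "g \<in> W j" for i j f g
    using orth' that by blast
  let ?W = "case_nat K W"
  have KU': "cinner f g = 0" "cinner g f = 0" if "f \<in> K" "g \<in> U'" for f g
    using that by (auto simp: U'_def cinner_commute[of f g])
  show ?case
  proof (intro exI[of _ ?W] exI[of _ R] conjI allI impI ballI)
    fix j assume j: "j < length (m # ms)"
    show "reducing (?W j)"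
      using j K W(1) by (cases j) auto
    show "?W j \<subseteq> U"
      using j W(2) by (cases j) (auto simp: K_def U'_def)
    show "L f = multiplier ((m # ms) ! j) f" if "f \<in> ?W j" for f
      using j W(3) that by (cases j) (auto simp: K_def)
  next
    fix i j f g assume "i < length (m # ms)" "j < length (m # ms)" "i \<noteq> j" "f \<in> ?W i" "g \<in> ?W j"
    then show "cinner f g = 0"
      using orth KU' W(2) by (cases i; cases j) (auto simp: subset_iff)
  next
    show "reducing R" "R \<subseteq> U"
      using R by (auto simp: U'_def)
  next
    fix l f assume l: "l \<in> set (m # ms)" and f: "f \<in> R" "factor l f = 0"
    show "f = 0"
    proof (cases "l \<in> set ms")
      case False
      then have "L f = multiplier m f"
        using l f by (simp add: factor_def)
      then have "cinner f f = 0"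
        using f R(2) by (auto simp: U'_def K_def)
      then show ?thesis
        by (rule cinner_self_eq_0)
    qed (use R(3) f in blast)
  next
    fix f assume f: "f \<in> U"
    obtain p where p: "p \<in> K" "\<forall>g\<in>K. cinner (f - p) g = 0"
      using projection_exists[OF reducingD(1,2)[OF K]] by blast
    then have "f - p \<in> U'"
      using f L2_complex.subspace_diff[OF reducingD(1)[OF Cons.prems(1)]] by (auto simp: U'_def K_def)
    then obtain w where w: "\<forall>j<length ms. w j \<in> W j" "f - p - (\<Sum>j<length ms. w j) \<in> R"
      using dec by blast
    have eq: "f - (\<Sum>j<length (m # ms). case_nat p w j) = f - p - (\<Sum>j<length ms. w j)"
      unfolding list.size add_Suc_right add_0_right sum.lessThan_Suc_shift by (simp add: diff_diff_eq)
    show "\<exists>w. (\<forall>j<length (m # ms). w j \<in> ?W j) \<and> f - (\<Sum>j<length (m # ms). w j) \<in> R"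
    proof (intro exI[of _ "case_nat p w"] conjI allI impI)
      show "case_nat p w j \<in> ?W j" if "j < length (m # ms)" for j
        using that w(1) p(1) by (cases j) auto
      show "f - (\<Sum>j<length (m # ms). case_nat p w j) \<in> R"
        unfolding eq by (rule w(2))
    qed
  qed
qed

lemma factors_injective:
  assumes R: "reducing R" and inj: "\<And>m f. m \<in> set ms \<Longrightarrow> f \<in> R \<Longrightarrow> factor m f = 0 \<Longrightarrow> f = 0"
    and ms: "\<forall>m\<in>set ms. periodic_multiplier m" and f: "f \<in> R" "factors ms f = 0"
  shows "f = 0"
  using inj ms f
proof (induction ms arbitrary: f)
  case (Cons m ms)
  have "factor m f \<in> R"
    unfolding factor_def using Cons.prems reducingD[OF R] by (intro L2_complex.subspace_diff) auto
  then have "factor m f = 0"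
  proof (rule Cons.IH[rotated 2])
    show "g = 0" if "l \<in> set ms" "g \<in> R" "factor l g = 0" for l g
      using that by (intro Cons.prems(1)[of l g]) auto
    show "\<forall>m\<in>set ms. periodic_multiplier m" "factors ms (factor m f) = 0"
      using Cons.prems(2,4) by simp_all
  qed
  then show ?case
    by (intro Cons.prems(1)[of m f] Cons.prems(3)) simp_all
qed simp

text \<open>
  On the remainder of \<open>kernel_decomposition\<close> every factor of the annihilating product is injective,
  so the remainder is trivial.  Factors that are injective on all of \<open>V\<close> are discarded beforehand:
  they contribute a trivial kernel, and their multipliers are not eigenvalues.
\<close>

theorem spectral_decomposition:
  assumes \<Phi>: "finite \<Phi>" "V = closure (cspan {shift k \<phi> | k \<phi>. \<phi> \<in> \<Phi>})"
  shows "\<exists>ms W. (\<forall>m\<in>set ms. periodic_multiplier m \<and> (\<exists>f\<in>V. f \<noteq> 0 \<and> L f = multiplier m f)) \<and>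
    (\<forall>j<length ms. reducing (W j) \<and> (\<forall>f\<in>W j. L f = multiplier (ms ! j) f)) \<and>
    (\<forall>i<length ms. \<forall>j<length ms. i \<noteq> j \<longrightarrow> (\<forall>f\<in>W i. \<forall>g\<in>W j. cinner f g = 0)) \<and>
    (\<forall>f\<in>V. \<exists>w. (\<forall>j<length ms. w j \<in> W j) \<and> f = (\<Sum>j<length ms. w j))"
proof -
  obtain ns where ns: "\<forall>m\<in>set ns. periodic_multiplier m" "\<forall>f\<in>V. factors ns f = 0"
    using factors_annihilate[OF \<Phi>] by blast
  define ms where "ms = filter (\<lambda>m. \<exists>f\<in>V. f \<noteq> 0 \<and> factor m f = 0) ns"
  have ms: "\<forall>m\<in>set ms. periodic_multiplier m"
    using ns(1) by (simp add: ms_def)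
  from kernel_decomposition[OF reducing_V ms] obtain W R where
    W: "\<forall>j<length ms. reducing (W j) \<and> W j \<subseteq> V \<and> (\<forall>f\<in>W j. L f = multiplier (ms ! j) f)"
    and orth: "\<forall>i<length ms. \<forall>j<length ms. i \<noteq> j \<longrightarrow> (\<forall>f\<in>W i. \<forall>g\<in>W j. cinner f g = 0)"
    and R: "reducing R" "R \<subseteq> V" "\<forall>m\<in>set ms. \<forall>f\<in>R. factor m f = 0 \<longrightarrow> f = 0"
    and dec: "\<forall>f\<in>V. \<exists>w. (\<forall>j<length ms. w j \<in> W j) \<and> f - (\<Sum>j<length ms. w j) \<in> R"
    by (elim exE conjE) (rule that)
  have R0: "f = 0" if f: "f \<in> R" for f
  proof (rule factors_injective[OF R(1) _ ns(1) f])
    show "factors ns f = 0"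
      using ns(2) f R(2) by blast
    show "g = 0" if "m \<in> set ns" "g \<in> R" "factor m g = 0" for m g
    proof (cases "m \<in> set ms")
      case True
      then show ?thesis
        using R(3) that(2,3) by blast
    next
      case False
      then have "\<forall>f\<in>V. f = 0 \<or> factor m f \<noteq> 0"
        using that(1) unfolding ms_def set_filter by blast
      then show ?thesis
        using R(2) that(2,3) by blast
    qed
  qed
  have sum: "\<exists>w. (\<forall>j<length ms. w j \<in> W j) \<and> f = (\<Sum>j<length ms. w j)" if f: "f \<in> V" for f
  proof -
    from dec[rule_format, OF f] obtain w where
      w: "\<forall>j<length ms. w j \<in> W j" "f - (\<Sum>j<length ms. w j) \<in> R"
      by (elim exE conjE) (rule that)
    then show ?thesis
      using R0[OF w(2)] by (intro exI[of _ w]) simp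
  qed
  show ?thesis
  proof (intro exI[of _ ms] exI[of _ W] conjI)
    show "\<forall>m\<in>set ms. periodic_multiplier m \<and> (\<exists>f\<in>V. f \<noteq> 0 \<and> L f = multiplier m f)"
      using ms by (auto simp: ms_def factor_def)
    show "\<forall>j<length ms. reducing (W j) \<and> (\<forall>f\<in>W j. L f = multiplier (ms ! j) f)"
      using W by simp
    show "\<forall>f\<in>V. \<exists>w. (\<forall>j<length ms. w j \<in> W j) \<and> f = (\<Sum>j<length ms. w j)"
      using sum by (rule ballI)
  qed (rule orth)
qed

end

theorem theorem1p1:
  fixes V :: "'n::finite L2 set" and L :: "'n L2 \<Rightarrow> 'n L2"
  assumes "shift_invariant V" and "finitely_generated V" and "V \<noteq> {0}"
    and "shift_preserving V L" and "normal_on V L"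
  shows "\<exists>(m :: nat) (\<Lambda> :: nat \<Rightarrow> 'n L2 \<Rightarrow> 'n L2) (W :: nat \<Rightarrow> 'n L2 set).
    (\<forall>j\<in>{1..m}. s_eigenvalue V L (\<Lambda> j)) \<and>
    (\<forall>j\<in>{1..m}. shift_invariant (W j) \<and> W j \<subseteq> V) \<and>
    (\<forall>i\<in>{1..m}. \<forall>j\<in>{1..m}. i \<noteq> j \<longrightarrow> (\<forall>f\<in>W i. \<forall>g\<in>W j. cinner f g = 0)) \<and>
    V = {\<Sum>j=1..m. f j | f. \<forall>j\<in>{1..m}. f j \<in> W j} \<and>
    (\<forall>f\<in>V. L f = (\<Sum>j=1..m. \<Lambda> j (orth_proj (W j) f))) \<and>
    (\<forall>j\<in>{1..m}. L ` W j \<subseteq> W j \<and> (\<forall>f\<in>W j. L f = \<Lambda> j f))"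
proof -
  interpret normal_shift_preserving_operator V L
    using assms by unfold_locales
  obtain \<Phi> where \<Phi>: "finite \<Phi>" "V = closure (cspan {shift k \<phi> | k \<phi>. \<phi> \<in> \<Phi>})"
    using \<open>finitely_generated V\<close> by (auto simp: finitely_generated_def)
  from spectral_decomposition[OF \<Phi>] obtain ms W where
    ms: "\<forall>m\<in>set ms. periodic_multiplier m \<and> (\<exists>f\<in>V. f \<noteq> 0 \<and> L f = multiplier m f)"
    and W: "\<forall>j<length ms. reducing (W j) \<and> (\<forall>f\<in>W j. L f = multiplier (ms ! j) f)"
    and orth: "\<forall>i<length ms. \<forall>j<length ms. i \<noteq> j \<longrightarrow> (\<forall>f\<in>W i. \<forall>g\<in>W j. cinner f g = 0)"
    and dec: "\<forall>f\<in>V. \<exists>w. (\<forall>j<length ms. w j \<in> W j) \<and> f = (\<Sum>j<length ms. w j)"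
    by (elim exE conjE) (rule that)
  define n where "n = length ms"
  define \<Lambda> where "\<Lambda> = (\<lambda>j. multiplier (ms ! (j - 1)))"
  define W' where "W' = (\<lambda>j. W (j - 1))"
  have idx: "j - 1 < n" if "j \<in> {1..n}" for j
    using that by auto
  have red: "reducing (W' j)" if "j \<in> {1..n}" for j
    unfolding W'_def using W idx[OF that] by (simp add: n_def)
  have W'_in: "f \<in> V" if "j \<in> {1..n}" "f \<in> W' j" for j f
    using reducingD(3)[OF red[OF that(1)]] that(2) by blast
  have LW: "L f = \<Lambda> j f" if "j \<in> {1..n}" "f \<in> W' j" for j f
    using W[rule_format, of "j - 1"] idx[OF that(1)] that(2) by (simp add: W'_def \<Lambda>_def n_def)
  have orth': "cinner f g = 0" if "i \<in> {1..n}" "j \<in> {1..n}" "i \<noteq> j" "f \<in> W' i" "g \<in> W' j" for i j f g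
  proof -
    have "i - 1 < length ms" "j - 1 < length ms" "i - 1 \<noteq> j - 1"
      using that(1-3) by (auto simp: n_def)
    then show ?thesis
      using orth that(4,5) unfolding W'_def by blast
  qed
  have eig: "s_eigenvalue V L (\<Lambda> j)" if "j \<in> {1..n}" for j
  proof -
    have "ms ! (j - 1) \<in> set ms"
      using idx[OF that] by (simp add: n_def)
    with ms have m: "periodic_multiplier (ms ! (j - 1))" "\<exists>f\<in>V. f \<noteq> 0 \<and> L f = \<Lambda> j f"
      by (auto simp: \<Lambda>_def)
    from multiplier_is_Lambda[OF m(1)] have "\<exists>a. bounded_spectrum a \<and> \<Lambda> j = Lambda a"
      by (auto simp: \<Lambda>_def)
    moreover from m(2) have "{f \<in> V. L f = \<Lambda> j f} \<noteq> {0}"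
      by blast
    ultimately show ?thesis
      by (simp add: s_eigenvalue_def)
  qed
  have dec': "\<exists>w. (\<forall>j\<in>{1..n}. w j \<in> W' j) \<and> f = (\<Sum>j=1..n. w j)" if f: "f \<in> V" for f
  proof -
    obtain w where w: "\<forall>j<length ms. w j \<in> W j" "f = (\<Sum>j<length ms. w j)"
      using dec f by blast
    have "(\<Sum>j=1..n. w (j - 1)) = f"
      by (simp add: w(2) n_def sum.atLeast1_atMost_eq)
    then show ?thesis
      using w(1) idx by (intro exI[of _ "\<lambda>j. w (j - 1)"]) (auto simp: W'_def n_def)
  qed
  have V_sum: "V = {\<Sum>j=1..n. f j | f. \<forall>j\<in>{1..n}. f j \<in> W' j}"
  proof
    show "V \<subseteq> {\<Sum>j=1..n. f j | f. \<forall>j\<in>{1..n}. f j \<in> W' j}"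
      using dec' by blast
    show "{\<Sum>j=1..n. f j | f. \<forall>j\<in>{1..n}. f j \<in> W' j} \<subseteq> V"
    proof clarify
      fix f assume "\<forall>j\<in>{1..n}. f j \<in> W' j"
      then show "(\<Sum>j=1..n. f j) \<in> V"
        by (intro L2_complex.subspace_sum[OF subspace]) (use W'_in in blast)
    qed
  qed
  have Lsum: "L f = (\<Sum>j=1..n. \<Lambda> j (orth_proj (W' j) f))" if f: "f \<in> V" for f
  proof -
    obtain w where w: "\<And>j. j \<in> {1..n} \<Longrightarrow> w j \<in> W' j" "f = (\<Sum>j=1..n. w j)"
      using dec'[OF f] by blast
    have proj: "orth_proj (W' j) f = w j" if j: "j \<in> {1..n}" for j
    proof (rule orth_proj_unique[OF reducingD(1)[OF red[OF j]] w(1)[OF j]])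
      fix g assume g: "g \<in> W' j"
      have eq: "f - w j = (\<Sum>i\<in>{1..n} - {j}. w i)"
        unfolding w(2) using j by (subst sum.remove[of _ j]) auto
      show "cinner (f - w j) g = 0"
        unfolding eq cinner_sum_left
        by (rule sum.neutral) (use orth'[OF _ j _ w(1) g] in blast)
    qed
    have "L (\<Sum>j\<in>I. w j) = (\<Sum>j\<in>I. \<Lambda> j (w j))" if "finite I" "I \<subseteq> {1..n}" for I
      using that
    proof (induction I rule: finite_induct)
      case (insert j I)
      have V: "w i \<in> V" if "i \<in> {1..n}" for i
        using w(1)[OF that] by (rule W'_in[OF that])
      then have "(\<Sum>j\<in>I. w j) \<in> V"
        using insert.prems by (intro L2_complex.subspace_sum[OF subspace]) auto
      then show ?case
        using insert V LW w(1) by (simp add: L_add)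
    qed (simp add: L_0)
    then have "L (\<Sum>j=1..n. w j) = (\<Sum>j=1..n. \<Lambda> j (w j))"
      by blast
    also have "\<dots> = (\<Sum>j=1..n. \<Lambda> j (orth_proj (W' j) f))"
      by (rule sum.cong[OF refl]) (simp only: proj)
    finally show ?thesis
      by (simp only: w(2)[symmetric])
  qed
  show ?thesis
  proof (intro exI[of _ n] exI[of _ \<Lambda>] exI[of _ W'] conjI ballI impI)
    fix j assume j: "j \<in> {1..n}"
    show "s_eigenvalue V L (\<Lambda> j)"
      using j by (rule eig)
    show "shift_invariant (W' j)"
      using red[OF j] by (rule reducing_shift_invariant)
    show "W' j \<subseteq> V"
      using W'_in[OF j] by blast
    show "L ` W' j \<subseteq> W' j"
      using reducingD(4)[OF red[OF j]] by blast
    show "L f = \<Lambda> j f" if "f \<in> W' j" for f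
      using j that by (rule LW)
    show "cinner f g = 0" if "i \<in> {1..n}" "i \<noteq> j" "f \<in> W' i" "g \<in> W' j" for i f g
      using that j by (intro orth')
  qed (fact V_sum, fact Lsum)
qed

end
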